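(* Let $p$ be a prime number, let $A$ be a countable torsion-free abelian group and let $B$ be an arbitrary countable abelian group. Then either $r_p(\operatorname{Ext}(A,B)) \leq \aleph_0$ or $r_p(\operatorname{Ext}(A,B)) = 2^{\aleph_0}$.
   Context: $\operatorname{Ext}(A,B)$ denotes $\operatorname{Ext}^1_{\mathbb{Z}}(A,B)$, the group of extensions of $A$ by $B$ in the category of abelian groups. If $A$ is a torsion-free abelian group, then $\operatorname{Ext}(A,B)$ is a divisible group for any abelian group $B$, hence it is of the form $$\operatorname{Ext}(A,B) \cong \bigoplus_{q \in \Pi} \mathbb{Z}(q^{\infty})^{(\nu_q)} \oplus \mathbb{Q}^{(\nu_0)}$$ for uniquely determined cardinals $\nu_0$ and $\nu_q$ ($q \in \Pi$), where $\Pi$ is the set of prime numbers, $\mathbb{Z}(q^{\infty})$ is the $q$-Prüfer group, and $G^{(\nu)}$ denotes the direct sum of $\nu$ copies of $G$. For a prime $p$, the $p$-rank of $\operatorname{Ext}(A,B)$ is the cardinal $r_p(\operatorname{Ext}(A,B)) := \nu_p$. *)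

theory Defs
  imports
    Complex_Main
    "HOL-Library.Countable_Set"
    "HOL-Computational_Algebra.Primes"
    "HOL-Algebra.Product_Groups"
begin

unbundle cardinal_syntax

text \<open>Abelian groups are the multiplicatively written \<^locale>\<open>comm_group\<close>s of HOL-Algebra.\<close>

definition torsion_free :: "('a, 'm) monoid_scheme \<Rightarrow> bool" where
  "torsion_free G \<longleftrightarrow>
     (\<forall>x\<in>carrier G. \<forall>n::nat. n > 0 \<longrightarrow> x [^]\<^bsub>G\<^esub> n = \<one>\<^bsub>G\<^esub> \<longrightarrow> x = \<one>\<^bsub>G\<^esub>)"


section \<open>The group of extensions\<close>

text \<open>The data of \<open>0 \<rightarrow> B \<rightarrow> E \<rightarrow> A \<rightarrow> 0\<close>; exactness is \<open>is_extension\<close> below.\<close>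

record ('a, 'b, 'e) extension =
  middle :: "'e monoid"
  inc :: "'b \<Rightarrow> 'e"
  prj :: "'e \<Rightarrow> 'a"

definition is_extension ::
  "('a, 'm) monoid_scheme \<Rightarrow> ('b, 'n) monoid_scheme \<Rightarrow> ('a, 'b, 'e) extension \<Rightarrow> bool" where
  "is_extension A B E \<longleftrightarrow>
     comm_group (middle E) \<and>
     inc E \<in> mon B (middle E) \<and>
     prj E \<in> epi (middle E) A \<and>
     inc E ` carrier B = kernel (middle E) A (prj E)"

definition ext_equiv ::
  "('b, 'n) monoid_scheme \<Rightarrow> ('a, 'b, 'e) extension \<Rightarrow> ('a, 'b, 'f) extension \<Rightarrow> bool" where
  "ext_equiv B E F \<longleftrightarrow>
     (\<exists>h \<in> iso (middle E) (middle F).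
        (\<forall>b\<in>carrier B. h (inc E b) = inc F b) \<and>
        (\<forall>x\<in>carrier (middle E). prj F (h x) = prj E x))"

definition split_extension ::
  "('a, 'm) monoid_scheme \<Rightarrow> ('b, 'n) monoid_scheme \<Rightarrow> ('a, 'b, 'a \<times> 'b) extension" where
  "split_extension A B =
     \<lparr>middle = A \<times>\<times> B, inc = (\<lambda>b. (\<one>\<^bsub>A\<^esub>, b)), prj = fst\<rparr>"

text \<open>
  The Baer sum: the fibre product of \<open>E\<close> and \<open>F\<close> over \<open>A\<close>, modulo the antidiagonal copy of \<open>B\<close>.
  Both \<^const>\<open>prj\<close>ections agree on the fibre product and are constant on its cosets, so the
  choice of a representative is immaterial.
\<close>

definition fibre_product ::
  "('a, 'b, 'e) extension \<Rightarrow> ('a, 'b, 'f) extension \<Rightarrow> ('e \<times> 'f) monoid" where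
  "fibre_product E F =
     (middle E \<times>\<times> middle F)
       \<lparr>carrier := {(x, y). x \<in> carrier (middle E) \<and> y \<in> carrier (middle F) \<and> prj E x = prj F y}\<rparr>"

definition antidiagonal ::
  "('b, 'n) monoid_scheme \<Rightarrow> ('a, 'b, 'e) extension \<Rightarrow> ('a, 'b, 'f) extension \<Rightarrow> ('e \<times> 'f) set" where
  "antidiagonal B E F = (\<lambda>b. (inc E b, inv\<^bsub>middle F\<^esub> (inc F b))) ` carrier B"

definition baer_sum ::
  "('b, 'n) monoid_scheme \<Rightarrow> ('a, 'b, 'e) extension \<Rightarrow> ('a, 'b, 'f) extension
     \<Rightarrow> ('a, 'b, ('e \<times> 'f) set) extension" where
  "baer_sum B E F =
     \<lparr>middle = fibre_product E F Mod antidiagonal B E F,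
      inc = (\<lambda>b. antidiagonal B E F #>\<^bsub>fibre_product E F\<^esub> (inc E b, \<one>\<^bsub>middle F\<^esub>)),
      prj = (\<lambda>X. prj E (fst (SOME z. z \<in> X)))\<rparr>"

text \<open>
  \<open>Ext(A,B)\<close> is the set of equivalence classes of extensions under the Baer sum.
  Every extension of \<open>A\<close> by \<open>B\<close> has a middle term in bijection with \<open>carrier A \<times> carrier B\<close>,
  hence is equivalent to one whose middle term lives on the type \<^typ>\<open>'a \<times> 'b\<close>. The classes
  therefore consist of extensions on that type; \<open>ext_class\<close> sends an extension on an arbitrary
  type to its class.
\<close>

definition ext_class ::
  "('a, 'm) monoid_scheme \<Rightarrow> ('b, 'n) monoid_scheme \<Rightarrow> ('a, 'b, 'e) extension
     \<Rightarrow> ('a, 'b, 'a \<times> 'b) extension set" where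
  "ext_class A B E = {F. is_extension A B F \<and> ext_equiv B E F}"

definition Ext ::
  "('a, 'm) monoid_scheme \<Rightarrow> ('b, 'n) monoid_scheme
     \<Rightarrow> ('a, 'b, 'a \<times> 'b) extension set monoid" where
  "Ext A B =
     \<lparr>carrier = ext_class A B ` {E :: ('a, 'b, 'a \<times> 'b) extension. is_extension A B E},
      monoid.mult = (\<lambda>X Y. \<Union>E\<in>X. \<Union>F\<in>Y. ext_class A B (baer_sum B E F)),
      one = ext_class A B (split_extension A B)\<rparr>"


section \<open>The \<open>p\<close>-rank of a divisible group\<close>

definition rat_group :: "rat monoid" where
  "rat_group = \<lparr>carrier = UNIV, monoid.mult = (+), one = 0\<rparr>"

text \<open>\<open>\<int>(q\<^sup>\<infinity>) = \<int>[1/q] / \<int>\<close>\<close>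

definition prufer_group :: "nat \<Rightarrow> rat set monoid" where
  "prufer_group q =
     rat_group\<lparr>carrier := {x. \<exists>n. of_nat q ^ n * x \<in> \<int>}\<rparr> Mod \<int>"

definition has_divisible_decomposition ::
  "('g, 'm) monoid_scheme \<Rightarrow> (nat \<Rightarrow> 'i set) \<Rightarrow> 'j set \<Rightarrow> bool" where
  "has_divisible_decomposition G N N0 \<longleftrightarrow>
     G \<cong> sum_group {q. prime q} (\<lambda>q. sum_group (N q) (\<lambda>_. prufer_group q))
          \<times>\<times> sum_group N0 (\<lambda>_. rat_group)"

text \<open>
  The cardinals \<open>\<nu>\<^sub>q\<close>, \<open>\<nu>\<^sub>0\<close> are represented by index sets \<open>N q\<close>, \<open>N0\<close>. These can be
  taken among the subsets of the element type of \<open>G\<close>, since a direct sum of nontrivial groups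
  has at least as many elements as summands. A divisible abelian group has such a decomposition,
  and \<open>N p\<close> is unique up to equipotence, so \<open>p_rank p G\<close> is unique up to \<open>=o\<close>.
\<close>

definition p_rank :: "nat \<Rightarrow> ('g, 'm) monoid_scheme \<Rightarrow> 'g rel" where
  "p_rank p G =
     card_of ((SOME N :: nat \<Rightarrow> 'g set. \<exists>N0 :: 'g set. has_divisible_decomposition G N N0) p)"

end

theory Submission
  imports Defs
    "HOL-Algebra.Free_Abelian_Groups"
    "HOL-Algebra.Multiplicative_Group"
    "HOL-Library.Countable_Set_Type"
begin

text \<open>
  Embed \<open>B\<close> into a countable divisible group \<open>D\<close> and put \<open>I = D/B\<close>. Divisible groups are injective,
  so \<open>Ext(A,B)\<close> is the cokernel of \<open>Hom(A,D) \<rightarrow> Hom(A,I)\<close>. As \<open>A\<close> is torsion-free, \<open>Hom(A,D)\<close> is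
  divisible, and the \<open>p\<close>-torsion of \<open>Ext(A,B)\<close> is the cokernel of \<open>\<pi>\<^sub>*: Hom(A,V) \<rightarrow> Hom(A,W)\<close> with
  \<open>W = I[p]\<close> and \<open>V\<close> its preimage in \<open>D\<close>. Both are Polish groups under pointwise convergence, filtered
  by open subgroups of countable index. If the closure of the image of every basic open subgroup
  is open, then \<open>\<pi>\<^sub>*\<close> is an open map and its cokernel is countable. Otherwise some such closure
  \<open>C\<close> is not open, the quotient by \<open>C\<close> contains a Cantor set, and the image of \<open>\<pi>\<^sub>*\<close> meets only
  countably many cosets of \<open>C\<close>, so the cokernel has the cardinality of the continuum. Finally, \<open>\<nu>\<^sub>p\<close>
  and the \<open>p\<close>-torsion of a divisible group have the same cardinality unless the latter is countable,
  in which case so is \<open>\<nu>\<^sub>p\<close>.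
\<close>

section \<open>Divisible groups\<close>

text \<open>The image of \<open>\<pi>\<^sub>*\<close> need not be closed, so the quotient topology
  of the cokernel need not be Hausdorff and is no place to look for a Cantor set. Closures of images
  of small open subgroups are closed, and countable index keeps the price of this replacement
  countable: the Cantor set maps to the cokernel with countable fibres, which is harmless at the
  cardinality of the continuum. Limits are infinite products whose factors lie in smaller and
  smaller subgroups.

  Torsion-freeness enters through division in Hom groups. If p \<phi> lifts to D, the lift can be
  divided by p and subtracted, so every p-torsion class is represented by a map into the countable
  group W.

  \<open>p_rank\<close> selects its decomposition by choice, hence the rank is controlled by
  estimates valid for every decomposition. Existence of a decomposition is a uniqueness statement: G
  and the sum built on a maximal independent set are divisible hulls of the same group.

  Ext inherits its group laws from Hom(A,I): an extension is recognised by a map of its middle term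
  to D, and Baer sums correspond to products of such maps.\<close>

lemma comm_group_DirProd:
  assumes "comm_group G" "comm_group H"
  shows "comm_group (G \<times>\<times> H)"
proof -
  interpret G: comm_group G by fact
  interpret H: comm_group H by fact
  show ?thesis
    by (rule group.group_comm_groupI) (auto intro: DirProd_group simp: G.m_comm H.m_comm)
qed

lemma int_pow_DirProd:
  assumes "group G" "group H" "x \<in> carrier G" "y \<in> carrier H"
  shows "(x, y) [^]\<^bsub>G \<times>\<times> H\<^esub> (k::int) = (x [^]\<^bsub>G\<^esub> k, y [^]\<^bsub>H\<^esub> k)"
proof -
  have GH: "group (G \<times>\<times> H)"
    by (simp add: DirProd_group assms)
  have "fst ((x, y) [^]\<^bsub>G \<times>\<times> H\<^esub> k) = fst (x, y) [^]\<^bsub>G\<^esub> k"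
    by (rule hom_int_pow) (auto simp: GH assms hom_def)
  moreover have "snd ((x, y) [^]\<^bsub>G \<times>\<times> H\<^esub> k) = snd (x, y) [^]\<^bsub>H\<^esub> k"
    by (rule hom_int_pow) (auto simp: GH assms hom_def)
  ultimately show ?thesis
    by (simp add: prod_eq_iff)
qed

lemma (in comm_group) subgroup_adjoin:
  assumes M: "subgroup M G" and u: "u \<in> carrier G"
  shows "subgroup {w \<otimes> u [^] (k::int) | w k. w \<in> M} G"
proof (rule subgroupI)
  interpret M: subgroup M G by fact
  show "{w \<otimes> u [^] (k::int) | w k. w \<in> M} \<subseteq> carrier G"
    using u by auto
  show "{w \<otimes> u [^] (k::int) | w k. w \<in> M} \<noteq> {}"
    using M.one_closed by blast
  show "inv a \<in> {w \<otimes> u [^] (k::int) | w k. w \<in> M}"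
    if "a \<in> {w \<otimes> u [^] (k::int) | w k. w \<in> M}" for a
  proof -
    from that obtain w and k :: int where "w \<in> M" "a = w \<otimes> u [^] k" by blast
    then have "inv a = inv w \<otimes> u [^] (- k)"
      using u by (simp add: inv_mult int_pow_neg)
    then show ?thesis using \<open>w \<in> M\<close> M.m_inv_closed by blast
  qed
  show "a \<otimes> b \<in> {w \<otimes> u [^] (k::int) | w k. w \<in> M}"
    if "a \<in> {w \<otimes> u [^] (k::int) | w k. w \<in> M}" "b \<in> {w \<otimes> u [^] (k::int) | w k. w \<in> M}" for a b
  proof -
    from that obtain w w' and k k' :: int
      where *: "w \<in> M" "a = w \<otimes> u [^] k" "w' \<in> M" "b = w' \<otimes> u [^] k'" by blast
    then have "a \<otimes> b = (w \<otimes> w') \<otimes> u [^] (k + k')"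
      using u by (simp add: int_pow_mult m_ac)
    then show ?thesis using * M.m_closed by blast
  qed
qed

lemma (in group) subgroup_Union_chain:
  assumes "\<C> \<noteq> {}" "subset.chain \<A> \<C>" "\<And>H. H \<in> \<C> \<Longrightarrow> subgroup H G"
  shows "subgroup (\<Union>\<C>) G"
proof (rule subgroupI)
  show "\<Union>\<C> \<subseteq> carrier G"
    using assms(3) subgroup.subset by blast
  show "\<Union>\<C> \<noteq> {}"
    using assms(1,3) subgroup.one_closed by fastforce
  show "inv a \<in> \<Union>\<C>" if "a \<in> \<Union>\<C>" for a
    using that assms(3) by (meson UnionE UnionI subgroup.m_inv_closed)
  show "a \<otimes> b \<in> \<Union>\<C>" if ab: "a \<in> \<Union>\<C>" "b \<in> \<Union>\<C>" for a b
  proof -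
    obtain H K where HK: "H \<in> \<C>" "K \<in> \<C>" "a \<in> H" "b \<in> K"
      using ab by blast
    with assms(2) have "H \<subseteq> K \<or> K \<subseteq> H"
      by (auto simp: subset_chain_def)
    then show ?thesis
      using HK assms(3) by (meson UnionI subgroup.m_closed subsetD)
  qed
qed

section \<open>Injectivity of divisible groups\<close>

definition divisible :: "('a, 'm) monoid_scheme \<Rightarrow> bool" where
  "divisible G \<longleftrightarrow> (\<forall>x\<in>carrier G. \<forall>n::nat. n > 0 \<longrightarrow> (\<exists>y\<in>carrier G. y [^]\<^bsub>G\<^esub> n = x))"

lemma divisibleD:
  assumes "divisible G" "x \<in> carrier G" "n > 0"
  obtains y where "y \<in> carrier G" "y [^]\<^bsub>G\<^esub> (n::nat) = x"
  using assms by (auto simp: divisible_def)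

text \<open>Division with remainder by the least positive element; the zero group is covered by
  \<open>n = 0\<close>, since 0 divides only 0. \<open>J\<close> will be the set of exponents for
  which a power of a given element lies in a given subgroup or domain.\<close>

lemma least_positive_generates:
  fixes J :: "int set"
  assumes "0 \<in> J" and diff: "\<And>i j. i \<in> J \<Longrightarrow> j \<in> J \<Longrightarrow> i - j \<in> J"
  obtains n :: nat where "int n \<in> J" "\<And>k. k \<in> J \<Longrightarrow> int n dvd k"
proof (cases "J = {0}")
  case True
  then show ?thesis using that[of 0] by auto
next
  case False
  have neg: "- i \<in> J" if "i \<in> J" for i
    using diff[OF assms(1) that] by simp
  have add: "i + j \<in> J" if "i \<in> J" "j \<in> J" for i j
    using diff[OF that(1) neg[OF that(2)]] by simp
  obtain j where "j \<in> J" "j \<noteq> 0"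
    using False assms(1) by blast
  then have ex: "\<exists>n::nat. n > 0 \<and> int n \<in> J"
    using neg by (cases "j > 0") (auto intro!: exI[of _ "nat \<bar>j\<bar>"])
  define n where "n = (LEAST n::nat. n > 0 \<and> int n \<in> J)"
  have n: "n > 0" "int n \<in> J"
    using LeastI_ex[OF ex] by (auto simp: n_def)
  have mult: "int n * int i \<in> J" for i
    by (induction i) (auto simp: assms(1) distrib_left add n(2))
  have mult': "int n * i \<in> J" for i
    using mult[of "nat i"] neg[OF mult[of "nat (- i)"]] by (cases "i \<ge> 0") auto
  have "int n dvd k" if "k \<in> J" for k
  proof -
    have "k mod int n \<in> J"
      using diff[OF that mult'[of "k div int n"]] by (simp add: minus_mult_div_eq_mod)
    moreover have "0 \<le> k mod int n" "k mod int n < int n"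
      using n by auto
    ultimately have "k mod int n = 0"
      using not_less_Least[of "nat (k mod int n)" "\<lambda>n. n > 0 \<and> int n \<in> J"]
      by (fold n_def) force
    then show ?thesis by auto
  qed
  then show ?thesis using that n by blast
qed

text \<open>The extension step in Baer's criterion. \<open>M\<close> is the graph of a homomorphism
  on a subgroup of \<open>G\<close>, and \<open>single\<close> says that it is single-valued. The
  exponents \<open>k\<close> with \<open>g [^] k\<close> in the domain are the multiples of some
  \<open>n\<close>, and \<open>g\<close> is sent to an \<open>n\<close>-th root of the value at
  \<open>g [^] n\<close>.\<close>

lemma partial_hom_adjoin:
  assumes "comm_group G" "comm_group X" "divisible X" "subgroup M (G \<times>\<times> X)"
    and single: "\<And>x. (\<one>\<^bsub>G\<^esub>, x) \<in> M \<Longrightarrow> x = \<one>\<^bsub>X\<^esub>" and g: "g \<in> carrier G"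
  obtains M' where "subgroup M' (G \<times>\<times> X)" "M \<subseteq> M'" "g \<in> fst ` M'"
    "\<And>x. (\<one>\<^bsub>G\<^esub>, x) \<in> M' \<Longrightarrow> x = \<one>\<^bsub>X\<^esub>"
proof -
  interpret G: comm_group G by fact
  interpret X: comm_group X by fact
  interpret P: comm_group "G \<times>\<times> X" by (simp add: comm_group_DirProd assms)
  interpret M: subgroup M "G \<times>\<times> X" by fact
  define J where "J = {k::int. \<exists>y. (g [^]\<^bsub>G\<^esub> k, y) \<in> M}"
  have "0 \<in> J" using M.one_closed by (auto simp: J_def)
  moreover have "i - j \<in> J" if "i \<in> J" "j \<in> J" for i j
  proof -
    from that obtain y z where yz: "(g [^]\<^bsub>G\<^esub> i, y) \<in> M" "(g [^]\<^bsub>G\<^esub> j, z) \<in> M"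
      by (auto simp: J_def)
    then have "(g [^]\<^bsub>G\<^esub> i, y) \<otimes>\<^bsub>G \<times>\<times> X\<^esub> inv\<^bsub>G \<times>\<times> X\<^esub> (g [^]\<^bsub>G\<^esub> j, z) \<in> M"
      by blast
    moreover have "y \<in> carrier X" "z \<in> carrier X" using yz M.subset by auto
    ultimately show ?thesis
      using g by (auto simp: J_def G.int_pow_diff)
  qed
  ultimately obtain n :: nat where n: "int n \<in> J" "\<And>k. k \<in> J \<Longrightarrow> int n dvd k"
    using least_positive_generates by blast
  then obtain y where y: "(g [^]\<^bsub>G\<^esub> n, y) \<in> M" by (auto simp: J_def int_pow_int)
  then have yX: "y \<in> carrier X" using M.subset by auto
  \<comment> \<open>If \<open>n = 0\<close>, no nonzero power of \<open>g\<close> lies in the domain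
    and the value at \<open>g\<close> is free; the trivial one is taken.\<close>
  obtain x where x: "x \<in> carrier X" "x [^]\<^bsub>X\<^esub> n = y"
  proof (cases "n = 0")
    case True
    then have "y = \<one>\<^bsub>X\<^esub>" using y single by simp
    then show ?thesis using True that[of "\<one>\<^bsub>X\<^esub>"] by simp
  next
    case False
    then show ?thesis using divisibleD[OF assms(3) yX] that by auto
  qed
  define M' where "M' = {w \<otimes>\<^bsub>G \<times>\<times> X\<^esub> (g, x) [^]\<^bsub>G \<times>\<times> X\<^esub> (k::int) | w k. w \<in> M}"
  show ?thesis
  proof
    show "subgroup M' (G \<times>\<times> X)"
      unfolding M'_def by (rule P.subgroup_adjoin) (auto simp: assms(4) g x)
    show "M \<subseteq> M'"
    proof
      fix w assume "w \<in> M"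
      then have "w = w \<otimes>\<^bsub>G \<times>\<times> X\<^esub> (g, x) [^]\<^bsub>G \<times>\<times> X\<^esub> (0::int)"
        using M.mem_carrier by (metis P.r_one int_pow_0)
      then show "w \<in> M'" using \<open>w \<in> M\<close> unfolding M'_def by blast
    qed
    have "(g, x) = \<one>\<^bsub>G \<times>\<times> X\<^esub> \<otimes>\<^bsub>G \<times>\<times> X\<^esub> (g, x) [^]\<^bsub>G \<times>\<times> X\<^esub> (1::int)"
      using g x(1) by (simp add: int_pow_DirProd)
    then have "(g, x) \<in> M'" unfolding M'_def using M.one_closed by blast
    then show "g \<in> fst ` M'" by force
    \<comment> \<open>A pair of \<open>M'\<close> over 1 has \<open>a\<close> inverse to
      \<open>g [^] k\<close>, so \<open>g [^] k\<close> is in the domain, \<open>n\<close> divides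
      \<open>k\<close>, and the choice of \<open>x\<close> puts \<open>(g [^] k, x [^] k)\<close>,
      hence the pair itself, into \<open>M\<close>.\<close>
    show "z = \<one>\<^bsub>X\<^esub>" if "(\<one>\<^bsub>G\<^esub>, z) \<in> M'" for z
    proof -
      from that obtain a b and k :: int where k: "(a, b) \<in> M" "\<one>\<^bsub>G\<^esub> = a \<otimes>\<^bsub>G\<^esub> g [^]\<^bsub>G\<^esub> k" "z = b \<otimes>\<^bsub>X\<^esub> x [^]\<^bsub>X\<^esub> k"
        unfolding M'_def using g x(1) by (auto simp: int_pow_DirProd)
      have ab: "a \<in> carrier G" "b \<in> carrier X"
        using k(1) M.subset by auto
      then have "g [^]\<^bsub>G\<^esub> k = inv\<^bsub>G\<^esub> a"
        using k(2) g by (metis G.inv_equality G.int_pow_closed G.m_comm)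
      moreover have "(inv\<^bsub>G\<^esub> a, inv\<^bsub>X\<^esub> b) \<in> M"
        using M.m_inv_closed[OF k(1)] ab by simp
      ultimately have "k \<in> J" by (auto simp: J_def)
      then obtain l where l: "k = int n * l" using n(2) by blast
      have "(g [^]\<^bsub>G\<^esub> n, y) [^]\<^bsub>G \<times>\<times> X\<^esub> l \<in> M"
        using y by (rule P.subgroup_int_pow_closed[OF assms(4)])
      moreover have "(g [^]\<^bsub>G\<^esub> n, y) [^]\<^bsub>G \<times>\<times> X\<^esub> l = (g [^]\<^bsub>G\<^esub> k, x [^]\<^bsub>X\<^esub> k)"
        using g x yX by (simp add: int_pow_DirProd l flip: int_pow_int G.int_pow_pow X.int_pow_pow)
      ultimately have "(a, b) \<otimes>\<^bsub>G \<times>\<times> X\<^esub> (g [^]\<^bsub>G\<^esub> k, x [^]\<^bsub>X\<^esub> k) \<in> M"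
        using k(1) M.m_closed by metis
      then show ?thesis using k single by simp
    qed
  qed
qed

text \<open>A maximal single-valued subgroup above \<open>R\<close> has full domain by the adjoining
  step, so it is the graph of the desired map. Prescribing a relation instead of a map on a subgroup
  allows values to be imposed along a monomorphism or on \<open>n\<close>-th powers.\<close>

lemma partial_hom_extend:
  assumes "comm_group G" "comm_group X" "divisible X" "subgroup R (G \<times>\<times> X)"
    and single: "\<And>x. (\<one>\<^bsub>G\<^esub>, x) \<in> R \<Longrightarrow> x = \<one>\<^bsub>X\<^esub>"
  obtains h where "h \<in> hom G X" "\<And>g x. (g, x) \<in> R \<Longrightarrow> h g = x"
proof -
  interpret G: comm_group G by fact
  interpret X: comm_group X by fact
  interpret P: comm_group "G \<times>\<times> X" by (simp add: comm_group_DirProd assms)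
  define \<A> where "\<A> = {M. subgroup M (G \<times>\<times> X) \<and> R \<subseteq> M \<and> (\<forall>x. (\<one>\<^bsub>G\<^esub>, x) \<in> M \<longrightarrow> x = \<one>\<^bsub>X\<^esub>)}"
  have "\<exists>M\<in>\<A>. \<forall>N\<in>\<A>. M \<subseteq> N \<longrightarrow> N = M"
  proof (rule subset_Zorn_nonempty)
    show "\<A> \<noteq> {}" using assms by (auto simp: \<A>_def)
    show "\<Union>\<C> \<in> \<A>" if "\<C> \<noteq> {}" "subset.chain \<A> \<C>" for \<C>
    proof -
      have "\<C> \<subseteq> \<A>" using that(2) by (auto simp: subset_chain_def)
      then show ?thesis
        using P.subgroup_Union_chain[OF that] that(1) unfolding \<A>_def by blast
    qed
  qed
  then obtain M where M: "M \<in> \<A>" and max: "\<And>N. N \<in> \<A> \<Longrightarrow> M \<subseteq> N \<Longrightarrow> N = M"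
    by blast
  from M have sM: "subgroup M (G \<times>\<times> X)" and RM: "R \<subseteq> M"
    and singleM: "\<And>x. (\<one>\<^bsub>G\<^esub>, x) \<in> M \<Longrightarrow> x = \<one>\<^bsub>X\<^esub>"
    by (auto simp: \<A>_def)
  interpret M: subgroup M "G \<times>\<times> X" by fact
  have total: "\<exists>x. (g, x) \<in> M" if g: "g \<in> carrier G" for g
  proof -
    obtain M' where "subgroup M' (G \<times>\<times> X)" "M \<subseteq> M'" "g \<in> fst ` M'"
      "\<And>x. (\<one>\<^bsub>G\<^esub>, x) \<in> M' \<Longrightarrow> x = \<one>\<^bsub>X\<^esub>"
      using partial_hom_adjoin[OF assms(1-3) sM singleM g] by metis
    then show ?thesis
      using max[of M'] RM by (auto simp: \<A>_def)
  qed
  have unique: "x = y" if "(g, x) \<in> M" "(g, y) \<in> M" for g x y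
  proof -
    have "(g, x) \<otimes>\<^bsub>G \<times>\<times> X\<^esub> inv\<^bsub>G \<times>\<times> X\<^esub> (g, y) \<in> M"
      using that by blast
    moreover have "g \<in> carrier G" "x \<in> carrier X" "y \<in> carrier X"
      using that M.subset by auto
    ultimately show ?thesis
      using singleM[of "x \<otimes>\<^bsub>X\<^esub> inv\<^bsub>X\<^esub> y"] by (simp add: X.inv_solve_right')
  qed
  define h where "h = (\<lambda>g. SOME x. (g, x) \<in> M)"
  have h: "(g, h g) \<in> M" if "g \<in> carrier G" for g
    unfolding h_def using total[OF that] by (rule someI_ex)
  show thesis
  proof
    show "h \<in> hom G X"
    proof (rule homI)
      show "h g \<in> carrier X" if "g \<in> carrier G" for g
        using h[OF that] M.subset by auto
      show "h (a \<otimes>\<^bsub>G\<^esub> b) = h a \<otimes>\<^bsub>X\<^esub> h b" if "a \<in> carrier G" "b \<in> carrier G" for a b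
        using M.m_closed[OF h[OF that(1)] h[OF that(2)]] h[of "a \<otimes>\<^bsub>G\<^esub> b"] that unique by auto
    qed
    show "h g = x" if "(g, x) \<in> R" for g x
      using that RM h[of g] unique[of g] M.subset by auto
  qed
qed

section \<open>Essential subgroups and divisible hulls\<close>

definition essential :: "'a set \<Rightarrow> ('a, 'm) monoid_scheme \<Rightarrow> bool" where
  "essential C G \<longleftrightarrow> (\<forall>x\<in>carrier G. x \<noteq> \<one>\<^bsub>G\<^esub> \<longrightarrow> (\<exists>k::int. x [^]\<^bsub>G\<^esub> k \<in> C \<and> x [^]\<^bsub>G\<^esub> k \<noteq> \<one>\<^bsub>G\<^esub>))"

lemma essential_mono: "essential C G \<Longrightarrow> C \<subseteq> D \<Longrightarrow> essential D G"
  unfolding essential_def by blast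

text \<open>A divisible subgroup splits off, and an essential one leaves no room for a complement.
  Elementwise: with \<open>n\<close> generating the exponents \<open>k\<close> for which
  \<open>g [^] k\<close> lies in \<open>D\<close>, an \<open>n\<close>-th root \<open>d\<close> of
  \<open>g [^] n\<close> inside \<open>D\<close> gives \<open>e\<close>, the quotient of
  \<open>g\<close> by \<open>d\<close>, with trivial \<open>n\<close>-th power. Every power of
  \<open>e\<close> in \<open>D\<close> has exponent divisible by \<open>n\<close>, so it is
  trivial.\<close>

lemma (in comm_group) divisible_essential_subgroup_eq:
  assumes D: "subgroup D G" and div: "divisible (G\<lparr>carrier := D\<rparr>)" and ess: "essential D G"
  shows "D = carrier G"
proof
  interpret D: subgroup D G by fact
  show "D \<subseteq> carrier G" by (rule D.subset)
  show "carrier G \<subseteq> D"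
  proof
    fix g assume g: "g \<in> carrier G"
    have Dpow: "x [^] (k::int) \<in> D" if "x \<in> D" for x k
      using that by (rule subgroup_int_pow_closed[OF D])
    define J where "J = {k::int. g [^] k \<in> D}"
    have "0 \<in> J" by (auto simp: J_def)
    moreover have "i - j \<in> J" if "i \<in> J" "j \<in> J" for i j
      using that g by (auto simp: J_def int_pow_diff)
    ultimately obtain n :: nat where n: "int n \<in> J" "\<And>k. k \<in> J \<Longrightarrow> int n dvd k"
      using least_positive_generates by blast
    show "g \<in> D"
    proof (cases "n = 0")
      \<comment> \<open>Here no nonzero power of \<open>g\<close> lies in \<open>D\<close>, so
        essentiality leaves only the trivial \<open>g\<close>.\<close>
      case True
      then show ?thesis
        using n ess g unfolding essential_def J_def
        by (metis D.one_closed dvd_0_left int_pow_0 mem_Collect_eq of_nat_0)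
    next
      case False
      have "g [^] n \<in> carrier (G\<lparr>carrier := D\<rparr>)" using n(1) by (auto simp: J_def int_pow_int)
      with div False obtain d where "d \<in> carrier (G\<lparr>carrier := D\<rparr>)" "d [^]\<^bsub>G\<lparr>carrier := D\<rparr>\<^esub> n = g [^] n"
        by (elim divisibleD) auto
      then have d: "d \<in> D" "d [^] n = g [^] n"
        by (auto simp flip: nat_pow_consistent)
      define e where "e = g \<otimes> inv d"
      have e: "e \<in> carrier G" using g d by (simp add: e_def)
      have epow: "e [^] k = g [^] k \<otimes> inv (d [^] k)" for k :: int
        unfolding e_def using g d by (simp add: int_pow_distrib int_pow_inv)
      have en: "e [^] int n = \<one>"
        using epow[of "int n"] d g by (simp add: int_pow_int)
      have "e = \<one>"
      proof (rule ccontr)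
        assume "e \<noteq> \<one>"
        then obtain k :: int where k: "e [^] k \<in> D" "e [^] k \<noteq> \<one>"
          using ess e unfolding essential_def by blast
        then have "e [^] k \<otimes> d [^] k \<in> D"
          using Dpow[OF d(1)] by blast
        moreover have "e [^] k \<otimes> d [^] k = g [^] k"
          using epow[of k] g d by (simp add: m_assoc)
        ultimately have "k \<in> J" by (simp add: J_def)
        then obtain l where l: "k = int n * l" using n(2) by blast
        have "e [^] k = (e [^] int n) [^] l"
          using e l by (simp add: int_pow_pow)
        then show False using k en by simp
      qed
      then have "g = d"
        using g d unfolding e_def by (simp add: inv_solve_right')
      then show ?thesis using d by simp
    qed
  qed
qed

lemma divisible_hom_image:
  assumes "group G" "group H" "f \<in> hom G H" "divisible G"
  shows "divisible (H\<lparr>carrier := f ` carrier G\<rparr>)"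
  unfolding divisible_def
proof (intro ballI allI impI)
  fix x and n :: nat
  assume "x \<in> carrier (H\<lparr>carrier := f ` carrier G\<rparr>)" "n > 0"
  then obtain g where "g \<in> carrier G" "x = f g" by auto
  moreover obtain y where "y \<in> carrier G" "y [^]\<^bsub>G\<^esub> n = g"
    using \<open>g \<in> carrier G\<close> \<open>n > 0\<close> assms(4) by (elim divisibleD)
  ultimately show "\<exists>y\<in>carrier (H\<lparr>carrier := f ` carrier G\<rparr>). y [^]\<^bsub>H\<lparr>carrier := f ` carrier G\<rparr>\<^esub> n = x"
    using hom_nat_pow[OF assms(3) \<open>y \<in> carrier G\<close> assms(1,2), of n]
    by (intro bexI[of _ "f y"]) (auto simp flip: monoid.nat_pow_consistent[OF group.is_monoid[OF assms(2)]])
qed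

text \<open>Uniqueness of divisible hulls.\<close>

lemma iso_of_essential_partial_iso:
  assumes "comm_group G" "comm_group X" "divisible G" "divisible X" "subgroup R (G \<times>\<times> X)"
    and single: "\<And>g x. (g, x) \<in> R \<Longrightarrow> g = \<one>\<^bsub>G\<^esub> \<longleftrightarrow> x = \<one>\<^bsub>X\<^esub>"
    and essG: "essential (fst ` R) G" and essX: "essential (snd ` R) X"
  shows "G \<cong> X"
proof -
  interpret G: comm_group G by fact
  interpret X: comm_group X by fact
  obtain h where h: "h \<in> hom G X" "\<And>g x. (g, x) \<in> R \<Longrightarrow> h g = x"
    using partial_hom_extend[OF assms(1,2,4,5)] single by metis
  interpret h: group_hom G X h
    by unfold_locales (rule h)
  have "x = \<one>\<^bsub>G\<^esub>" if x: "x \<in> carrier G" "h x = \<one>\<^bsub>X\<^esub>" for x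
  proof (rule ccontr)
    assume "x \<noteq> \<one>\<^bsub>G\<^esub>"
    then obtain k :: int where k: "x [^]\<^bsub>G\<^esub> k \<in> fst ` R" "x [^]\<^bsub>G\<^esub> k \<noteq> \<one>\<^bsub>G\<^esub>"
      using essG x(1) unfolding essential_def by blast
    then obtain y where y: "(x [^]\<^bsub>G\<^esub> k, y) \<in> R" by auto
    then have "y = h x [^]\<^bsub>X\<^esub> k" using h(2)[OF y] x(1) by (simp add: h.hom_int_pow)
    then show False using x(2) k(2) single[OF y] by simp
  qed
  then have "inj_on h (carrier G)"
    by (simp add: h.inj_on_one_iff)
  moreover have "h ` carrier G = carrier X"
  proof (rule X.divisible_essential_subgroup_eq)
    show "subgroup (h ` carrier G) X"
      by (rule h.img_is_subgroup)
    show "divisible (X\<lparr>carrier := h ` carrier G\<rparr>)"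
      by (rule divisible_hom_image) (auto simp: h assms)
    have "snd ` R \<subseteq> h ` carrier G"
      using h(2) subgroup.subset[OF assms(5)] by force
    then show "essential (h ` carrier G) X"
      by (rule essential_mono[OF essX])
  qed
  ultimately have "h \<in> iso G X"
    using h(1) by (simp add: iso_iff)
  then show ?thesis by (rule is_isoI)
qed

section \<open>Direct sums\<close>

lemma (in comm_group) comm_group_subgroup:
  assumes "subgroup H G" shows "comm_group (G\<lparr>carrier := H\<rparr>)"
proof (rule group.group_comm_groupI)
  interpret H: subgroup H G by fact
  show "group (G\<lparr>carrier := H\<rparr>)" by (rule H.subgroup_is_group) (rule is_group)
qed (use subgroup.subset[OF assms] in \<open>auto intro: m_comm\<close>)

lemma hom_vimage_subgroup:
  assumes "group G" "group H" "f \<in> hom G H" "subgroup K H"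
  shows "subgroup {x \<in> carrier G. f x \<in> K} G"
proof -
  interpret group_hom G H f by (simp add: assms group_hom_def group_hom_axioms_def)
  show ?thesis
    using assms(4) by (auto intro!: G.subgroupI simp: subgroup.m_closed subgroup.m_inv_closed)
      (metis G.one_closed hom_one subgroup.one_closed)
qed

lemma comm_group_sum_group:
  assumes "\<And>i. i \<in> I \<Longrightarrow> comm_group (H i)"
  shows "comm_group (sum_group I H)"
proof (rule group.group_comm_groupI)
  have gr: "\<And>i. i \<in> I \<Longrightarrow> group (H i)"
    using assms comm_group.axioms(2) by blast
  then show "group (sum_group I H)" by simp
  show "x \<otimes>\<^bsub>sum_group I H\<^esub> y = y \<otimes>\<^bsub>sum_group I H\<^esub> x"
    if "x \<in> carrier (sum_group I H)" "y \<in> carrier (sum_group I H)" for x y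
    using that assms by (auto simp: carrier_sum_group gr PiE_iff intro!: restrict_ext comm_groupE(4))
qed

lemma proj_hom_sum_group:
  assumes "\<And>i. i \<in> I \<Longrightarrow> group (H i)" "i \<in> I"
  shows "(\<lambda>x. x i) \<in> hom (sum_group I H) (H i)"
  using assms by (auto simp: hom_def carrier_sum_group)

lemma pow_sum_group:
  assumes "\<And>i. i \<in> I \<Longrightarrow> group (H i)" "i \<in> I" "x \<in> carrier (sum_group I H)"
  shows "(x [^]\<^bsub>sum_group I H\<^esub> (k::int)) i = x i [^]\<^bsub>H i\<^esub> k"
  using hom_int_pow[OF proj_hom_sum_group[OF assms(1,2)] assms(3)] assms by simp

lemma nat_pow_sum_group:
  assumes "\<And>i. i \<in> I \<Longrightarrow> group (H i)" "i \<in> I" "x \<in> carrier (sum_group I H)"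
  shows "(x [^]\<^bsub>sum_group I H\<^esub> (k::nat)) i = x i [^]\<^bsub>H i\<^esub> k"
  using pow_sum_group[OF assms, of k] assms by (simp add: int_pow_int)

lemma sum_group_eqI:
  assumes "\<And>i. i \<in> I \<Longrightarrow> group (H i)" "x \<in> carrier (sum_group I H)" "y \<in> carrier (sum_group I H)"
    "\<And>i. i \<in> I \<Longrightarrow> x i = y i"
  shows "x = y"
  using assms(2-) by (auto simp: carrier_sum_group[OF assms(1)] intro: PiE_ext)

lemma divisible_sum_group:
  assumes gr: "\<And>i. i \<in> I \<Longrightarrow> group (H i)" and div: "\<And>i. i \<in> I \<Longrightarrow> divisible (H i)"
  shows "divisible (sum_group I H)"
  unfolding divisible_def
proof (intro ballI allI impI)
  fix x and n :: nat assume x: "x \<in> carrier (sum_group I H)" and n: "n > 0"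
  \<comment> \<open>The root of a trivial coordinate has to be chosen trivial; otherwise the support
    of the root could become infinite.\<close>
  have "\<exists>y. y \<in> carrier (H i) \<and> y [^]\<^bsub>H i\<^esub> n = x i \<and> (x i = \<one>\<^bsub>H i\<^esub> \<longrightarrow> y = \<one>\<^bsub>H i\<^esub>)" if i: "i \<in> I" for i
  proof (cases "x i = \<one>\<^bsub>H i\<^esub>")
    case True
    then show ?thesis using gr[OF i]
      by (intro exI[of _ "\<one>\<^bsub>H i\<^esub>"]) (simp add: group.is_monoid monoid.nat_pow_one)
  next
    case False
    have "x i \<in> carrier (H i)" using x i by (auto simp: carrier_sum_group gr)
    then show ?thesis using divisibleD[OF div[OF i] _ n] False by metis
  qed
  then obtain y where y: "\<And>i. i \<in> I \<Longrightarrow> y i \<in> carrier (H i)" "\<And>i. i \<in> I \<Longrightarrow> y i [^]\<^bsub>H i\<^esub> n = x i"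
    "\<And>i. i \<in> I \<Longrightarrow> x i = \<one>\<^bsub>H i\<^esub> \<Longrightarrow> y i = \<one>\<^bsub>H i\<^esub>"
    by metis
  define z where "z = restrict y I"
  have "finite {i \<in> I. y i \<noteq> \<one>\<^bsub>H i\<^esub>}"
    by (rule finite_subset[of _ "{i \<in> I. x i \<noteq> \<one>\<^bsub>H i\<^esub>}"]) (use x y in \<open>auto simp: carrier_sum_group gr\<close>)
  then have z: "z \<in> carrier (sum_group I H)"
    using y by (auto simp: carrier_sum_group gr z_def cong: conj_cong)
  moreover have "z [^]\<^bsub>sum_group I H\<^esub> n = x"
  proof (rule sum_group_eqI[OF gr])
    show "z [^]\<^bsub>sum_group I H\<^esub> n \<in> carrier (sum_group I H)"
      using z gr by (simp add: group.is_monoid monoid.nat_pow_closed)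
    show "(z [^]\<^bsub>sum_group I H\<^esub> n) i = x i" if "i \<in> I" for i
      using that y(2) by (simp add: nat_pow_sum_group gr z) (simp add: z_def)
  qed (use x in auto)
  ultimately show "\<exists>y\<in>carrier (sum_group I H). y [^]\<^bsub>sum_group I H\<^esub> n = x" by blast
qed

lemma nat_pow_DirProd:
  assumes "group G" "group H" "x \<in> carrier G" "y \<in> carrier H"
  shows "(x, y) [^]\<^bsub>G \<times>\<times> H\<^esub> (k::nat) = (x [^]\<^bsub>G\<^esub> k, y [^]\<^bsub>H\<^esub> k)"
  using int_pow_DirProd[OF assms, of k] by (simp add: int_pow_int)

lemma divisible_DirProd:
  assumes "group G" "group H" "divisible G" "divisible H"
  shows "divisible (G \<times>\<times> H)"
  unfolding divisible_def
proof (intro ballI allI impI)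
  fix x and n :: nat assume x: "x \<in> carrier (G \<times>\<times> H)" and n: "n > 0"
  obtain a b where ab: "x = (a, b)" "a \<in> carrier G" "b \<in> carrier H" using x by auto
  obtain a' where "a' \<in> carrier G" "a' [^]\<^bsub>G\<^esub> n = a" using divisibleD[OF assms(3) ab(2) n] .
  moreover obtain b' where "b' \<in> carrier H" "b' [^]\<^bsub>H\<^esub> n = b" using divisibleD[OF assms(4) ab(3) n] .
  ultimately show "\<exists>y\<in>carrier (G \<times>\<times> H). y [^]\<^bsub>G \<times>\<times> H\<^esub> n = x"
    by (intro bexI[of _ "(a', b')"]) (auto simp: nat_pow_DirProd assms ab)
qed

definition sum_unit :: "'i set \<Rightarrow> ('i \<Rightarrow> ('b, 'c) monoid_scheme) \<Rightarrow> 'i \<Rightarrow> 'b \<Rightarrow> 'i \<Rightarrow> 'b" where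
  "sum_unit I H i h = (\<lambda>j\<in>I. if j = i then h else \<one>\<^bsub>H j\<^esub>)"

lemma sum_unit_hom:
  assumes "\<And>i. i \<in> I \<Longrightarrow> group (H i)" "i \<in> I"
  shows "sum_unit I H i \<in> hom (H i) (sum_group I H)"
proof (rule homI)
  have [simp]: "\<And>i. i \<in> I \<Longrightarrow> \<one>\<^bsub>H i\<^esub> \<in> carrier (H i)"
    using assms(1) by (simp add: group.is_monoid monoid.one_closed)
  show "sum_unit I H i x \<in> carrier (sum_group I H)" if "x \<in> carrier (H i)" for x
  proof -
    have "{j \<in> I. sum_unit I H i x j \<noteq> \<one>\<^bsub>H j\<^esub>} \<subseteq> {i}"
      by (auto simp: sum_unit_def)
    then have "finite {j \<in> I. sum_unit I H i x j \<noteq> \<one>\<^bsub>H j\<^esub>}"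
      using finite_subset by blast
    then show ?thesis
      using that assms by (auto simp: carrier_sum_group sum_unit_def)
  qed
  show "sum_unit I H i (x \<otimes>\<^bsub>H i\<^esub> y) = sum_unit I H i x \<otimes>\<^bsub>sum_group I H\<^esub> sum_unit I H i y"
    if "x \<in> carrier (H i)" "y \<in> carrier (H i)" for x y
    using that assms by (auto simp: sum_unit_def fun_eq_iff group.is_monoid monoid.l_one)
qed

text \<open>Finite support makes \<open>x\<close> a finite product of its coordinate parts, which
  are collected one at a time.\<close>

lemma mem_subgroup_of_sum_group:
  assumes gr: "\<And>i. i \<in> I \<Longrightarrow> group (H i)" and K: "subgroup K (sum_group I H)"
    and x: "x \<in> carrier (sum_group I H)" and unit: "\<And>i. i \<in> I \<Longrightarrow> sum_unit I H i (x i) \<in> K"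
  shows "x \<in> K"
proof -
  interpret K: subgroup K "sum_group I H" by fact
  have "finite F \<Longrightarrow> F \<subseteq> I \<Longrightarrow> (\<lambda>i\<in>I. if i \<in> F then x i else \<one>\<^bsub>H i\<^esub>) \<in> K" for F
  proof (induction F rule: finite_induct)
    case empty
    then show ?case using K.one_closed by (simp add: restrict_def)
  next
    case (insert i F)
    have eq: "(\<lambda>j\<in>I. if j \<in> insert i F then x j else \<one>\<^bsub>H j\<^esub>)
       = sum_unit I H i (x i) \<otimes>\<^bsub>sum_group I H\<^esub> (\<lambda>j\<in>I. if j \<in> F then x j else \<one>\<^bsub>H j\<^esub>)"
      using insert(2,4) x
      by (auto simp: fun_eq_iff sum_unit_def carrier_sum_group gr PiE_iff group.is_monoid monoid.l_one monoid.r_one)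
    show ?case unfolding eq using insert.prems by (intro K.m_closed insert.IH unit) auto
  qed
  from this[of "{i\<in>I. x i \<noteq> \<one>\<^bsub>H i\<^esub>}"]
  have "(\<lambda>i\<in>I. if i \<in> {i\<in>I. x i \<noteq> \<one>\<^bsub>H i\<^esub>} then x i else \<one>\<^bsub>H i\<^esub>) \<in> K"
    using x by (auto simp: carrier_sum_group gr)
  moreover have "(\<lambda>i\<in>I. if i \<in> {i\<in>I. x i \<noteq> \<one>\<^bsub>H i\<^esub>} then x i else \<one>\<^bsub>H i\<^esub>) = x"
    using x by (auto simp: carrier_sum_group gr PiE_iff extensional_def)
  ultimately show ?thesis by simp
qed

text \<open>Powers repair one bad coordinate at a time. Essentiality in the \<open>i\<close>-th
  factor gives a power that brings coordinate \<open>i\<close> into \<open>K\<close> and keeps it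
  nontrivial; good coordinates stay good because \<open>K\<close> is closed under powers. So the
  number of bad coordinates drops, and with none left the element itself lies in
  \<open>K\<close>.\<close>

lemma essential_sum_group:
  assumes gr: "\<And>i. i \<in> I \<Longrightarrow> group (H i)" and K: "subgroup K (sum_group I H)"
    and ess: "\<And>i. i \<in> I \<Longrightarrow> essential {h \<in> carrier (H i). sum_unit I H i h \<in> K} (H i)"
  shows "essential K (sum_group I H)"
proof -
  interpret S: group "sum_group I H" using gr by simp
  interpret K: subgroup K "sum_group I H" by fact
  let ?bad = "\<lambda>x. {i\<in>I. sum_unit I H i (x i) \<notin> K}"
  have one: "sum_unit I H i \<one>\<^bsub>H i\<^esub> \<in> K" if "i \<in> I" for i
    using hom_one[OF sum_unit_hom[OF gr that] gr[OF that] S.is_group] K.one_closed by simp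
  have fin: "finite (?bad x)" if "x \<in> carrier (sum_group I H)" for x
    by (rule finite_subset[of _ "{i \<in> I. x i \<noteq> \<one>\<^bsub>H i\<^esub>}"])
      (use that one in \<open>auto simp: carrier_sum_group gr\<close>)
  have pow_unit: "sum_unit I H i (h [^]\<^bsub>H i\<^esub> (k::int)) \<in> K"
    if "i \<in> I" "h \<in> carrier (H i)" "sum_unit I H i h \<in> K" for i h k
    using hom_int_pow[OF sum_unit_hom[OF gr that(1)] that(2) gr[OF that(1)] S.is_group]
      S.subgroup_int_pow_closed[OF K that(3)] by simp
  have "\<exists>k::int. x [^]\<^bsub>sum_group I H\<^esub> k \<in> K \<and> x [^]\<^bsub>sum_group I H\<^esub> k \<noteq> \<one>\<^bsub>sum_group I H\<^esub>"
    if "x \<in> carrier (sum_group I H)" "x \<noteq> \<one>\<^bsub>sum_group I H\<^esub>" for x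
    using that
  proof (induction "card (?bad x)" arbitrary: x rule: less_induct)
    case less
    show ?case
    proof (cases "?bad x = {}")
      case True
      then have "x \<in> K" using mem_subgroup_of_sum_group[OF gr K less.prems(1)] by blast
      then show ?thesis using less.prems by (intro exI[of _ 1]) auto
    next
      case False
      then obtain i where i: "i \<in> I" "sum_unit I H i (x i) \<notin> K" by blast
      have xc: "x j \<in> carrier (H j)" if "j \<in> I" for j
        using less.prems(1) that by (auto simp: carrier_sum_group gr)
      have "x i \<noteq> \<one>\<^bsub>H i\<^esub>" using one i by metis
      then obtain k :: int where k: "sum_unit I H i (x i [^]\<^bsub>H i\<^esub> k) \<in> K" "x i [^]\<^bsub>H i\<^esub> k \<noteq> \<one>\<^bsub>H i\<^esub>"
        using ess[OF i(1)] xc[OF i(1)] unfolding essential_def by blast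
      define y where "y = x [^]\<^bsub>sum_group I H\<^esub> k"
      have y: "y \<in> carrier (sum_group I H)" using less.prems(1) by (simp add: y_def)
      have yj: "y j = x j [^]\<^bsub>H j\<^esub> k" if "j \<in> I" for j
        unfolding y_def by (rule pow_sum_group[OF gr that less.prems(1)])
      have "y i \<noteq> \<one>\<^bsub>H i\<^esub>" using yj i k by simp
      then have y1: "y \<noteq> \<one>\<^bsub>sum_group I H\<^esub>" using i by auto
      have "?bad y \<subset> ?bad x"
      proof (rule psubsetI)
        show "?bad y \<subseteq> ?bad x" using yj pow_unit xc by auto
        have "i \<notin> ?bad y" using i k yj by simp
        then show "?bad y \<noteq> ?bad x" using i by blast
      qed
      then have "card (?bad y) < card (?bad x)"
        using fin[OF less.prems(1)] by (rule psubset_card_mono[rotated])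
      then obtain l :: int where l: "y [^]\<^bsub>sum_group I H\<^esub> l \<in> K" "y [^]\<^bsub>sum_group I H\<^esub> l \<noteq> \<one>\<^bsub>sum_group I H\<^esub>"
        using less.hyps y y1 by blast
      have "y [^]\<^bsub>sum_group I H\<^esub> l = x [^]\<^bsub>sum_group I H\<^esub> (k * l)"
        unfolding y_def using less.prems(1) by (simp add: S.int_pow_pow)
      then show ?thesis using l by metis
    qed
  qed
  then show ?thesis unfolding essential_def by blast
qed

text \<open>The same repair with two factors: one power treats the first coordinate without killing
  the pair, and a further one treats the second unless that has already become trivial.\<close>

lemma essential_DirProd:
  assumes "group G" "group H" and K: "subgroup K (G \<times>\<times> H)"
    and essG: "essential {g \<in> carrier G. (g, \<one>\<^bsub>H\<^esub>) \<in> K} G"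
    and essH: "essential {h \<in> carrier H. (\<one>\<^bsub>G\<^esub>, h) \<in> K} H"
  shows "essential K (G \<times>\<times> H)"
  unfolding essential_def
proof (intro ballI impI)
  interpret G: group G by fact
  interpret H: group H by fact
  interpret P: group "G \<times>\<times> H" by (simp add: DirProd_group assms)
  interpret K: subgroup K "G \<times>\<times> H" by fact
  fix x assume x: "x \<in> carrier (G \<times>\<times> H)" "x \<noteq> \<one>\<^bsub>G \<times>\<times> H\<^esub>"
  obtain g h where gh: "x = (g, h)" "g \<in> carrier G" "h \<in> carrier H" using x by auto
  have pw: "x [^]\<^bsub>G \<times>\<times> H\<^esub> k = (g [^]\<^bsub>G\<^esub> k, h [^]\<^bsub>H\<^esub> k)" for k :: int
    using gh by (simp add: int_pow_DirProd assms)
  have "\<exists>k::int. (g [^]\<^bsub>G\<^esub> k, \<one>\<^bsub>H\<^esub>) \<in> K \<and> (g [^]\<^bsub>G\<^esub> k, h [^]\<^bsub>H\<^esub> k) \<noteq> (\<one>\<^bsub>G\<^esub>, \<one>\<^bsub>H\<^esub>)"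
  proof (cases "g = \<one>\<^bsub>G\<^esub>")
    case True
    then show ?thesis using x gh K.one_closed by (intro exI[of _ 1]) auto
  next
    case False
    then show ?thesis using essG gh unfolding essential_def by blast
  qed
  then obtain k :: int where k: "(g [^]\<^bsub>G\<^esub> k, \<one>\<^bsub>H\<^esub>) \<in> K" "(g [^]\<^bsub>G\<^esub> k, h [^]\<^bsub>H\<^esub> k) \<noteq> (\<one>\<^bsub>G\<^esub>, \<one>\<^bsub>H\<^esub>)"
    by blast
  show "\<exists>k::int. x [^]\<^bsub>G \<times>\<times> H\<^esub> k \<in> K \<and> x [^]\<^bsub>G \<times>\<times> H\<^esub> k \<noteq> \<one>\<^bsub>G \<times>\<times> H\<^esub>"
  proof (cases "h [^]\<^bsub>H\<^esub> k = \<one>\<^bsub>H\<^esub>")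
    case True
    then show ?thesis using k pw by (intro exI[of _ k]) auto
  next
    case False
    then obtain l :: int where l: "(\<one>\<^bsub>G\<^esub>, (h [^]\<^bsub>H\<^esub> k) [^]\<^bsub>H\<^esub> l) \<in> K" "(h [^]\<^bsub>H\<^esub> k) [^]\<^bsub>H\<^esub> l \<noteq> \<one>\<^bsub>H\<^esub>"
      using essH gh(3) unfolding essential_def by (metis (mono_tags, lifting) H.int_pow_closed mem_Collect_eq)
    have "(g [^]\<^bsub>G\<^esub> k, \<one>\<^bsub>H\<^esub>) [^]\<^bsub>G \<times>\<times> H\<^esub> l \<in> K"
      by (rule P.subgroup_int_pow_closed[OF K k(1)])
    then have "((g [^]\<^bsub>G\<^esub> k) [^]\<^bsub>G\<^esub> l, \<one>\<^bsub>H\<^esub>) \<in> K"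
      using gh by (simp add: int_pow_DirProd assms)
    from K.m_closed[OF this l(1)] have "x [^]\<^bsub>G \<times>\<times> H\<^esub> (k * l) \<in> K"
      using gh pw by (simp add: G.int_pow_pow H.int_pow_pow)
    moreover have "x [^]\<^bsub>G \<times>\<times> H\<^esub> (k * l) \<noteq> \<one>\<^bsub>G \<times>\<times> H\<^esub>"
      using l gh pw[of "k * l"] by (simp add: H.int_pow_pow)
    ultimately show ?thesis by blast
  qed
qed

section \<open>The rationals as divisible hull of the integers\<close>

lemma rat_group_simps [simp]:
  "carrier rat_group = UNIV" "x \<otimes>\<^bsub>rat_group\<^esub> y = x + y" "\<one>\<^bsub>rat_group\<^esub> = 0"
  by (simp_all add: rat_group_def)

lemma comm_group_rat_group: "comm_group rat_group"
proof (rule group.group_comm_groupI)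
  show "group rat_group"
    by (rule groupI) (auto simp: add.assoc intro: exI[of _ "- x" for x])
qed (simp add: add.commute)

lemma nat_pow_rat_group [simp]: "x [^]\<^bsub>rat_group\<^esub> (n::nat) = of_nat n * x"
  by (induction n) (auto simp: algebra_simps)

lemma inv_rat_group [simp]: "inv\<^bsub>rat_group\<^esub> x = - x"
proof -
  interpret comm_group rat_group by (rule comm_group_rat_group)
  show ?thesis by (rule inv_equality) auto
qed

lemma int_pow_rat_group [simp]: "x [^]\<^bsub>rat_group\<^esub> (k::int) = of_int k * x"
  by (cases k rule: int_cases2) (auto simp: int_pow_def2)

lemma divisible_rat_group: "divisible rat_group"
  unfolding divisible_def
proof (intro ballI allI impI)
  fix x :: rat and n :: nat assume "n > 0"
  then show "\<exists>y\<in>carrier rat_group. y [^]\<^bsub>rat_group\<^esub> n = x"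
    by (intro bexI[of _ "x / of_nat n"]) auto
qed

text \<open>The denominator clears a fraction. The integers appear as powers of 1 because this is
  the form in which a basis element meets its summand in
  \<open>divisible_decomposition_exists\<close>.\<close>

lemma essential_Ints_rat_group: "essential (range (\<lambda>k::int. 1 [^]\<^bsub>rat_group\<^esub> k)) rat_group"
  unfolding essential_def
proof (intro ballI impI)
  fix x :: rat assume x: "x \<noteq> \<one>\<^bsub>rat_group\<^esub>"
  obtain a b where ab: "quotient_of x = (a, b)" by fastforce
  then have "b > 0" "x = of_int a / of_int b"
    using quotient_of_denom_pos quotient_of_div by auto
  then show "\<exists>k::int. x [^]\<^bsub>rat_group\<^esub> k \<in> range (\<lambda>k::int. 1 [^]\<^bsub>rat_group\<^esub> k)
       \<and> x [^]\<^bsub>rat_group\<^esub> k \<noteq> \<one>\<^bsub>rat_group\<^esub>"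
    using x by (intro exI[of _ b]) auto
qed


section \<open>Pruefer groups\<close>

definition prufer_carrier :: "nat \<Rightarrow> rat set" where
  "prufer_carrier q = {x. \<exists>n. of_nat q ^ n * x \<in> \<int>}"

definition prufer_cls :: "nat \<Rightarrow> rat \<Rightarrow> rat set" where
  "prufer_cls q x = \<int> #>\<^bsub>rat_group\<lparr>carrier := prufer_carrier q\<rparr>\<^esub> x"

lemma prufer_group_alt: "prufer_group q = rat_group\<lparr>carrier := prufer_carrier q\<rparr> Mod \<int>"
  by (simp add: prufer_group_def prufer_carrier_def)

lemma subgroup_prufer_carrier: "subgroup (prufer_carrier q) rat_group"
proof -
  interpret comm_group rat_group by (rule comm_group_rat_group)
  show ?thesis
  proof (rule subgroupI)
    show "prufer_carrier q \<noteq> {}"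
      by (auto simp: prufer_carrier_def intro!: exI[of _ 0])
    show "inv\<^bsub>rat_group\<^esub> a \<in> prufer_carrier q" if "a \<in> prufer_carrier q" for a
      using that by (auto simp: prufer_carrier_def)
    show "a \<otimes>\<^bsub>rat_group\<^esub> b \<in> prufer_carrier q" if ab: "a \<in> prufer_carrier q" "b \<in> prufer_carrier q" for a b
    proof -
      obtain m n where mn: "of_nat q ^ m * a \<in> \<int>" "of_nat q ^ n * b \<in> \<int>"
        using ab by (auto simp: prufer_carrier_def)
      have "of_nat q ^ (m + n) * (a + b) = of_nat q ^ n * (of_nat q ^ m * a) + of_nat q ^ m * (of_nat q ^ n * b)"
        by (simp add: power_add algebra_simps)
      also have "\<dots> \<in> \<int>"
        by (rule Ints_add; rule Ints_mult) (use mn in auto)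
      finally show ?thesis by (auto simp: prufer_carrier_def)
    qed
  qed simp
qed

lemma comm_group_prufer_carrier: "comm_group (rat_group\<lparr>carrier := prufer_carrier q\<rparr>)"
  by (rule comm_group.comm_group_subgroup[OF comm_group_rat_group subgroup_prufer_carrier])

lemma Ints_subset_prufer_carrier: "\<int> \<subseteq> prufer_carrier q"
  by (auto simp: prufer_carrier_def intro: exI[of _ 0])

lemma subgroup_Ints_prufer: "subgroup \<int> (rat_group\<lparr>carrier := prufer_carrier q\<rparr>)"
proof -
  interpret comm_group "rat_group\<lparr>carrier := prufer_carrier q\<rparr>" by (rule comm_group_prufer_carrier)
  interpret R: comm_group rat_group by (rule comm_group_rat_group)
  show ?thesis
  proof (rule subgroupI)
    show "inv\<^bsub>rat_group\<lparr>carrier := prufer_carrier q\<rparr>\<^esub> a \<in> \<int>" if "a \<in> \<int>" for a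
      using that Ints_subset_prufer_carrier[of q] R.m_inv_consistent[OF subgroup_prufer_carrier] by force
  qed (use Ints_subset_prufer_carrier[of q] in auto)
qed

lemma comm_group_prufer_group: "comm_group (prufer_group q)"
  unfolding prufer_group_alt
  by (rule comm_group.abelian_FactGroup[OF comm_group_prufer_carrier subgroup_Ints_prufer])

lemma group_prufer_group [simp]: "group (prufer_group q)"
  by (rule comm_group.axioms(2)[OF comm_group_prufer_group])

lemma carrier_prufer_group: "carrier (prufer_group q) = prufer_cls q ` prufer_carrier q"
  by (simp add: prufer_group_alt carrier_FactGroup prufer_cls_def)

lemma prufer_cls_eq_iff: "prufer_cls q x = prufer_cls q y \<longleftrightarrow> x - y \<in> \<int>"
proof
  assume "prufer_cls q x = prufer_cls q y"
  moreover have "x \<in> prufer_cls q x"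
    by (auto simp: prufer_cls_def r_coset_def intro!: bexI[of _ 0])
  ultimately show "x - y \<in> \<int>" by (auto simp: prufer_cls_def r_coset_def)
next
  have *: "prufer_cls q x \<subseteq> prufer_cls q y" if "x - y \<in> \<int>" for x y
  proof
    fix z assume "z \<in> prufer_cls q x"
    then obtain k where "k \<in> \<int>" "z = k + x" by (auto simp: prufer_cls_def r_coset_def)
    then have "z = (k + (x - y)) + y" "k + (x - y) \<in> \<int>" using that by auto
    then show "z \<in> prufer_cls q y" unfolding prufer_cls_def r_coset_def by force
  qed
  assume "x - y \<in> \<int>"
  moreover from this have "y - x \<in> \<int>" by (metis Ints_minus minus_diff_eq)
  ultimately show "prufer_cls q x = prufer_cls q y" using * by blast
qed

lemma one_prufer_group: "\<one>\<^bsub>prufer_group q\<^esub> = prufer_cls q 0"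
  by (auto simp: prufer_group_alt prufer_cls_def r_coset_def)

lemma prufer_cls_eq_one_iff: "prufer_cls q x = \<one>\<^bsub>prufer_group q\<^esub> \<longleftrightarrow> x \<in> \<int>"
  by (simp add: one_prufer_group prufer_cls_eq_iff)

lemma prufer_cls_closed: "x \<in> prufer_carrier q \<Longrightarrow> prufer_cls q x \<in> carrier (prufer_group q)"
  by (simp add: carrier_prufer_group)

lemma prufer_cls_int_pow:
  assumes "x \<in> prufer_carrier q"
  shows "prufer_cls q x [^]\<^bsub>prufer_group q\<^esub> (k::int) = prufer_cls q (of_int k * x)"
proof -
  interpret R: comm_group rat_group by (rule comm_group_rat_group)
  interpret comm_group "rat_group\<lparr>carrier := prufer_carrier q\<rparr>" by (rule comm_group_prufer_carrier)
  interpret normal \<int> "rat_group\<lparr>carrier := prufer_carrier q\<rparr>"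
    by (rule subgroup_imp_normal[OF subgroup_Ints_prufer])
  show ?thesis
    unfolding prufer_group_alt prufer_cls_def
    using FactGroup_int_pow[of x k] assms R.int_pow_consistent[OF subgroup_prufer_carrier assms, of k] by simp
qed

lemma prufer_cls_nat_pow:
  assumes "x \<in> prufer_carrier q"
  shows "prufer_cls q x [^]\<^bsub>prufer_group q\<^esub> (k::nat) = prufer_cls q (of_nat k * x)"
  using prufer_cls_int_pow[OF assms, of "int k"] by (simp add: int_pow_int)

lemma divisible_prufer_group:
  assumes q: "prime q"
  shows "divisible (prufer_group q)"
  unfolding divisible_def
proof (intro ballI allI impI)
  fix x and n :: nat
  assume x: "x \<in> carrier (prufer_group q)" and n: "n > 0"
  obtain r where r: "x = prufer_cls q r" "r \<in> prufer_carrier q"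
    using x by (auto simp: carrier_prufer_group)
  obtain k where "of_nat q ^ k * r \<in> \<int>" using r by (auto simp: prufer_carrier_def)
  then obtain a where a: "of_nat q ^ k * r = of_int a" by (auto elim: Ints_cases)
  have q0: "(of_nat q :: rat) \<noteq> 0" using q by auto
  obtain e m where em: "n = q ^ e * m" "\<not> q dvd m"
    using n q multiplicity_decompose'[of n q] by (metis not_prime_unit neq0_conv mult.commute)
  have "coprime (int m) (int q ^ k)"
    using em(2) q by (metis coprime_commute coprime_int_iff coprime_power_right_iff of_nat_power prime_imp_coprime)
  then obtain u v where uv: "u * int m + v * int q ^ k = 1"
    by (metis coprime_iff_gcd_eq_1 bezout_int)
  have rr: "r = of_int a / of_nat q ^ k" using a q0 by (simp add: field_simps)
  \<comment> \<open>Division by \<open>q ^ e\<close> is done in the rationals; division by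
    \<open>m\<close> is multiplication by \<open>u\<close>, its inverse modulo the denominator
    \<open>q ^ k\<close> of \<open>r\<close>. As \<open>u * m = 1 - v * q ^ k\<close>, the product
    \<open>n * y\<close> misses \<open>r\<close> only by the integer \<open>v * a\<close>.\<close>
  define y :: rat where "y = of_int (u * a) / of_nat q ^ (k + e)"
  have y: "y \<in> prufer_carrier q"
    using q0 by (auto simp: y_def prufer_carrier_def intro!: exI[of _ "k + e"])
  have uv': "of_int u * of_nat m = (1 :: rat) - of_int v * of_nat q ^ k"
    using arg_cong[OF uv, of "of_int :: int \<Rightarrow> rat"] by simp
  have "of_nat n * y = (of_int u * of_nat m) * of_int a / of_nat q ^ k"
    using q0 by (simp add: y_def em(1) power_add field_simps)
  also have "\<dots> = r - of_int (v * a)"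
    unfolding uv' using q0 by (simp add: rr field_simps)
  finally have "prufer_cls q (of_nat n * y) = prufer_cls q r"
    by (simp add: prufer_cls_eq_iff)
  then show "\<exists>y\<in>carrier (prufer_group q). y [^]\<^bsub>prufer_group q\<^esub> n = x"
    using y r by (intro bexI[of _ "prufer_cls q y"]) (auto simp: prufer_cls_nat_pow prufer_cls_closed)
qed

text \<open>A generator of the subgroup of order \<open>q\<close> when \<open>q\<close> is prime;
  every nontrivial subgroup contains it.\<close>

definition prufer_gen :: "nat \<Rightarrow> rat set" where
  "prufer_gen q = prufer_cls q (1 / of_nat q)"

lemma inverse_mem_prufer_carrier: "q > 0 \<Longrightarrow> 1 / of_nat q \<in> prufer_carrier q"
  by (auto simp: prufer_carrier_def intro!: exI[of _ 1])

lemma prufer_gen_closed: "q > 0 \<Longrightarrow> prufer_gen q \<in> carrier (prufer_group q)"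
  by (simp add: prufer_gen_def prufer_cls_closed inverse_mem_prufer_carrier)

lemma prufer_gen_pow_eq_one_iff:
  assumes "q > 0"
  shows "prufer_gen q [^]\<^bsub>prufer_group q\<^esub> (k::int) = \<one>\<^bsub>prufer_group q\<^esub> \<longleftrightarrow> int q dvd k"
proof -
  have "of_int k / of_nat q \<in> (\<int> :: rat set) \<longleftrightarrow> int q dvd k"
  proof
    assume "of_int k / of_nat q \<in> (\<int> :: rat set)"
    then obtain j where "of_int k / of_nat q = (of_int j :: rat)" by (auto elim: Ints_cases)
    then have "of_int k = (of_int (int q * j) :: rat)" using assms by (simp add: field_simps)
    then have "k = int q * j" by (simp only: of_int_eq_iff)
    then show "int q dvd k" by simp
  qed (use assms in auto)
  then show ?thesis
    using assms by (simp add: prufer_gen_def prufer_cls_int_pow inverse_mem_prufer_carrier prufer_cls_eq_one_iff)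
qed

text \<open>Let \<open>n\<close> be least with \<open>q ^ n * r\<close> integral. One factor
  \<open>q\<close> earlier the multiple is \<open>j / q\<close> and not integral, hence a nontrivial
  power of the generator.\<close>

lemma essential_prufer_gen:
  assumes "prime q"
  shows "essential (range (\<lambda>k::int. prufer_gen q [^]\<^bsub>prufer_group q\<^esub> k)) (prufer_group q)"
  unfolding essential_def
proof (intro ballI impI)
  fix x assume x: "x \<in> carrier (prufer_group q)" "x \<noteq> \<one>\<^bsub>prufer_group q\<^esub>"
  obtain r where r: "x = prufer_cls q r" "r \<in> prufer_carrier q"
    using x by (auto simp: carrier_prufer_group)
  have q0: "q > 0" using assms by (simp add: prime_gt_0_nat)
  have rZ: "r \<notin> \<int>" using x r by (simp add: prufer_cls_eq_one_iff)
  define n where "n = (LEAST n. of_nat q ^ n * r \<in> \<int>)"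
  have n: "of_nat q ^ n * r \<in> \<int>"
    unfolding n_def using r(2) by (auto simp: prufer_carrier_def intro: LeastI_ex)
  then have "n \<noteq> 0" using rZ by (intro notI) simp
  then obtain m where m: "n = Suc m" by (cases n) auto
  have "of_nat q ^ m * r \<notin> \<int>"
    using not_less_Least[of m "\<lambda>n. of_nat q ^ n * r \<in> \<int>"] m by (simp add: n_def)
  moreover obtain j where j: "of_nat q ^ n * r = of_int j" using n by (auto elim: Ints_cases)
  moreover have "of_nat q ^ m * r = of_int j * (1 / of_nat q)"
    using j m q0 by (simp add: field_simps)
  ultimately show "\<exists>k::int. x [^]\<^bsub>prufer_group q\<^esub> k \<in> range (\<lambda>k::int. prufer_gen q [^]\<^bsub>prufer_group q\<^esub> k)
       \<and> x [^]\<^bsub>prufer_group q\<^esub> k \<noteq> \<one>\<^bsub>prufer_group q\<^esub>"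
    using r q0 by (intro exI[of _ "int q ^ m"])
      (auto simp: prufer_cls_int_pow prufer_gen_def inverse_mem_prufer_carrier prufer_cls_eq_one_iff)
qed

text \<open>Both \<open>p * r\<close> and some \<open>q ^ k * r\<close> are integers, and a Bezout
  combination of the two is \<open>r\<close>.\<close>

lemma prufer_group_torsion:
  assumes "prime p" "prime q" "p \<noteq> q" "x \<in> carrier (prufer_group q)"
    and "x [^]\<^bsub>prufer_group q\<^esub> p = \<one>\<^bsub>prufer_group q\<^esub>"
  shows "x = \<one>\<^bsub>prufer_group q\<^esub>"
proof -
  obtain r where r: "x = prufer_cls q r" "r \<in> prufer_carrier q"
    using assms by (auto simp: carrier_prufer_group)
  obtain k where k: "of_nat q ^ k * r \<in> \<int>" using r by (auto simp: prufer_carrier_def)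
  have p: "of_nat p * r \<in> \<int>"
    using assms(5) r by (simp add: prufer_cls_nat_pow prufer_cls_eq_one_iff)
  have "coprime (int p) (int q ^ k)"
    using assms primes_coprime[of p q] by simp
  then obtain u v where uv: "u * int p + v * int q ^ k = 1"
    by (metis coprime_iff_gcd_eq_1 bezout_int)
  have "r = of_int (u * int p + v * int q ^ k) * r" by (simp add: uv)
  also have "\<dots> = of_int u * (of_nat p * r) + of_int v * (of_nat q ^ k * r)"
    by (simp add: algebra_simps)
  also have "\<dots> \<in> \<int>" by (rule Ints_add; rule Ints_mult) (use p k in auto)
  finally show ?thesis using r by (simp add: prufer_cls_eq_one_iff)
qed

lemma countable_prufer_group: "countable (carrier (prufer_group q))"
  by (simp add: carrier_prufer_group)


section \<open>Independent elements\<close>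

abbreviation keys where "keys \<equiv> Poly_Mapping.keys"
abbreviation lookup where "lookup \<equiv> Poly_Mapping.lookup"

text \<open>Expanding \<open>x\<close> in generators, every term is sent to a trivial power. This
  turns statements about orders of generators into statements about kernels.\<close>

lemma frag_hom_eq_one:
  assumes "group G" and h: "h \<in> hom (free_Abelian_group S) G" and x: "keys x \<subseteq> S"
    and one: "\<And>s. s \<in> keys x \<Longrightarrow> h (frag_of s) [^]\<^bsub>G\<^esub> lookup x s = \<one>\<^bsub>G\<^esub>"
  shows "h x = \<one>\<^bsub>G\<^esub>"
proof -
  interpret G: group G by fact
  interpret h: group_hom "free_Abelian_group S" G h
    using h by (simp add: group_hom_def group_hom_axioms_def)
  have "h (frag_cmul c (frag_of s)) = h (frag_of s) [^]\<^bsub>G\<^esub> c" if "s \<in> S" for s c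
    using h.hom_int_pow[of "frag_of s" c] that by simp
  then have *: "h (frag_cmul (lookup x s) (frag_of s)) = \<one>\<^bsub>G\<^esub>" if "s \<in> keys x" for s
    using one[OF that] that x by auto
  have "finite F \<Longrightarrow> F \<subseteq> keys x \<Longrightarrow>
     (\<Sum>s\<in>F. frag_cmul (lookup x s) (frag_of s)) \<in> carrier (free_Abelian_group S) \<and>
     h (\<Sum>s\<in>F. frag_cmul (lookup x s) (frag_of s)) = \<one>\<^bsub>G\<^esub>" for F
  proof (induction F rule: finite_induct)
    case empty
    then show ?case using h.hom_one by simp
  next
    case (insert s F)
    then have s: "s \<in> S" using x by auto
    then have c: "frag_cmul (lookup x s) (frag_of s) \<in> carrier (free_Abelian_group S)"
      by (auto dest: subsetD[OF keys_cmul])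
    have d: "(\<Sum>s\<in>F. frag_cmul (lookup x s) (frag_of s)) \<in> carrier (free_Abelian_group S)"
      using insert by simp
    show ?case
      using h.hom_mult[OF c d] insert * h.G.m_closed[OF c d] by simp
  qed
  from this[of "keys x"] have "h (frag_extend frag_of x) = \<one>\<^bsub>G\<^esub>"
    by (simp add: frag_extend_def)
  then show ?thesis by (simp flip: frag_expansion)
qed

text \<open>Removing the \<open>s\<close>-term leaves a combination of generators that
  \<open>h\<close> kills. With \<open>h\<close> a coordinate map, the lemma reads off the
  coefficient of \<open>x\<close> at \<open>s\<close>.\<close>

lemma frag_hom_single_support:
  assumes "comm_group G" and h: "h \<in> hom (free_Abelian_group S) G" and x: "keys x \<subseteq> S"
    and s: "s \<in> S" and one: "\<And>t. t \<in> S \<Longrightarrow> t \<noteq> s \<Longrightarrow> h (frag_of t) = \<one>\<^bsub>G\<^esub>"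
  shows "h x = h (frag_of s) [^]\<^bsub>G\<^esub> lookup x s"
proof -
  interpret G: comm_group G by fact
  interpret h: group_hom "free_Abelian_group S" G h
    using h by (simp add: group_hom_def group_hom_axioms_def)
  define z where "z = frag_cmul (lookup x s) (frag_of s)"
  have z: "z \<in> carrier (free_Abelian_group S)"
    using s by (auto simp: z_def dest: subsetD[OF keys_cmul])
  have hz: "h z = h (frag_of s) [^]\<^bsub>G\<^esub> lookup x s"
    using h.hom_int_pow[of "frag_of s" "lookup x s"] s by (simp add: z_def)
  have y: "x - z \<in> carrier (free_Abelian_group S)"
    using x z by (auto dest: subsetD[OF keys_diff])
  have "s \<notin> keys (x - z)"
    by (simp add: in_keys_iff lookup_minus z_def)
  then have "h (x - z) = \<one>\<^bsub>G\<^esub>"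
    using y one by (intro frag_hom_eq_one[OF G.is_group h]) (auto, metis G.int_pow_one subsetD)
  moreover have "h ((x - z) + z) = h (x - z) \<otimes>\<^bsub>G\<^esub> h z"
    using h.hom_mult[OF y z] by simp
  ultimately show ?thesis using hz s by simp
qed

section \<open>Maximal independent sets\<close>

context comm_group
begin

definition frag_eval :: "('a \<Rightarrow>\<^sub>0 int) \<Rightarrow> 'a" where
  "frag_eval = (SOME h. h \<in> hom (free_Abelian_group (carrier G)) G \<and> (\<forall>x\<in>carrier G. h (frag_of x) = x))"

lemma frag_eval_hom: "frag_eval \<in> hom (free_Abelian_group (carrier G)) G"
  and frag_eval_of: "x \<in> carrier G \<Longrightarrow> frag_eval (frag_of x) = x"
proof -
  have "\<exists>h. h \<in> hom (free_Abelian_group (carrier G)) G \<and> (\<forall>x\<in>carrier G. h (frag_of x) = x)"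
    by (rule free_Abelian_group_universal[of "\<lambda>x. x" "carrier G"]) auto
  from someI_ex[OF this, folded frag_eval_def]
  show "frag_eval \<in> hom (free_Abelian_group (carrier G)) G"
    "x \<in> carrier G \<Longrightarrow> frag_eval (frag_of x) = x" by auto
qed

lemma frag_eval_add:
  assumes "keys x \<subseteq> carrier G" "keys y \<subseteq> carrier G"
  shows "frag_eval (x + y) = frag_eval x \<otimes> frag_eval y"
  using hom_mult[OF frag_eval_hom, of x y] assms by simp

definition frag_independent :: "'a set \<Rightarrow> bool" where
  "frag_independent S \<longleftrightarrow> (\<forall>x. keys x \<subseteq> S \<longrightarrow> frag_eval x = \<one> \<longrightarrow>
     (\<forall>s\<in>S. s [^] lookup x s = \<one>))"

text \<open>Zorn's lemma gives a maximal independent set among the elements of infinite or prime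
  order; these are the orders of 1 in the rationals and of \<open>1 / q\<close> in a Prufer group.
  Some nontrivial power \<open>h\<close> of a given element has such an order, and if
  \<open>h\<close> is not in \<open>S\<close>, the failure of independence of
  \<open>insert h S\<close> expresses a nontrivial power of \<open>h\<close> through
  \<open>S\<close>.\<close>

lemma exists_essential_independent:
  obtains S where "S \<subseteq> carrier G" "\<And>s. s \<in> S \<Longrightarrow> ord s = 0 \<or> prime (ord s)" "frag_independent S"
    "essential (frag_eval ` {x. keys x \<subseteq> S}) G"
proof -
  define T where "T = {s \<in> carrier G. ord s = 0 \<or> prime (ord s)}"
  define \<A> where "\<A> = {S. S \<subseteq> T \<and> frag_independent S}"
  have "\<exists>S\<in>\<A>. \<forall>S'\<in>\<A>. S \<subseteq> S' \<longrightarrow> S' = S"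
  proof (rule subset_Zorn_nonempty)
    have "{} \<in> \<A>" by (auto simp: \<A>_def frag_independent_def)
    then show "\<A> \<noteq> {}" by blast
    fix \<C> assume \<C>: "\<C> \<noteq> {}" "subset.chain \<A> \<C>"
    then have sub: "\<C> \<subseteq> \<A>" by (auto simp: subset_chain_def)
    \<comment> \<open>A relation involves finitely many elements, so it lives in one member of the
      chain.\<close>
    have "s [^] lookup x s = \<one>"
      if x: "keys x \<subseteq> \<Union>\<C>" "frag_eval x = \<one>" and s: "s \<in> \<Union>\<C>" for x s
    proof (cases "s \<in> keys x")
      case True
      obtain S where S: "S \<in> \<C>" "keys x \<subseteq> S"
        using finite_subset_Union_chain[OF finite_keys x(1) \<C>] by blast
      then have "frag_independent S" using sub by (auto simp: \<A>_def)
      then show ?thesis using S x True unfolding frag_independent_def by blast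
    next
      case False
      then show ?thesis by (simp add: in_keys_iff)
    qed
    then show "\<Union>\<C> \<in> \<A>" using sub unfolding \<A>_def frag_independent_def by blast
  qed
  then obtain S where S: "S \<in> \<A>" and max: "\<And>S'. S' \<in> \<A> \<Longrightarrow> S \<subseteq> S' \<Longrightarrow> S' = S" by blast
  have ST: "S \<subseteq> T" and ind: "frag_independent S" using S by (auto simp: \<A>_def)
  have SG: "S \<subseteq> carrier G" using ST by (auto simp: T_def)
  have "essential (frag_eval ` {x. keys x \<subseteq> S}) G"
    unfolding essential_def
  proof (intro ballI impI)
    fix g assume g: "g \<in> carrier G" "g \<noteq> \<one>"
    \<comment> \<open>For finite order, dividing the order by one of its prime factors
      \<open>r\<close> gives the exponent that leaves an element of order \<open>r\<close>.\<close>
    obtain k :: int where k: "g [^] k \<in> T" "g [^] k \<noteq> \<one>"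
    proof (cases "ord g = 0")
      case True
      then show ?thesis using g that[of 1] by (simp add: T_def)
    next
      case False
      moreover have "ord g \<noteq> 1" using g ord_eq_1 by blast
      ultimately obtain r where r: "prime r" "r dvd ord g" using prime_factor_nat by blast
      define d where "d = ord g div r"
      have rd: "ord g = r * d" using r by (simp add: d_def)
      have "ord (g [^] d) = ord g div d"
        using rd False by (intro ord_pow g(1)) auto
      then have o: "ord (g [^] d) = r" using rd False by simp
      then have "g [^] d \<noteq> \<one>" using r by auto
      then show ?thesis using that[of "int d"] o r g by (simp add: T_def int_pow_int)
    qed
    define h where "h = g [^] k"
    have h: "h \<in> T" "h \<noteq> \<one>" "h \<in> carrier G" using k g by (auto simp: h_def)
    obtain m :: int and y where my: "h [^] m = frag_eval y" "keys y \<subseteq> S" "h [^] m \<noteq> \<one>"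
    proof (cases "h \<in> S")
      case True
      then show ?thesis using that[of 1 "frag_of h"] h frag_eval_of by simp
    next
      case False
      then have "insert h S \<notin> \<A>" using max by blast
      then have "\<not> frag_independent (insert h S)" using ST h by (auto simp: \<A>_def)
      then obtain x s where x: "keys x \<subseteq> insert h S" "frag_eval x = \<one>"
        and s: "s \<in> insert h S" "s [^] lookup x s \<noteq> \<one>"
        unfolding frag_independent_def by blast
      define m where "m = lookup x h"
      define y where "y = x - frag_cmul m (frag_of h)"
      have ly: "lookup y t = (if t = h then 0 else lookup x t)" for t
        by (simp add: y_def lookup_minus lookup_frag_of m_def)
      have y: "keys y \<subseteq> S"
      proof
        fix t assume "t \<in> keys y"
        then have "t \<noteq> h" "t \<in> keys x" by (auto simp: in_keys_iff ly split: if_splits)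
        then show "t \<in> S" using x by blast
      qed
      have km: "keys (frag_cmul m (frag_of h)) \<subseteq> carrier G"
        using h by (auto dest: subsetD[OF keys_cmul])
      have evm: "frag_eval (frag_cmul m (frag_of h)) = h [^] m"
        using hom_int_pow[OF frag_eval_hom, of "frag_of h" m] h frag_eval_of by simp
      have evy: "frag_eval y \<in> carrier G"
        using y SG hom_in_carrier[OF frag_eval_hom, of y] by (simp add: subset_trans)
      have "frag_eval (y + frag_cmul m (frag_of h)) = frag_eval y \<otimes> h [^] m"
        using frag_eval_add[OF _ km, of y] y SG evm by auto
      then have ev: "frag_eval y \<otimes> h [^] m = \<one>" using x by (simp add: y_def)
      \<comment> \<open>If the \<open>h\<close>-term were trivial, the remaining terms would form a
        relation in \<open>S\<close>; all of them would be trivial, contrary to the choice of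
        \<open>s\<close>.\<close>
      have "h [^] m \<noteq> \<one>"
      proof
        assume m1: "h [^] m = \<one>"
        then have "frag_eval y = \<one>" using ev evy by simp
        then have all: "\<forall>t\<in>S. t [^] lookup y t = \<one>"
          using ind y unfolding frag_independent_def by blast
        show False
        proof (cases "s = h")
          case True
          then show ?thesis using s m1 by (simp add: m_def)
        next
          case False
          then show ?thesis using s all ly by auto
        qed
      qed
      moreover have "h [^] (- m) = frag_eval y"
        using ev evy h by (metis int_pow_closed int_pow_neg inv_equality)
      moreover have "h [^] (- m) \<noteq> \<one>"
        using \<open>h [^] m \<noteq> \<one>\<close> h by (simp add: int_pow_neg)
      ultimately show ?thesis using that y by blast
    qed
    have "g [^] (k * m) = h [^] m" using g by (simp add: h_def int_pow_pow)
    then show "\<exists>k::int. g [^] k \<in> frag_eval ` {x. keys x \<subseteq> S} \<and> g [^] k \<noteq> \<one>"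
      using my by (intro exI[of _ "k * m"]) auto
  qed
  then show ?thesis
    using that[OF SG _ ind] ST by (auto simp: T_def)
qed

end

section \<open>The structure of divisible groups\<close>

lemma hom_DirProd_left:
  assumes "group G" "group H"
  shows "(\<lambda>x. (x, \<one>\<^bsub>H\<^esub>)) \<in> hom G (G \<times>\<times> H)"
  using assms by (auto simp: hom_def group.is_monoid monoid.l_one monoid.one_closed)

lemma hom_DirProd_right:
  assumes "group G" "group H"
  shows "(\<lambda>y. (\<one>\<^bsub>G\<^esub>, y)) \<in> hom H (G \<times>\<times> H)"
  using assms by (auto simp: hom_def group.is_monoid monoid.l_one monoid.one_closed)

lemma hom_comp: "f \<in> hom G H \<Longrightarrow> g \<in> hom H K \<Longrightarrow> (\<lambda>x. g (f x)) \<in> hom G K"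
  using hom_compose[of f G H g K] by (simp add: o_def)

text \<open>\<open>X\<close> has one copy of the rationals for each basis element of infinite order
  and one Prufer group for each of prime order. Sending a basis element to the standard generator of
  its own summand identifies the span of \<open>S\<close> with a subgroup of \<open>X\<close>. Both
  spans are essential and both groups are divisible, so the identification extends to an
  isomorphism.\<close>

theorem divisible_decomposition_exists:
  fixes G :: "('a, 'm) monoid_scheme"
  assumes "comm_group G" and div: "divisible G"
  obtains N :: "nat \<Rightarrow> 'a set" and N0 :: "'a set" where "has_divisible_decomposition G N N0"
proof -
  interpret G: comm_group G by fact
  obtain S where SG: "S \<subseteq> carrier G" and ordS: "\<And>s. s \<in> S \<Longrightarrow> G.ord s = 0 \<or> prime (G.ord s)"
    and ind: "G.frag_independent S" and essS: "essential (G.frag_eval ` {x. keys x \<subseteq> S}) G"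
    using G.exists_essential_independent by metis
  \<comment> \<open>The basis elements index their own summands, so the index sets live in the
    element type, as \<open>p_rank\<close> demands.\<close>
  define N where "N = (\<lambda>q. {s \<in> S. G.ord s = q})"
  define N0 where "N0 = {s \<in> S. G.ord s = 0}"
  define P where "P = {q::nat. prime q}"
  define T where "T = (\<lambda>q. sum_group (N q) (\<lambda>_. prufer_group q))"
  define TT where "TT = sum_group P T"
  define V where "V = sum_group N0 (\<lambda>_. rat_group)"
  define X where "X = TT \<times>\<times> V"
  have ratg [simp]: "group rat_group" by (rule comm_group.axioms(2)[OF comm_group_rat_group])
  have Tc: "comm_group (T q)" for q
    unfolding T_def by (rule comm_group_sum_group) (rule comm_group_prufer_group)
  then have Tg: "group (T q)" for q using comm_group.axioms(2) by blast
  have TTc: "comm_group TT"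
    unfolding TT_def by (rule comm_group_sum_group) (rule Tc)
  have Vc: "comm_group V"
    unfolding V_def by (rule comm_group_sum_group) (rule comm_group_rat_group)
  interpret TT: comm_group TT by (rule TTc)
  interpret V: comm_group V by (rule Vc)
  interpret X: comm_group X unfolding X_def by (rule comm_group_DirProd[OF TTc Vc])
  have divX: "divisible X"
    unfolding X_def TT_def V_def T_def P_def
    by (intro divisible_DirProd divisible_sum_group) (auto intro: divisible_prufer_group divisible_rat_group)
  define \<phi> where "\<phi> = (\<lambda>q s h. (sum_unit P T q (sum_unit (N q) (\<lambda>_. prufer_group q) s h), \<one>\<^bsub>V\<^esub>))"
  define \<psi> where "\<psi> = (\<lambda>s h. (\<one>\<^bsub>TT\<^esub>, sum_unit N0 (\<lambda>_. rat_group) s h))"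
  have \<phi>: "\<phi> q s \<in> hom (prufer_group q) X" if "q \<in> P" "s \<in> N q" for q s
  proof -
    have c1: "sum_unit (N q) (\<lambda>_. prufer_group q) s \<in> hom (prufer_group q) (T q)"
      unfolding T_def by (rule sum_unit_hom) (auto simp: that)
    have c2: "sum_unit P T q \<in> hom (T q) TT"
      unfolding TT_def by (rule sum_unit_hom) (auto simp: that Tg)
    have c3: "(\<lambda>x. (x, \<one>\<^bsub>V\<^esub>)) \<in> hom TT X"
      unfolding X_def by (rule hom_DirProd_left) auto
    show ?thesis unfolding \<phi>_def by (rule hom_comp[OF hom_comp[OF c1 c2] c3])
  qed
  have \<psi>: "\<psi> s \<in> hom rat_group X" if "s \<in> N0" for s
  proof -
    have c1: "sum_unit N0 (\<lambda>_. rat_group) s \<in> hom rat_group V"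
      unfolding V_def by (rule sum_unit_hom) (auto simp: that)
    have c2: "(\<lambda>y. (\<one>\<^bsub>TT\<^esub>, y)) \<in> hom V X"
      unfolding X_def by (rule hom_DirProd_right) auto
    show ?thesis unfolding \<psi>_def by (rule hom_comp[OF c1 c2])
  qed
  \<comment> \<open>\<open>u s\<close> has the same order as \<open>s\<close>, which is why
    relations transfer in both directions.\<close>
  define u where "u = (\<lambda>s. if G.ord s = 0 then \<psi> s 1 else \<phi> (G.ord s) s (prufer_gen (G.ord s)))"
  have cases: "s \<in> N0 \<and> G.ord s = 0 \<or> G.ord s \<in> P \<and> s \<in> N (G.ord s) \<and> G.ord s > 0" if "s \<in> S" for s
    using ordS[OF that] that prime_gt_0_nat by (auto simp: N_def N0_def P_def)
  have u_closed: "u s \<in> carrier X" if "s \<in> S" for s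
    using cases[OF that] hom_in_carrier[OF \<phi>, of "G.ord s" s "prufer_gen (G.ord s)"] hom_in_carrier[OF \<psi>, of s 1]
    by (auto simp: u_def prufer_gen_closed)
  then obtain hX where hX: "hX \<in> hom (free_Abelian_group S) X" "\<And>s. s \<in> S \<Longrightarrow> hX (frag_of s) = u s"
    using X.free_Abelian_group_universal[of u S] by blast
  have projT: "(\<lambda>z. fst z q s) \<in> hom X (prufer_group q)" if "q \<in> P" "s \<in> N q" for q s
  proof -
    have c1: "fst \<in> hom X TT" by (auto simp: hom_def X_def)
    have c2: "(\<lambda>x. x q) \<in> hom TT (T q)"
      unfolding TT_def by (rule proj_hom_sum_group) (auto simp: that Tg)
    have c3: "(\<lambda>x. x s) \<in> hom (T q) (prufer_group q)"
      unfolding T_def by (rule proj_hom_sum_group) (auto simp: that)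
    show ?thesis by (rule hom_comp[OF hom_comp[OF c1 c2] c3])
  qed
  have projV: "(\<lambda>z. snd z s) \<in> hom X rat_group" if "s \<in> N0" for s
  proof -
    have c1: "snd \<in> hom X V" by (auto simp: hom_def X_def)
    have c2: "(\<lambda>x. x s) \<in> hom V rat_group"
      unfolding V_def by (rule proj_hom_sum_group) (auto simp: that)
    show ?thesis by (rule hom_comp[OF c1 c2])
  qed
  have proj_u_T: "fst (u t) q s = (if t = s then prufer_gen q else \<one>\<^bsub>prufer_group q\<^esub>)"
    if "q \<in> P" "s \<in> N q" "t \<in> S" for q s t
    using that by (auto simp: u_def \<phi>_def \<psi>_def sum_unit_def TT_def T_def N_def P_def)
  have proj_u_V: "snd (u t) s = (if t = s then 1 else 0)" if "s \<in> N0" "t \<in> S" for s t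
    using that by (auto simp: u_def \<phi>_def \<psi>_def sum_unit_def V_def N0_def)
  have coord_T: "fst (hX x) q s = prufer_gen q [^]\<^bsub>prufer_group q\<^esub> lookup x s"
    if "q \<in> P" "s \<in> N q" "keys x \<subseteq> S" for q s x
  proof -
    have sS: "s \<in> S" using that by (simp add: N_def)
    have "(\<lambda>x. fst (hX x) q s) \<in> hom (free_Abelian_group S) (prufer_group q)"
      using hX(1) projT[OF that(1,2)] by (rule hom_comp)
    from frag_hom_single_support[OF comm_group_prufer_group this that(3) sS]
    show ?thesis using sS hX(2) proj_u_T that by auto
  qed
  have coord_V: "snd (hX x) s = of_int (lookup x s)"
    if "s \<in> N0" "keys x \<subseteq> S" for s x
  proof -
    have sS: "s \<in> S" using that by (simp add: N0_def)
    have "(\<lambda>x. snd (hX x) s) \<in> hom (free_Abelian_group S) rat_group"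
      using hX(1) projV[OF that(1)] by (rule hom_comp)
    from frag_hom_single_support[OF comm_group_rat_group this that(2) sS]
    show ?thesis using sS hX(2) proj_u_V that by auto
  qed
  have u_pow: "u s [^]\<^bsub>X\<^esub> k = (if G.ord s = 0 then \<psi> s (of_int k)
       else \<phi> (G.ord s) s (prufer_gen (G.ord s) [^]\<^bsub>prufer_group (G.ord s)\<^esub> k))" if "s \<in> S" for s and k :: int
  proof (cases "G.ord s = 0")
    case True
    then have "s \<in> N0" using that by (simp add: N0_def)
    then show ?thesis
      using hom_int_pow[OF \<psi>, of s 1 k] True by (simp add: u_def)
  next
    case False
    then have "G.ord s \<in> P" "s \<in> N (G.ord s)" "G.ord s > 0" using cases[OF that] by auto
    then show ?thesis
      using hom_int_pow[OF \<phi>, of "G.ord s" s "prufer_gen (G.ord s)" k] False by (simp add: u_def prufer_gen_closed)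
  qed
  have u_pow_one: "u s [^]\<^bsub>X\<^esub> k = \<one>\<^bsub>X\<^esub>" if "s \<in> S" "s [^]\<^bsub>G\<^esub> k = \<one>\<^bsub>G\<^esub>" for s and k :: int
  proof -
    have dv: "int (G.ord s) dvd k" using that SG G.int_pow_eq_id by blast
    show ?thesis
    proof (cases "G.ord s = 0")
      case True
      then show ?thesis using dv by simp
    next
      case False
      then have *: "G.ord s \<in> P" "s \<in> N (G.ord s)" "G.ord s > 0" using cases[OF that(1)] by auto
      then have "\<phi> (G.ord s) s \<one>\<^bsub>prufer_group (G.ord s)\<^esub> = \<one>\<^bsub>X\<^esub>"
        by (intro hom_one[OF \<phi>]) auto
      then show ?thesis
        using False that(1) prufer_gen_pow_eq_one_iff[OF *(3), of k] dv by (simp add: u_pow)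
    qed
  qed
  \<comment> \<open>Parametrising the partial isomorphism by formal combinations reduces
    single-valuedness in either direction to an equality of kernels.\<close>
  define R where "R = (\<lambda>x. (G.frag_eval x, hX x)) ` carrier (free_Abelian_group S)"
  have ev: "G.frag_eval \<in> hom (free_Abelian_group S) G"
    using G.frag_eval_hom SG by (auto simp: hom_def)
  have evhX: "(\<lambda>x. (G.frag_eval x, hX x)) \<in> hom (free_Abelian_group S) (G \<times>\<times> X)"
    using ev hX(1) by (simp add: hom_paired)
  have subR: "subgroup R (G \<times>\<times> X)"
    unfolding R_def
    by (rule group_hom.img_is_subgroup)
       (simp add: group_hom_def group_hom_axioms_def evhX DirProd_group)
  \<comment> \<open>The coordinate of \<open>hX x\<close> in the summand of \<open>s\<close>
    determines the coefficient of \<open>s\<close> up to a multiple of the order of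
    \<open>s\<close>.\<close>
  have pow_one: "s [^]\<^bsub>G\<^esub> lookup x s = \<one>\<^bsub>G\<^esub>"
    if "keys x \<subseteq> S" "hX x = \<one>\<^bsub>X\<^esub>" "s \<in> S" for x s
  proof -
    have "int (G.ord s) dvd lookup x s"
    proof (cases "G.ord s = 0")
      case True
      then have s: "s \<in> N0" using that by (simp add: N0_def)
      then have "snd (hX x) s = 0" using that by (simp add: X_def V_def)
      then show ?thesis using coord_V[OF s that(1)] by simp
    next
      case False
      then have s: "G.ord s \<in> P" "s \<in> N (G.ord s)" "G.ord s > 0" using cases[OF that(3)] by auto
      then have "fst (hX x) (G.ord s) s = \<one>\<^bsub>prufer_group (G.ord s)\<^esub>" using that by (simp add: X_def TT_def T_def)
      then show ?thesis using coord_T[OF s(1,2) that(1)] prufer_gen_pow_eq_one_iff[OF s(3)] by simp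
    qed
    then show ?thesis using that(3) SG G.int_pow_eq_id by blast
  qed
  have "G \<cong> X"
  proof (rule iso_of_essential_partial_iso[OF assms(1) X.comm_group_axioms div divX subR])
    show "g = \<one>\<^bsub>G\<^esub> \<longleftrightarrow> y = \<one>\<^bsub>X\<^esub>" if gy: "(g, y) \<in> R" for g y
    proof -
      obtain x where x: "keys x \<subseteq> S" "g = G.frag_eval x" "y = hX x"
        using gy by (auto simp: R_def)
      show ?thesis
      proof
        assume "g = \<one>\<^bsub>G\<^esub>"
        then have "\<forall>s\<in>S. s [^]\<^bsub>G\<^esub> lookup x s = \<one>\<^bsub>G\<^esub>"
          using ind x(1,2) by (simp add: G.frag_independent_def)
        then show "y = \<one>\<^bsub>X\<^esub>"
          unfolding x(3) using x(1) hX(2) u_pow_one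
          by (intro frag_hom_eq_one[OF X.is_group hX(1) x(1)]) (auto simp: subset_iff)
      next
        assume "y = \<one>\<^bsub>X\<^esub>"
        then show "g = \<one>\<^bsub>G\<^esub>"
          unfolding x(2) using x pow_one SG
          by (intro frag_hom_eq_one[OF G.is_group ev x(1)]) (auto simp: G.frag_eval_of subset_iff)
      qed
    qed
    have "fst ` R = G.frag_eval ` {x. keys x \<subseteq> S}"
      by (force simp: R_def)
    then show "essential (fst ` R) G" using essS by simp
    define K where "K = snd ` R"
    have Keq: "K = hX ` carrier (free_Abelian_group S)" by (force simp: K_def R_def)
    have K: "subgroup K X"
      unfolding Keq by (rule group_hom.img_is_subgroup)
        (simp add: group_hom_def group_hom_axioms_def hX)
    have u_pow_K: "u s [^]\<^bsub>X\<^esub> k \<in> K" if "s \<in> S" for s and k :: int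
    proof -
      have "u s \<in> K"
        unfolding Keq by (rule image_eqI[of _ _ "frag_of s"]) (simp_all add: that hX(2))
      then show ?thesis by (rule X.subgroup_int_pow_closed[OF K])
    qed
    define K1 where "K1 = {t \<in> carrier TT. (t, \<one>\<^bsub>V\<^esub>) \<in> K}"
    have K1: "subgroup K1 TT"
      unfolding K1_def using hom_DirProd_left[of TT V] K
      by (intro hom_vimage_subgroup[of TT X]) (auto simp: X_def DirProd_group)
    \<comment> \<open>Essentiality is pulled back through the nested sums to a single summand, where
      the powers of one generator are essential.\<close>
    have "essential K1 TT"
      unfolding TT_def
    proof (rule essential_sum_group)
      show "subgroup K1 (sum_group P T)" using K1 by (simp add: TT_def)
      fix q assume q: "q \<in> P"
      define K2 where "K2 = {y \<in> carrier (T q). sum_unit P T q y \<in> K1}"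
      have unitTT: "sum_unit P T q \<in> hom (T q) TT"
        unfolding TT_def by (rule sum_unit_hom) (auto simp: q Tg)
      have K2: "subgroup K2 (T q)"
        unfolding K2_def by (rule hom_vimage_subgroup[OF Tg TT.is_group unitTT K1])
      have "essential K2 (T q)"
        unfolding T_def
      proof (rule essential_sum_group)
        show "subgroup K2 (sum_group (N q) (\<lambda>_. prufer_group q))" using K2 by (simp add: T_def)
        fix s assume s: "s \<in> N q"
        have sS: "s \<in> S" "G.ord s = q" using s by (auto simp: N_def)
        have q0: "q > 0" using q by (simp add: P_def prime_gt_0_nat)
        have unitT: "sum_unit (N q) (\<lambda>_. prufer_group q) s \<in> hom (prufer_group q) (T q)"
          unfolding T_def by (rule sum_unit_hom) (auto simp: s)
        have gen: "prufer_gen q [^]\<^bsub>prufer_group q\<^esub> (k::int) \<in> carrier (prufer_group q)" for k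
          by (simp add: group.int_pow_closed prufer_gen_closed q0)
        have "\<phi> q s (prufer_gen q [^]\<^bsub>prufer_group q\<^esub> (k::int)) \<in> K" for k
          using u_pow_K[OF sS(1), of k] u_pow[OF sS(1), of k] sS q0 by simp
        then have "range (\<lambda>k::int. prufer_gen q [^]\<^bsub>prufer_group q\<^esub> k)
           \<subseteq> {h \<in> carrier (prufer_group q). sum_unit (N q) (\<lambda>_. prufer_group q) s h \<in> K2}"
          using hom_in_carrier[OF unitT] hom_in_carrier[OF unitTT] gen
          by (auto simp: K2_def K1_def \<phi>_def)
        then show "essential {h \<in> carrier (prufer_group q). sum_unit (N q) (\<lambda>_. prufer_group q) s h \<in> K2} (prufer_group q)"
          by (rule essential_mono[OF essential_prufer_gen, rotated]) (use q in \<open>simp add: P_def\<close>)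
      qed auto
      then show "essential {h \<in> carrier (T q). sum_unit P T q h \<in> K1} (T q)"
        by (simp add: K2_def)
    qed (rule Tg)
    moreover have "essential {h \<in> carrier V. (\<one>\<^bsub>TT\<^esub>, h) \<in> K} V"
      unfolding V_def
    proof (rule essential_sum_group)
      define K1' where "K1' = {v \<in> carrier V. (\<one>\<^bsub>TT\<^esub>, v) \<in> K}"
      have K1': "subgroup K1' V"
        unfolding K1'_def using hom_DirProd_right[of TT V] K
        by (intro hom_vimage_subgroup[of V X]) (auto simp: X_def DirProd_group)
      then show "subgroup {h \<in> carrier (sum_group N0 (\<lambda>_. rat_group)). (\<one>\<^bsub>TT\<^esub>, h) \<in> K} (sum_group N0 (\<lambda>_. rat_group))"
        by (simp add: K1'_def V_def)
      fix s assume s: "s \<in> N0"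
      then have sS: "s \<in> S" "G.ord s = 0" by (auto simp: N0_def)
      have unitV: "sum_unit N0 (\<lambda>_. rat_group) s \<in> hom rat_group V"
        unfolding V_def by (rule sum_unit_hom) (auto simp: s)
      have "\<psi> s (1 [^]\<^bsub>rat_group\<^esub> (k::int)) \<in> K" for k
        using u_pow_K[OF sS(1), of k] u_pow[OF sS(1), of k] sS by simp
      then have "range (\<lambda>k::int. 1 [^]\<^bsub>rat_group\<^esub> k) \<subseteq>
         {h \<in> carrier rat_group. sum_unit N0 (\<lambda>_. rat_group) s h \<in> {h \<in> carrier V. (\<one>\<^bsub>TT\<^esub>, h) \<in> K}}"
        using hom_in_carrier[OF unitV] by (auto simp: \<psi>_def)
      then show "essential {h \<in> carrier rat_group. sum_unit N0 (\<lambda>_. rat_group) s h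
            \<in> {h \<in> carrier (sum_group N0 (\<lambda>_. rat_group)). (\<one>\<^bsub>TT\<^esub>, h) \<in> K}} rat_group"
        using essential_Ints_rat_group by (auto intro: essential_mono simp: V_def)
    qed auto
    ultimately show "essential (snd ` R) X"
      unfolding K_def[symmetric] X_def using K
      by (intro essential_DirProd) (auto simp: K1_def X_def)
  qed
  then have "has_divisible_decomposition G N N0"
    by (simp add: has_divisible_decomposition_def X_def TT_def T_def V_def P_def)
  then show ?thesis by (rule that)
qed

section \<open>Ranks and torsion\<close>

text \<open>An element is determined by the finite graph of its nontrivial values.\<close>

lemma card_of_sum_group:
  assumes gr: "\<And>i. i \<in> I \<Longrightarrow> group (H i)"
  shows "|carrier (sum_group I H)| \<le>o |Fpow (SIGMA i:I. carrier (H i))|"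
proof (rule card_of_ordLeqI)
  let ?f = "\<lambda>x. {(i, x i) | i. i \<in> I \<and> x i \<noteq> \<one>\<^bsub>H i\<^esub>}"
  show "inj_on ?f (carrier (sum_group I H))"
  proof (rule inj_onI)
    fix x y assume xy: "x \<in> carrier (sum_group I H)" "y \<in> carrier (sum_group I H)" and eq: "?f x = ?f y"
    show "x = y"
    proof (rule sum_group_eqI[OF gr xy])
      fix i assume i: "i \<in> I"
      have "x i = y i" if "x i \<noteq> \<one>\<^bsub>H i\<^esub>"
      proof -
        have "(i, x i) \<in> ?f x" using that i by blast
        then show ?thesis unfolding eq by auto
      qed
      moreover have "x i = y i" if "y i \<noteq> \<one>\<^bsub>H i\<^esub>"
      proof -
        have "(i, y i) \<in> ?f y" using that i by blast
        then show ?thesis unfolding eq[symmetric] by auto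
      qed
      ultimately show "x i = y i" by metis
    qed
  qed
  show "?f x \<in> Fpow (SIGMA i:I. carrier (H i))" if "x \<in> carrier (sum_group I H)" for x
  proof -
    have "?f x = (\<lambda>i. (i, x i)) ` {i \<in> I. x i \<noteq> \<one>\<^bsub>H i\<^esub>}" by auto
    then show ?thesis using that by (auto simp: Fpow_def carrier_sum_group gr)
  qed
qed

lemma countable_Fpow: "countable A \<Longrightarrow> countable (Fpow A)"
  using countable_Collect_finite_subset[of A] by (simp add: Fpow_def conj_commute)

lemma countable_ordLeq: "|A| \<le>o |B| \<Longrightarrow> countable B \<Longrightarrow> countable A"
proof -
  assume "|A| \<le>o |B|" "countable B"
  then obtain f where f: "inj_on f A" "f ` A \<subseteq> B" using card_of_ordLeq[of A B] by auto
  then have "countable (f ` A)" using \<open>countable B\<close> countable_subset by blast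
  then show "countable A" using f(1) by (rule countable_image_inj_on)
qed

lemma countable_sum_group:
  assumes "\<And>i. i \<in> I \<Longrightarrow> group (H i)" "countable I" "\<And>i. i \<in> I \<Longrightarrow> countable (carrier (H i))"
  shows "countable (carrier (sum_group I H))"
  by (rule countable_ordLeq[OF card_of_sum_group[OF assms(1)]]) (auto intro!: countable_Fpow simp: assms)

section \<open>Comparison of the p-rank with the p-torsion\<close>

definition torsion_part :: "nat \<Rightarrow> ('a, 'm) monoid_scheme \<Rightarrow> 'a set" where
  "torsion_part p G = {x \<in> carrier G. x [^]\<^bsub>G\<^esub> p = \<one>\<^bsub>G\<^esub>}"

text \<open>The rationals and the Prufer groups of other primes have no \<open>p\<close>-torsion, so
  the \<open>p\<close>-component is injective on the torsion part; conversely each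
  \<open>p\<close>-Prufer summand contributes its generator of order \<open>p\<close>. The crude
  upper bound by the whole \<open>p\<close>-component is enough, because exact cardinalities matter
  only in the uncountable case.\<close>

lemma torsion_part_sums:
  fixes N :: "nat \<Rightarrow> 'i set" and N0 :: "'j set"
  assumes p: "prime p"
  defines "X \<equiv> sum_group {q. prime q} (\<lambda>q. sum_group (N q) (\<lambda>_. prufer_group q)) \<times>\<times> sum_group N0 (\<lambda>_. rat_group)"
  shows "|N p| \<le>o |torsion_part p X|"
    and "|torsion_part p X| \<le>o |carrier (sum_group (N p) (\<lambda>_. prufer_group p))|"
proof -
  define T where "T = (\<lambda>q. sum_group (N q) (\<lambda>_. prufer_group q))"
  define TT where "TT = sum_group {q. prime q} T"
  define V where "V = sum_group N0 (\<lambda>_. rat_group)"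
  have X: "X = TT \<times>\<times> V" by (simp add: X_def TT_def T_def V_def)
  have ratg [simp]: "group rat_group" by (rule comm_group.axioms(2)[OF comm_group_rat_group])
  have Tg: "group (T q)" for q by (simp add: T_def)
  interpret TT: group TT by (simp add: TT_def Tg)
  interpret V: group V by (simp add: V_def)
  interpret X: group X unfolding X by (simp add: DirProd_group)
  have p0: "p > 0" using p by (simp add: prime_gt_0_nat)
  let ?f = "\<lambda>s. (sum_unit {q. prime q} T p (sum_unit (N p) (\<lambda>_. prufer_group p) s (prufer_gen p)), \<one>\<^bsub>V\<^esub>)"
  show "|N p| \<le>o |torsion_part p X|"
  proof (rule card_of_ordLeqI)
    show "inj_on ?f (N p)"
    proof (rule inj_onI)
      fix s t assume st: "s \<in> N p" "t \<in> N p" "?f s = ?f t"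
      then have "fst (?f s) p s = fst (?f t) p s" by simp
      then have eq: "prufer_gen p = (if s = t then prufer_gen p else \<one>\<^bsub>prufer_group p\<^esub>)"
        using p st by (simp add: sum_unit_def)
      have "prufer_gen p \<noteq> \<one>\<^bsub>prufer_group p\<^esub>"
        using prufer_gen_pow_eq_one_iff[OF p0, of 1] prufer_gen_closed[OF p0] p
        by (auto simp: group.int_pow_1)
      then show "s = t" using eq by metis
    qed
    fix s assume s: "s \<in> N p"
    have c1: "sum_unit (N p) (\<lambda>_. prufer_group p) s \<in> hom (prufer_group p) (T p)"
      unfolding T_def by (rule sum_unit_hom) (auto simp: s)
    have c2: "sum_unit {q. prime q} T p \<in> hom (T p) TT"
      unfolding TT_def by (rule sum_unit_hom) (auto simp: p Tg)
    have c3: "(\<lambda>x. (x, \<one>\<^bsub>V\<^esub>)) \<in> hom TT X"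
      unfolding X by (rule hom_DirProd_left) auto
    have h: "(\<lambda>h. (sum_unit {q. prime q} T p (sum_unit (N p) (\<lambda>_. prufer_group p) s h), \<one>\<^bsub>V\<^esub>)) \<in> hom (prufer_group p) X"
      by (rule hom_comp[OF hom_comp[OF c1 c2] c3])
    have "prufer_gen p [^]\<^bsub>prufer_group p\<^esub> p = \<one>\<^bsub>prufer_group p\<^esub>"
      using prufer_gen_pow_eq_one_iff[OF p0, of "int p"] by (simp add: int_pow_int)
    then have "?f s [^]\<^bsub>X\<^esub> p = \<one>\<^bsub>X\<^esub>"
      using hom_nat_pow[OF h prufer_gen_closed[OF p0], of p] hom_one[OF h] by simp
    then show "?f s \<in> torsion_part p X"
      using hom_in_carrier[OF h prufer_gen_closed[OF p0]] by (simp add: torsion_part_def)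
  qed
  show "|torsion_part p X| \<le>o |carrier (sum_group (N p) (\<lambda>_. prufer_group p))|"
  proof (rule card_of_ordLeqI)
    have tor: "fst x q s = \<one>\<^bsub>prufer_group q\<^esub>"
      if x: "x \<in> torsion_part p X" and q: "prime q" "q \<noteq> p" "s \<in> N q" for x q s
    proof -
      have xc: "fst x \<in> carrier TT" "fst x [^]\<^bsub>TT\<^esub> p = \<one>\<^bsub>TT\<^esub>"
        using x nat_pow_DirProd[of TT V "fst x" "snd x" p] by (auto simp: torsion_part_def X)
      have xq: "fst x q \<in> carrier (T q)" using xc(1) q by (auto simp: TT_def carrier_sum_group Tg)
      then have xs: "fst x q s \<in> carrier (prufer_group q)" using q by (auto simp: T_def carrier_sum_group)
      have "fst x q [^]\<^bsub>T q\<^esub> p = \<one>\<^bsub>T q\<^esub>"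
        using nat_pow_sum_group[of "{q. prime q}" T q "fst x" p] xc q by (simp add: Tg TT_def)
      then have "fst x q s [^]\<^bsub>prufer_group q\<^esub> p = \<one>\<^bsub>prufer_group q\<^esub>"
        using nat_pow_sum_group[of "N q" "\<lambda>_. prufer_group q" s "fst x q" p] xq q by (simp add: T_def)
      then show ?thesis using prufer_group_torsion[OF p q(1)] q xs by auto
    qed
    have torV: "snd x s = 0" if x: "x \<in> torsion_part p X" and s: "s \<in> N0" for x s
    proof -
      have xc: "snd x \<in> carrier V" "snd x [^]\<^bsub>V\<^esub> p = \<one>\<^bsub>V\<^esub>"
        using x nat_pow_DirProd[of TT V "fst x" "snd x" p] by (auto simp: torsion_part_def X)
      have "snd x s [^]\<^bsub>rat_group\<^esub> p = 0"
        using nat_pow_sum_group[of N0 "\<lambda>_. rat_group" s "snd x" p] xc s by (simp add: V_def)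
      then show ?thesis using p0 by simp
    qed
    show "inj_on (\<lambda>x. fst x p) (torsion_part p X)"
    proof (rule inj_onI)
      fix x y assume xy: "x \<in> torsion_part p X" "y \<in> torsion_part p X" "fst x p = fst y p"
      have c: "fst x \<in> carrier TT" "fst y \<in> carrier TT" "snd x \<in> carrier V" "snd y \<in> carrier V"
        using xy by (auto simp: torsion_part_def X)
      have "fst x = fst y"
      proof (rule sum_group_eqI[of "{q. prime q}" T])
        fix q :: nat assume q: "q \<in> {q. prime q}"
        show "fst x q = fst y q"
        proof (cases "q = p")
          case False
          show ?thesis
          proof (rule sum_group_eqI[of "N q" "\<lambda>_. prufer_group q"])
            have "fst x q \<in> carrier (T q)" "fst y q \<in> carrier (T q)"
              using c q by (auto simp: TT_def carrier_sum_group Tg)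
            then show "fst x q \<in> carrier (sum_group (N q) (\<lambda>_. prufer_group q))"
              "fst y q \<in> carrier (sum_group (N q) (\<lambda>_. prufer_group q))"
              by (simp_all add: T_def)
          qed (use tor[OF xy(1)] tor[OF xy(2)] q False in auto)
        qed (use xy in simp)
      qed (use c in \<open>auto simp: Tg TT_def\<close>)
      moreover have "snd x = snd y"
        by (rule sum_group_eqI[of N0 "\<lambda>_. rat_group"]) (use c torV xy in \<open>auto simp: V_def\<close>)
      ultimately show "x = y" by (simp add: prod_eq_iff)
    qed
    show "fst x p \<in> carrier (sum_group (N p) (\<lambda>_. prufer_group p))" if "x \<in> torsion_part p X" for x
    proof -
      have "fst x p \<in> carrier (T p)"
        using that p by (auto simp: torsion_part_def X TT_def carrier_sum_group Tg)
      then show ?thesis by (simp add: T_def)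
    qed
  qed
qed

lemma torsion_part_iso:
  assumes "group G" "group H" "f \<in> iso G H"
  shows "bij_betw f (torsion_part p G) (torsion_part p H)"
proof -
  have hom: "f \<in> hom G H" and inj: "inj_on f (carrier G)" and im: "f ` carrier G = carrier H"
    using assms(3) by (auto simp: iso_iff)
  have pw: "f x [^]\<^bsub>H\<^esub> p = \<one>\<^bsub>H\<^esub> \<longleftrightarrow> x [^]\<^bsub>G\<^esub> p = \<one>\<^bsub>G\<^esub>" if "x \<in> carrier G" for x
    using hom_nat_pow[OF hom that assms(1,2), of p] hom_one[OF hom assms(1,2)] inj that
    by (metis assms(1) group.is_monoid inj_on_eq_iff monoid.nat_pow_closed monoid.one_closed)
  show ?thesis
    unfolding bij_betw_def
  proof
    show "inj_on f (torsion_part p G)"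
      using inj by (rule inj_on_subset) (auto simp: torsion_part_def)
    show "f ` torsion_part p G = torsion_part p H"
      using pw im by (force simp: torsion_part_def)
  qed
qed

lemma torsion_part_decomposition:
  assumes G: "group G" and dec: "has_divisible_decomposition G N N0" and p: "prime p"
  shows "|N p| \<le>o |torsion_part p G|"
    and "|torsion_part p G| \<le>o |carrier (sum_group (N p) (\<lambda>_. prufer_group p))|"
proof -
  let ?X = "sum_group {q. prime q} (\<lambda>q. sum_group (N q) (\<lambda>_. prufer_group q)) \<times>\<times> sum_group N0 (\<lambda>_. rat_group)"
  obtain f where f: "f \<in> iso G ?X"
    using dec by (auto simp: has_divisible_decomposition_def is_iso_def)
  have ratg [simp]: "group rat_group" by (rule comm_group.axioms(2)[OF comm_group_rat_group])
  have "group ?X" by (intro DirProd_group sum_group) auto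
  then have "bij_betw f (torsion_part p G) (torsion_part p ?X)"
    using torsion_part_iso[OF G _ f] by blast
  then have eq: "|torsion_part p G| =o |torsion_part p ?X|"
    by (rule card_of_ordIsoI)
  show "|N p| \<le>o |torsion_part p G|"
    using torsion_part_sums(1)[OF p] eq ordIso_symmetric ordLeq_ordIso_trans by blast
  show "|torsion_part p G| \<le>o |carrier (sum_group (N p) (\<lambda>_. prufer_group p))|"
    using torsion_part_sums(2)[OF p] eq ordIso_ordLeq_trans by blast
qed

text \<open>Existence turns the choice in \<open>p_rank\<close> into a genuine decomposition;
  nothing more is known about it, so the estimates must hold for all of them.\<close>

lemma p_rank_witness:
  fixes G :: "('a, 'm) monoid_scheme"
  assumes "comm_group G" "divisible G"
  obtains N :: "nat \<Rightarrow> 'a set" and N0 :: "'a set" where "has_divisible_decomposition G N N0" "p_rank p G = |N p|"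
proof -
  have "\<exists>N. \<exists>N0 :: 'a set. has_divisible_decomposition G (N :: nat \<Rightarrow> 'a set) N0"
    by (rule divisible_decomposition_exists[OF assms]) blast
  from someI_ex[OF this] show ?thesis
    using that unfolding p_rank_def by blast
qed

lemma p_rank_countable:
  fixes G :: "('a, 'm) monoid_scheme"
  assumes "comm_group G" "divisible G" "prime p" "countable (torsion_part p G)"
  shows "p_rank p G \<le>o natLeq"
proof -
  obtain N and N0 :: "'a set" where dec: "has_divisible_decomposition G N N0" "p_rank p G = |N p|"
    by (rule p_rank_witness[OF assms(1,2)])
  have "|N p| \<le>o |torsion_part p G|"
    using torsion_part_decomposition(1)[OF comm_group.axioms(2)[OF assms(1)] dec(1) assms(3)] .
  then have "countable (N p)" using countable_ordLeq assms(4) by blast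
  then show ?thesis using dec(2) by (simp add: countable_card_le_natLeq)
qed

text \<open>A finite index set would make the \<open>p\<close>-component countable. Over an infinite
  one, finitely supported functions with values in a countable group are no more numerous than the
  indices.\<close>

lemma p_rank_uncountable:
  fixes G :: "('a, 'm) monoid_scheme"
  assumes "comm_group G" "divisible G" "prime p" "uncountable (torsion_part p G)"
  shows "p_rank p G =o |torsion_part p G|"
proof -
  obtain N and N0 :: "'a set" where dec: "has_divisible_decomposition G N N0" "p_rank p G = |N p|"
    by (rule p_rank_witness[OF assms(1,2)])
  have le: "|N p| \<le>o |torsion_part p G|"
    and ge: "|torsion_part p G| \<le>o |carrier (sum_group (N p) (\<lambda>_. prufer_group p))|"
    using torsion_part_decomposition[OF comm_group.axioms(2)[OF assms(1)] dec(1) assms(3)] by auto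
  have inf: "infinite (N p)"
  proof
    assume "finite (N p)"
    then have "countable (carrier (sum_group (N p) (\<lambda>_. prufer_group p)))"
      by (intro countable_sum_group) (auto simp: countable_finite countable_prufer_group)
    then show False using countable_ordLeq[OF ge] assms(4) by blast
  qed
  have ne: "carrier (prufer_group p) \<noteq> {}"
    using prufer_gen_closed[of p] assms(3) prime_gt_0_nat by blast
  have "|carrier (prufer_group p)| \<le>o natLeq"
    using countable_prufer_group by (simp flip: countable_card_le_natLeq)
  moreover have "natLeq \<le>o |N p|"
    using inf infinite_iff_natLeq_ordLeq by blast
  ultimately have "|carrier (prufer_group p)| \<le>o |N p|"
    by (rule ordLeq_transitive)
  then have "|N p \<times> carrier (prufer_group p)| =o |N p|"
    using inf ne by (intro card_of_Times_infinite_simps)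
  moreover have "|Fpow (N p \<times> carrier (prufer_group p))| =o |N p \<times> carrier (prufer_group p)|"
    using inf prufer_gen_closed[of p] assms(3)
    by (intro card_of_Fpow_infinite) (auto simp: finite_cartesian_product_iff prime_gt_0_nat)
  moreover have "|carrier (sum_group (N p) (\<lambda>_. prufer_group p))| \<le>o |Fpow (N p \<times> carrier (prufer_group p))|"
    by (rule card_of_sum_group) simp
  ultimately have "|torsion_part p G| \<le>o |N p|"
    using ge by (meson ordIso_transitive ordLeq_ordIso_trans ordLeq_transitive)
  then show ?thesis using le dec(2) by (simp add: ordIso_iff_ordLeq)
qed

section \<open>Cokernels of filtered groups\<close>

primrec partial_prod :: "('a, 'm) monoid_scheme \<Rightarrow> (nat \<Rightarrow> 'a) \<Rightarrow> nat \<Rightarrow> 'a" where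
  "partial_prod G x 0 = \<one>\<^bsub>G\<^esub>"
| "partial_prod G x (Suc n) = partial_prod G x n \<otimes>\<^bsub>G\<^esub> x n"

lemma (in monoid) partial_prod_closed [simp]:
  "(\<And>i. i < n \<Longrightarrow> x i \<in> carrier G) \<Longrightarrow> partial_prod G x n \<in> carrier G"
  by (induction n) auto

lemma partial_prod_cong: "(\<And>i. i < n \<Longrightarrow> x i = y i) \<Longrightarrow> partial_prod G x n = partial_prod G y n"
  by (induction n) auto

lemma (in comm_monoid) mult_interchange:
  "\<lbrakk>a \<in> carrier G; b \<in> carrier G; c \<in> carrier G; d \<in> carrier G\<rbrakk> \<Longrightarrow> a \<otimes> b \<otimes> c \<otimes> d = (a \<otimes> c) \<otimes> (b \<otimes> d)"
  by (simp add: m_ac)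

lemma (in comm_group) mult_cancel_common:
  "\<lbrakk>a \<in> carrier G; b \<in> carrier G; z \<in> carrier G\<rbrakk> \<Longrightarrow> (a \<otimes> z) \<otimes> inv (b \<otimes> z) = a \<otimes> inv b"
  using mult_interchange[of a z "inv b" "inv z"] by (simp add: inv_mult m_assoc)

lemma (in group) mult_telescope:
  assumes "a \<in> carrier G" "b \<in> carrier G" "c \<in> carrier G"
  shows "(a \<otimes> inv b) \<otimes> (b \<otimes> inv c) = a \<otimes> inv c"
proof -
  have "(a \<otimes> inv b) \<otimes> (b \<otimes> inv c) = a \<otimes> ((inv b \<otimes> b) \<otimes> inv c)"
    using assms by (simp add: m_assoc del: l_inv Units_l_inv)
  then show ?thesis using assms by simp
qed

lemma (in comm_group) partial_prod_tail:
  assumes H: "subgroup H G" and x: "\<And>i. x i \<in> carrier G" "\<And>i. n \<le> i \<Longrightarrow> x i \<in> H" and "n \<le> N"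
  shows "partial_prod G x N \<otimes> inv (partial_prod G x n) \<in> H"
  using \<open>n \<le> N\<close>
proof (induction N rule: dec_induct)
  case base
  then show ?case using x subgroup.one_closed[OF H] by simp
next
  case (step N)
  have "partial_prod G x (Suc N) \<otimes> inv (partial_prod G x n)
     = (partial_prod G x N \<otimes> inv (partial_prod G x n)) \<otimes> x N"
    using x(1) by (simp add: m_ac)
  then show ?case using subgroup.m_closed[OF H step.IH x(2)] step by simp
qed

text \<open>A Polish group given by a neighbourhood base of open subgroups: \<open>separated\<close>
  is the Hausdorff property, \<open>complete\<close> the convergence of products whose factors tend
  to 1, \<open>countable_index\<close> separability. The \<open>n\<close>-th partial product stops
  before \<open>s n\<close>, so the missing tail belongs to \<open>F n\<close>.\<close>

locale filtered_group = comm_group +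
  fixes F :: "nat \<Rightarrow> 'a set"
  assumes F: "subgroup (F n) G" and F_Suc: "F (Suc n) \<subseteq> F n"
    and separated: "x \<in> carrier G \<Longrightarrow> (\<And>n. x \<in> F n) \<Longrightarrow> x = \<one>"
    and complete: "(\<And>n. s n \<in> F n) \<Longrightarrow> \<exists>y\<in>carrier G. \<forall>n. y \<otimes> inv (partial_prod G s n) \<in> F n"
    and countable_index: "\<exists>C. countable C \<and> C \<subseteq> carrier G \<and> (\<forall>x\<in>carrier G. \<exists>c\<in>C. x \<otimes> inv c \<in> F n)"
begin

lemma F_antimono: "m \<le> n \<Longrightarrow> F n \<subseteq> F m"
  using F_Suc by (rule lift_Suc_antimono_le)

lemma F_carrier: "x \<in> F n \<Longrightarrow> x \<in> carrier G"
  using subgroup.subset[OF F] by blast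

end

text \<open>Continuity is required level by level; composition with a fixed homomorphism has this
  property.\<close>

locale filtered_hom = P: filtered_group P FP + Q: filtered_group Q FQ
  for P :: "('a, 'm) monoid_scheme" and FP and Q :: "('b, 'n) monoid_scheme" (structure) and FQ +
  fixes \<Phi> :: "'a \<Rightarrow> 'b"
  assumes \<Phi>: "\<Phi> \<in> hom P Q" and \<Phi>_F: "x \<in> FP n \<Longrightarrow> \<Phi> x \<in> FQ n"
begin

sublocale group_hom P Q \<Phi>
  by unfold_locales (rule \<Phi>)

text \<open>The closure of the image of the \<open>n\<close>-th neighbourhood.\<close>

definition cl :: "nat \<Rightarrow> 'b set" where
  "cl n = {q \<in> carrier Q. \<forall>m. \<exists>x\<in>FP n. q \<otimes> inv \<Phi> x \<in> FQ m}"

lemma image_subset_cl: "x \<in> FP n \<Longrightarrow> \<Phi> x \<in> cl n"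
  unfolding cl_def using P.F_carrier subgroup.one_closed[OF Q.F] by force

lemma subgroup_cl: "subgroup (cl n) Q"
proof (rule Q.subgroupI)
  show "cl n \<subseteq> carrier Q" by (auto simp: cl_def)
  show "cl n \<noteq> {}" using image_subset_cl subgroup.one_closed[OF P.F] by blast
  show "inv a \<in> cl n" if a: "a \<in> cl n" for a
    unfolding cl_def
  proof (intro CollectI conjI allI)
    show "inv a \<in> carrier Q" using a by (simp add: cl_def)
    fix m
    obtain x where x: "x \<in> FP n" "a \<otimes> inv \<Phi> x \<in> FQ m" using a by (auto simp: cl_def)
    have c: "a \<in> carrier Q" "x \<in> carrier P" using a x P.F_carrier by (auto simp: cl_def)
    have "inv (a \<otimes> inv \<Phi> x) \<in> FQ m"
      by (rule subgroup.m_inv_closed[OF Q.F x(2)])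
    then have "inv a \<otimes> inv \<Phi> (inv\<^bsub>P\<^esub> x) \<in> FQ m"
      using c by (simp add: Q.inv_mult)
    then show "\<exists>x\<in>FP n. inv a \<otimes> inv \<Phi> x \<in> FQ m"
      using subgroup.m_inv_closed[OF P.F x(1)] by blast
  qed
  show "a \<otimes> b \<in> cl n" if ab: "a \<in> cl n" "b \<in> cl n" for a b
    unfolding cl_def
  proof (intro CollectI conjI allI)
    show "a \<otimes> b \<in> carrier Q" using ab by (simp add: cl_def)
    fix m
    obtain x y where x: "x \<in> FP n" "a \<otimes> inv \<Phi> x \<in> FQ m"
      and y: "y \<in> FP n" "b \<otimes> inv \<Phi> y \<in> FQ m" using ab unfolding cl_def by blast
    have c: "a \<in> carrier Q" "b \<in> carrier Q" "x \<in> carrier P" "y \<in> carrier P"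
      using ab x y P.F_carrier by (auto simp: cl_def)
    have "(a \<otimes> inv \<Phi> x) \<otimes> (b \<otimes> inv \<Phi> y) \<in> FQ m"
      by (rule subgroup.m_closed[OF Q.F x(2) y(2)])
    also have "(a \<otimes> inv \<Phi> x) \<otimes> (b \<otimes> inv \<Phi> y)
      = (a \<otimes> b) \<otimes> inv \<Phi> (x \<otimes>\<^bsub>P\<^esub> y)"
      using c by (simp add: Q.inv_mult Q.m_ac)
    finally show "\<exists>x\<in>FP n. a \<otimes> b \<otimes> inv \<Phi> x \<in> FQ m"
      using subgroup.m_closed[OF P.F x(1) y(1)] by blast
  qed
qed

text \<open>\<open>FQ m\<close> is a subgroup, so the \<open>m\<close> that keeps \<open>z\<close>
  away from the image also keeps the whole coset of \<open>z\<close> away from the closure: two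
  displacements by \<open>FQ m\<close> combine to one.\<close>

lemma cl_closed:
  assumes z: "z \<in> carrier Q" "z \<notin> cl n"
  obtains m where "\<And>w. w \<in> FQ m \<Longrightarrow> z \<otimes> w \<notin> cl n"
proof -
  obtain m where m: "\<And>x. x \<in> FP n \<Longrightarrow> z \<otimes> inv \<Phi> x \<notin> FQ m"
    using z by (auto simp: cl_def)
  have "z \<otimes> w \<notin> cl n" if w: "w \<in> FQ m" for w
  proof
    assume "z \<otimes> w \<in> cl n"
    then obtain x where x: "x \<in> FP n" "z \<otimes> w \<otimes> inv \<Phi> x \<in> FQ m" by (auto simp: cl_def)
    have c: "w \<in> carrier Q" "x \<in> carrier P" using w x P.F_carrier Q.F_carrier by auto
    have "(z \<otimes> w \<otimes> inv \<Phi> x) \<otimes> inv w \<in> FQ m"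
      by (rule subgroup.m_closed[OF Q.F x(2) subgroup.m_inv_closed[OF Q.F w]])
    also have "(z \<otimes> w \<otimes> inv \<Phi> x) \<otimes> inv w = (z \<otimes> inv \<Phi> x) \<otimes> (w \<otimes> inv w)"
      using c z by (intro Q.mult_interchange) auto
    also have "\<dots> = z \<otimes> inv \<Phi> x" using c z by simp
    finally show False using m[OF x(1)] by blast
  qed
  then show ?thesis using that by blast
qed

text \<open>The successive approximation argument of the open mapping theorem.\<close>

lemma image_open:
  assumes "\<And>n. \<exists>k. FQ k \<subseteq> cl n"
  obtains k where "FQ k \<subseteq> \<Phi> ` carrier P"
proof -
  obtain k' where k': "\<And>n. FQ (k' n) \<subseteq> cl n" using assms by metis
  \<comment> \<open>The maximum with \<open>n\<close> forces the remainders, which lie in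
    \<open>FQ (k n)\<close>, to tend to 1.\<close>
  define k where "k n = max n (k' n)" for n
  have k: "FQ (k n) \<subseteq> cl n" for n
    using k'[of n] Q.F_antimono[of "k' n" "k n"] by (auto simp: k_def)
  have kn: "FQ (k n) \<subseteq> FQ n" for n
    by (rule Q.F_antimono) (simp add: k_def)
  \<comment> \<open>Density is used with the precision \<open>k (Suc n)\<close>, so that the
    remainder can be approximated again at the next level.\<close>
  have "\<forall>n q. \<exists>x. q \<in> FQ (k n) \<longrightarrow> x \<in> FP n \<and> q \<otimes> inv \<Phi> x \<in> FQ (k (Suc n))"
    using k by (fastforce simp: cl_def)
  then obtain X where X: "\<And>n q. q \<in> FQ (k n) \<Longrightarrow> X n q \<in> FP n"
    "\<And>n q. q \<in> FQ (k n) \<Longrightarrow> q \<otimes> inv \<Phi> (X n q) \<in> FQ (k (Suc n))"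
    by metis
  have "FQ (k 0) \<subseteq> \<Phi> ` carrier P"
  proof
    fix q0 assume q0: "q0 \<in> FQ (k 0)"
    define q where "q = rec_nat q0 (\<lambda>n r. r \<otimes> inv \<Phi> (X n r))"
    have qS: "q (Suc n) = q n \<otimes> inv \<Phi> (X n (q n))" for n by (simp add: q_def)
    define x where "x n = X n (q n)" for n
    have q: "q n \<in> FQ (k n)" for n
    proof (induction n)
      case 0
      then show ?case using q0 by (simp add: q_def)
    next
      case (Suc n)
      then show ?case using X(2) by (simp add: qS)
    qed
    have x: "x n \<in> FP n" for n using X(1)[OF q] by (simp add: x_def)
    have xc: "x n \<in> carrier P" for n using x P.F_carrier by blast
    have q0c: "q0 \<in> carrier Q" using q0 Q.F_carrier by blast
    have q_eq: "q n = q0 \<otimes> inv \<Phi> (partial_prod P x n)" for n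
    proof (induction n)
      case 0
      then show ?case using q0c by (simp add: q_def)
    next
      case (Suc n)
      have "q (Suc n) = q n \<otimes> inv \<Phi> (x n)" by (simp add: qS x_def)
      then show ?case unfolding Suc using q0c xc by (simp add: Q.inv_mult Q.m_ac)
    qed
    obtain y where y: "y \<in> carrier P" "\<And>n. y \<otimes>\<^bsub>P\<^esub> inv\<^bsub>P\<^esub> partial_prod P x n \<in> FP n"
      using P.complete[OF x] by blast
    have "q0 \<otimes> inv \<Phi> y \<in> FQ n" for n
    proof -
      \<comment> \<open>The remainder \<open>q n\<close> and the image of the tail of the product
        are both in \<open>FQ n\<close>; together they give the distance from \<open>q0\<close> to
        \<open>\<Phi> y\<close>.\<close>
      have "q n \<otimes> inv \<Phi> (y \<otimes>\<^bsub>P\<^esub> inv\<^bsub>P\<^esub> partial_prod P x n) \<in> FQ n"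
        using q kn \<Phi>_F[OF y(2)] by (intro subgroup.m_closed[OF Q.F] subgroup.m_inv_closed[OF Q.F]) auto
      moreover have "q n \<otimes> inv \<Phi> (y \<otimes>\<^bsub>P\<^esub> inv\<^bsub>P\<^esub> partial_prod P x n)
         = q0 \<otimes> inv \<Phi> y \<otimes> (\<Phi> (partial_prod P x n) \<otimes> inv \<Phi> (partial_prod P x n))"
        using q0c y xc unfolding q_eq by (simp add: Q.inv_mult Q.m_ac del: Q.r_inv)
      ultimately show ?thesis using q0c y xc by simp
    qed
    then have "q0 \<otimes> inv \<Phi> y = \<one>" using Q.separated q0c y by simp
    then have "q0 = \<Phi> y" using q0c y by (simp add: Q.inv_solve_right')
    then show "q0 \<in> \<Phi> ` carrier P" using y by blast
  qed
  then show ?thesis by (rule that)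
qed

text \<open>Points outside \<open>cl n\<close> exist arbitrarily close to 1. A sequence
  \<open>y j\<close> of them is thinned out until all later terms together cannot move
  \<open>y j\<close> into the closed set \<open>cl n\<close>. A set of indices is sent to the
  product of its \<open>y j\<close>; at the first difference \<open>j\<close> of two sets the
  quotient is \<open>y j\<close> up to such a later perturbation.\<close>

lemma cantor_scheme:
  assumes n: "\<And>k. \<not> FQ k \<subseteq> cl n"
  obtains q :: "(nat \<Rightarrow> bool) \<Rightarrow> 'b" where "\<And>s. q s \<in> carrier Q"
    "\<And>s t. s \<noteq> t \<Longrightarrow> q s \<otimes> inv q t \<notin> cl n"
proof -
  have "\<forall>m. \<exists>y. y \<in> FQ m \<and> y \<notin> cl n" using n by blast
  then obtain Y where Y: "\<And>m. Y m \<in> FQ m" "\<And>m. Y m \<notin> cl n" by metis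
  \<comment> \<open>Closedness protects a neighbourhood of \<open>Y m\<close>; the strict inequality
    makes the chosen levels increase.\<close>
  have "\<exists>m'>m. \<forall>w\<in>FQ m'. Y m \<otimes> w \<notin> cl n" for m
  proof -
    obtain m0 where "\<And>w. w \<in> FQ m0 \<Longrightarrow> Y m \<otimes> w \<notin> cl n"
      using cl_closed[OF Q.F_carrier[OF Y(1)] Y(2)] by blast
    moreover have "FQ (max m0 (Suc m)) \<subseteq> FQ m0" by (rule Q.F_antimono) simp
    ultimately show ?thesis by (intro exI[of _ "max m0 (Suc m)"]) auto
  qed
  then obtain M where M: "\<And>m. M m > m" "\<And>m w. w \<in> FQ (M m) \<Longrightarrow> Y m \<otimes> w \<notin> cl n" by metis
  define m where "m j = (M ^^ j) 0" for j
  have mS: "m (Suc j) = M (m j)" for j by (simp add: m_def)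
  have sm: "strict_mono m" by (simp add: strict_mono_Suc_iff mS M)
  have FQm: "FQ (m j) \<subseteq> FQ i" if "i \<le> j" for i j
    using Q.F_antimono[of i "m j"] strict_mono_imp_increasing[OF sm, of j] that by simp
  define y where "y j = Y (m j)" for j
  have y: "y j \<in> FQ (m j)" "y j \<in> carrier Q" "w \<in> FQ (m (Suc j)) \<Longrightarrow> y j \<otimes> w \<notin> cl n" for j w
    using Y M Q.F_carrier[OF Y(1)] by (auto simp: y_def mS)
  define x where "x s j = (if s j then y j else \<one>)" for s j
  have x: "x s j \<in> FQ (m j)" "x s j \<in> carrier Q" for s j
    using y subgroup.one_closed[OF Q.F] by (auto simp: x_def)
  have "\<exists>z\<in>carrier Q. \<forall>j. z \<otimes> inv partial_prod Q (x s) j \<in> FQ j" for s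
    using Q.complete[of "x s"] x(1) FQm by blast
  then obtain q where q: "\<And>s. q s \<in> carrier Q"
    "\<And>s j. q s \<otimes> inv partial_prod Q (x s) j \<in> FQ j" by metis
  \<comment> \<open>Completeness places the tail after \<open>j\<close> only in \<open>FQ j\<close>.
    Comparing with the partial product of length \<open>m j\<close>, all of whose factors from
    \<open>j\<close> on lie in \<open>FQ (m j)\<close>, improves this to
    \<open>FQ (m j)\<close>.\<close>
  have q_m: "q s \<otimes> inv partial_prod Q (x s) j \<in> FQ (m j)" for s j
  proof -
    let ?N = "m j"
    have le: "j \<le> ?N" using strict_mono_imp_increasing[OF sm] by blast
    have "partial_prod Q (x s) ?N \<otimes> inv partial_prod Q (x s) j \<in> FQ (m j)"
    proof (rule Q.partial_prod_tail[OF Q.F x(2) _ le])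
      show "x s i \<in> FQ (m j)" if "j \<le> i" for i
        using x(1)[of s i] Q.F_antimono[of "m j" "m i"] sm that by (auto simp: strict_mono_less_eq)
    qed
    with q(2)[of s ?N] have "(q s \<otimes> inv partial_prod Q (x s) ?N) \<otimes>
       (partial_prod Q (x s) ?N \<otimes> inv partial_prod Q (x s) j) \<in> FQ (m j)"
      by (rule subgroup.m_closed[OF Q.F])
    then show ?thesis using q(1) x(2) by (simp add: Q.mult_telescope)
  qed
  \<comment> \<open>The common initial product \<open>p\<close> cancels; what remains of the two
    tails beyond \<open>j\<close> are \<open>a\<close> and \<open>b\<close>, both in
    \<open>FQ (m (Suc j))\<close>.\<close>
  have main: "q s \<otimes> inv q t \<notin> cl n" if j: "s j" "\<not> t j" "\<And>i. i < j \<Longrightarrow> s i = t i" for s t j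
  proof -
    define p where "p = partial_prod Q (x t) j"
    have p: "p \<in> carrier Q" using x by (simp add: p_def)
    have ps: "partial_prod Q (x s) (Suc j) = p \<otimes> y j"
      using j partial_prod_cong[of j "x s" "x t" Q] by (simp add: p_def x_def)
    have pt: "partial_prod Q (x t) (Suc j) = p"
      using j p by (simp add: p_def x_def[of t j])
    define a where "a = q s \<otimes> inv (p \<otimes> y j)"
    define b where "b = q t \<otimes> inv p"
    have ab: "a \<in> FQ (m (Suc j))" "b \<in> FQ (m (Suc j))"
      using q_m[of s "Suc j"] q_m[of t "Suc j"] unfolding ps pt a_def b_def by auto
    then have "y j \<otimes> (a \<otimes> inv b) \<notin> cl n"
      by (intro y subgroup.m_closed[OF Q.F] subgroup.m_inv_closed[OF Q.F])
    moreover have "q s \<otimes> inv q t = y j \<otimes> (a \<otimes> inv b)"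
    proof -
      have abc: "a \<in> carrier Q" "b \<in> carrier Q" using ab Q.F_carrier by auto
      have "q s = a \<otimes> (p \<otimes> y j)"
        using p q(1) y(2) by (simp add: a_def Q.m_assoc)
      then have "q s = (a \<otimes> y j) \<otimes> p"
        using p abc y(2) by (simp add: Q.m_ac)
      moreover have "q t = b \<otimes> p"
        using p q(1) by (simp add: b_def Q.m_assoc)
      ultimately show ?thesis
        using p abc y(2) Q.mult_cancel_common[of "a \<otimes> y j" b p] by (simp add: Q.m_ac)
    qed
    ultimately show ?thesis by simp
  qed
  have "q s \<otimes> inv q t \<notin> cl n" if "s \<noteq> t" for s t
  proof
    assume st: "q s \<otimes> inv q t \<in> cl n"
    \<comment> \<open>\<open>main\<close> needs the first differing index to belong to the left set;
      inverses in the subgroup \<open>cl n\<close> allow the two to be exchanged.\<close>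
    have "inv (q s \<otimes> inv q t) \<in> cl n"
      by (rule subgroup.m_inv_closed[OF subgroup_cl st])
    then have ts: "q t \<otimes> inv q s \<in> cl n"
      using q(1) by (simp add: Q.inv_mult Q.m_comm)
    have "\<exists>j. s j \<noteq> t j" using that by auto
    from exists_least_iff[THEN iffD1, OF this]
    obtain j where "s j \<noteq> t j" "\<And>i. i < j \<Longrightarrow> s i = t i" by blast
    then show False using main[of s j t] main[of t j s] st ts by auto
  qed
  then show ?thesis using that q(1) by blast
qed

text \<open>If all closures are open, the image contains some \<open>FQ k\<close>, which has
  countable index. Otherwise fix a closure \<open>cl n\<close> that is not open: since
  \<open>FP n\<close> has countable index, the image is covered by countably many cosets of
  \<open>cl n\<close>, and for fixed \<open>s\<close> each coset contains
  \<open>q t \<otimes> inv q s\<close> for at most one \<open>t\<close>. Hence countable fibres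
  instead of injectivity.\<close>

theorem cokernel_dichotomy:
  obtains (countable) C where "countable C" "C \<subseteq> carrier Q"
      "\<And>y. y \<in> carrier Q \<Longrightarrow> \<exists>c\<in>C. y \<otimes> inv c \<in> \<Phi> ` carrier P"
  | (continuum) q :: "(nat \<Rightarrow> bool) \<Rightarrow> 'b" where "\<And>s. q s \<in> carrier Q"
      "\<And>s. countable {t. q t \<otimes> inv q s \<in> \<Phi> ` carrier P}"
proof (cases "\<forall>n. \<exists>k. FQ k \<subseteq> cl n")
  case True
  then obtain k where "FQ k \<subseteq> \<Phi> ` carrier P" using image_open by blast
  moreover obtain C where "countable C" "C \<subseteq> carrier Q" "\<And>x. x \<in> carrier Q \<Longrightarrow> \<exists>c\<in>C. x \<otimes> inv c \<in> FQ k"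
    using Q.countable_index[of k] by blast
  ultimately show ?thesis using countable[of C] by blast
next
  case False
  then obtain n where "\<And>k. \<not> FQ k \<subseteq> cl n" by blast
  then obtain q :: "(nat \<Rightarrow> bool) \<Rightarrow> 'b" where q: "\<And>s. q s \<in> carrier Q"
    "\<And>s t. s \<noteq> t \<Longrightarrow> q s \<otimes> inv q t \<notin> cl n" using cantor_scheme by blast
  obtain D where D: "countable D" "D \<subseteq> carrier P" "\<And>x. x \<in> carrier P \<Longrightarrow> \<exists>d\<in>D. x \<otimes>\<^bsub>P\<^esub> inv\<^bsub>P\<^esub> d \<in> FP n"
    using P.countable_index[of n] by blast
  show ?thesis
  proof (rule continuum[of q])
    show "q s \<in> carrier Q" for s by (rule q)
    show "countable {t. q t \<otimes> inv q s \<in> \<Phi> ` carrier P}" (is "countable ?T") for s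
    proof -
      have "\<exists>d\<in>D. q t \<otimes> inv q s \<otimes> inv \<Phi> d \<in> cl n" if t: "t \<in> ?T" for t
      proof -
        obtain x where x: "x \<in> carrier P" "q t \<otimes> inv q s = \<Phi> x" using t by auto
        obtain d where d: "d \<in> D" "x \<otimes>\<^bsub>P\<^esub> inv\<^bsub>P\<^esub> d \<in> FP n" using D(3) x(1) by blast
        then have "\<Phi> (x \<otimes>\<^bsub>P\<^esub> inv\<^bsub>P\<^esub> d) \<in> cl n" by (intro image_subset_cl)
        then show ?thesis using x d D(2) by (intro bexI[of _ d]) auto
      qed
      then obtain d where d: "\<And>t. t \<in> ?T \<Longrightarrow> d t \<in> D"
        "\<And>t. t \<in> ?T \<Longrightarrow> q t \<otimes> inv q s \<otimes> inv \<Phi> (d t) \<in> cl n" by metis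
      have "inj_on d ?T"
      proof (rule inj_onI)
        fix t t' assume t: "t \<in> ?T" "t' \<in> ?T" "d t = d t'"
        define z where "z = inv q s \<otimes> inv \<Phi> (d t)"
        have z: "z \<in> carrier Q" using q(1) d(1)[OF t(1)] D(2) by (auto simp: z_def)
        have "q t \<otimes> z \<in> cl n" "q t' \<otimes> z \<in> cl n"
          using d(2)[OF t(1)] d(2)[OF t(2)] q(1) d(1)[OF t(1)] D(2) t(3) by (auto simp: z_def Q.m_assoc subset_iff)
        then have "(q t \<otimes> z) \<otimes> inv (q t' \<otimes> z) \<in> cl n"
          by (metis subgroup.m_closed subgroup.m_inv_closed subgroup_cl)
        then have "q t \<otimes> inv q t' \<in> cl n" using q(1) z by (simp only: Q.mult_cancel_common)
        then show "t = t'" using q(2) by blast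
      qed
      moreover have "countable (d ` ?T)" using D(1) d(1) countable_subset by (metis image_subsetI)
      ultimately show ?thesis using countable_image_inj_on by blast
    qed
  qed
qed

end

section \<open>Groups of homomorphisms under pointwise convergence\<close>

definition hom_group :: "('a, 'm) monoid_scheme \<Rightarrow> ('b, 'n) monoid_scheme \<Rightarrow> ('a \<Rightarrow> 'b) monoid" where
  "hom_group A V = \<lparr>carrier = hom A V \<inter> extensional (carrier A),
     monoid.mult = (\<lambda>f g. \<lambda>a\<in>carrier A. f a \<otimes>\<^bsub>V\<^esub> g a), one = (\<lambda>a\<in>carrier A. \<one>\<^bsub>V\<^esub>)\<rparr>"

lemma hom_group_simps [simp]:
  "carrier (hom_group A V) = hom A V \<inter> extensional (carrier A)"
  "f \<otimes>\<^bsub>hom_group A V\<^esub> g = (\<lambda>a\<in>carrier A. f a \<otimes>\<^bsub>V\<^esub> g a)"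
  "\<one>\<^bsub>hom_group A V\<^esub> = (\<lambda>a\<in>carrier A. \<one>\<^bsub>V\<^esub>)"
  by (simp_all add: hom_group_def)

lemma hom_mult_pointwise:
  assumes "group A" "comm_group V" "f \<in> hom A V" "g \<in> hom A V"
  shows "(\<lambda>a\<in>carrier A. f a \<otimes>\<^bsub>V\<^esub> g a) \<in> hom A V"
proof -
  interpret A: group A by fact
  interpret V: comm_group V by fact
  show ?thesis
    using assms(3,4) by (auto simp: hom_def Pi_iff V.m_ac)
qed

lemma comm_group_hom_group:
  assumes "group A" "comm_group V"
  shows "comm_group (hom_group A V)"
proof -
  interpret A: group A by fact
  interpret V: comm_group V by fact
  show ?thesis
  proof (rule comm_groupI)
    fix f assume f: "f \<in> carrier (hom_group A V)"
    then have fc: "f a \<in> carrier V" if "a \<in> carrier A" for a using that hom_in_carrier by fastforce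
    show "\<one>\<^bsub>hom_group A V\<^esub> \<otimes>\<^bsub>hom_group A V\<^esub> f = f"
      using f fc by (auto simp: fun_eq_iff extensional_def)
    have "(\<lambda>a\<in>carrier A. inv\<^bsub>V\<^esub> f a) \<in> hom A V"
      using f by (auto simp: hom_def Pi_iff V.inv_mult)
    then show "\<exists>g\<in>carrier (hom_group A V). g \<otimes>\<^bsub>hom_group A V\<^esub> f = \<one>\<^bsub>hom_group A V\<^esub>"
      using fc by (intro bexI[of _ "\<lambda>a\<in>carrier A. inv\<^bsub>V\<^esub> f a"]) (auto simp: fun_eq_iff)
  next
    fix f g assume fg: "f \<in> carrier (hom_group A V)" "g \<in> carrier (hom_group A V)"
    then show "f \<otimes>\<^bsub>hom_group A V\<^esub> g \<in> carrier (hom_group A V)"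
      using hom_mult_pointwise[OF assms] by auto
    have c: "f a \<in> carrier V" "g a \<in> carrier V" if "a \<in> carrier A" for a
      using that fg hom_in_carrier by fastforce+
    then show "f \<otimes>\<^bsub>hom_group A V\<^esub> g = g \<otimes>\<^bsub>hom_group A V\<^esub> f"
      by (auto simp: fun_eq_iff V.m_comm)
    fix h assume "h \<in> carrier (hom_group A V)"
    then have "h a \<in> carrier V" if "a \<in> carrier A" for a using that hom_in_carrier by fastforce
    then show "f \<otimes>\<^bsub>hom_group A V\<^esub> g \<otimes>\<^bsub>hom_group A V\<^esub> h = f \<otimes>\<^bsub>hom_group A V\<^esub> (g \<otimes>\<^bsub>hom_group A V\<^esub> h)"
      using c by (auto simp: fun_eq_iff V.m_assoc)
  next
    show "\<one>\<^bsub>hom_group A V\<^esub> \<in> carrier (hom_group A V)"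
      by (auto simp: hom_def)
  qed
qed

lemma eval_hom_group: "a \<in> carrier A \<Longrightarrow> (\<lambda>f. f a) \<in> hom (hom_group A V) V"
  by (auto simp: hom_def)

lemma inv_hom_group:
  assumes "group A" "comm_group V" "f \<in> carrier (hom_group A V)" "a \<in> carrier A"
  shows "(inv\<^bsub>hom_group A V\<^esub> f) a = inv\<^bsub>V\<^esub> f a"
proof -
  interpret V: comm_group V by fact
  interpret H: comm_group "hom_group A V" by (rule comm_group_hom_group[OF assms(1,2)])
  interpret group_hom "hom_group A V" V "\<lambda>f. f a"
    by unfold_locales (rule eval_hom_group[OF assms(4)])
  show ?thesis using hom_inv assms(3) by blast
qed

text \<open>Basic neighbourhoods of the trivial map for pointwise convergence into a discrete group,
  along an enumeration of \<open>A\<close>.\<close>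

definition hom_filtration :: "('a, 'm) monoid_scheme \<Rightarrow> ('b, 'n) monoid_scheme \<Rightarrow> nat \<Rightarrow> ('a \<Rightarrow> 'b) set" where
  "hom_filtration A V n = {f \<in> carrier (hom_group A V). \<forall>i<n. f (from_nat_into (carrier A) i) = \<one>\<^bsub>V\<^esub>}"

lemma hom_groupI:
  assumes "\<And>a. a \<in> carrier A \<Longrightarrow> f a \<in> carrier V"
    "\<And>a b. a \<in> carrier A \<Longrightarrow> b \<in> carrier A \<Longrightarrow> f (a \<otimes>\<^bsub>A\<^esub> b) = f a \<otimes>\<^bsub>V\<^esub> f b"
    "f \<in> extensional (carrier A)"
  shows "f \<in> carrier (hom_group A V)"
  using assms by (auto simp: hom_def)

text \<open>At each point all late factors are trivial, so partial products become constant there,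
  and the limit is multiplicative because finitely many of its values can be read off one partial
  product. The index is countable because a coset is determined by \<open>n\<close> values in the
  countable group \<open>V\<close>.\<close>

lemma filtered_hom_group:
  fixes A :: "('a, 'm) monoid_scheme" and V :: "('b, 'n) monoid_scheme"
  assumes "group A" and cA: "countable (carrier A)" and "comm_group V" and cV: "countable (carrier V)"
  shows "filtered_group (hom_group A V) (hom_filtration A V)"
proof -
  interpret A: group A by fact
  interpret V: comm_group V by fact
  interpret H: comm_group "hom_group A V" by (rule comm_group_hom_group) fact+
  define e where "e = from_nat_into (carrier A)"
  have e: "e i \<in> carrier A" for i
    using from_nat_into[of "carrier A"] A.carrier_not_empty by (auto simp: e_def)
  have e_surj: "\<exists>i. e i = a" if "a \<in> carrier A" for a
    using from_nat_into_surj[OF cA that] by (simp add: e_def)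
  have fc: "f a \<in> carrier V" if "f \<in> carrier (hom_group A V)" "a \<in> carrier A" for f a
    using that hom_in_carrier by fastforce
  let ?F = "hom_filtration A V"
  have F: "f \<in> ?F n \<longleftrightarrow> f \<in> carrier (hom_group A V) \<and> (\<forall>i<n. f (e i) = \<one>\<^bsub>V\<^esub>)" for f n
    by (simp add: hom_filtration_def e_def)
  have diff: "(f \<otimes>\<^bsub>hom_group A V\<^esub> inv\<^bsub>hom_group A V\<^esub> g) a = f a \<otimes>\<^bsub>V\<^esub> inv\<^bsub>V\<^esub> g a"
    if "g \<in> carrier (hom_group A V)" "a \<in> carrier A" for f g a
    using that inv_hom_group[OF assms(1,3) that] by simp
  show ?thesis
  proof (intro filtered_group.intro filtered_group_axioms.intro)
    show "comm_group (hom_group A V)" by (rule H.comm_group_axioms)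
    show "subgroup (?F n) (hom_group A V)" for n
    proof (rule H.subgroupI)
      show "?F n \<subseteq> carrier (hom_group A V)" using F by blast
      have "\<one>\<^bsub>hom_group A V\<^esub> \<in> ?F n" unfolding F using e H.one_closed by (auto simp del: hom_group_simps(1))
      then show "?F n \<noteq> {}" by blast
      show "inv\<^bsub>hom_group A V\<^esub> a \<in> ?F n" if "a \<in> ?F n" for a
        using that e unfolding F by (auto simp: inv_hom_group[OF assms(1,3)] simp del: hom_group_simps(1))
      show "a \<otimes>\<^bsub>hom_group A V\<^esub> b \<in> ?F n" if "a \<in> ?F n" "b \<in> ?F n" for a b
        using that e H.m_closed[of a b] unfolding F by (auto simp del: hom_group_simps(1))
    qed
    show "?F (Suc n) \<subseteq> ?F n" for n unfolding subset_iff F by auto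
    show "x = \<one>\<^bsub>hom_group A V\<^esub>" if x: "x \<in> carrier (hom_group A V)" "\<And>n. x \<in> ?F n" for x
    proof -
      have "x a = \<one>\<^bsub>V\<^esub>" if a: "a \<in> carrier A" for a
      proof -
        obtain i where "e i = a" using e_surj[OF a] by blast
        then show ?thesis using x(2)[of "Suc i"] unfolding F by blast
      qed
      then show ?thesis using x(1) by (auto simp: fun_eq_iff extensional_def)
    qed
    show "\<exists>C. countable C \<and> C \<subseteq> carrier (hom_group A V) \<and>
        (\<forall>x\<in>carrier (hom_group A V). \<exists>c\<in>C. x \<otimes>\<^bsub>hom_group A V\<^esub> inv\<^bsub>hom_group A V\<^esub> c \<in> ?F n)" for n
    proof -
      define v where "v f = map (\<lambda>i. f (e i)) [0..<n]" for f :: "'a \<Rightarrow> 'b"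
      \<comment> \<open>One representative for each list of values that actually occurs.\<close>
      define C where "C = inv_into (carrier (hom_group A V)) v ` v ` carrier (hom_group A V)"
      have "v ` carrier (hom_group A V) \<subseteq> lists (carrier V)"
        using fc e by (auto simp: v_def simp del: hom_group_simps(1))
      then have "countable (v ` carrier (hom_group A V))"
        by (rule countable_subset) (use cV in simp)
      then have "countable C"
        unfolding C_def by (rule countable_image)
      moreover have "C \<subseteq> carrier (hom_group A V)"
        unfolding C_def by (auto intro: inv_into_into simp del: hom_group_simps(1))
      moreover have "\<exists>c\<in>C. x \<otimes>\<^bsub>hom_group A V\<^esub> inv\<^bsub>hom_group A V\<^esub> c \<in> ?F n" if x: "x \<in> carrier (hom_group A V)" for x
      proof -
        define c where "c = inv_into (carrier (hom_group A V)) v (v x)"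
        have cC: "c \<in> C" using x unfolding c_def C_def by blast
        have c: "c \<in> carrier (hom_group A V)" using cC \<open>C \<subseteq> carrier (hom_group A V)\<close> by blast
        have "v c = v x" unfolding c_def by (rule f_inv_into_f[OF imageI[OF x]])
        then have "c (e i) = x (e i)" if "i < n" for i
          using that by (auto simp: v_def)
        then have "x \<otimes>\<^bsub>hom_group A V\<^esub> inv\<^bsub>hom_group A V\<^esub> c \<in> ?F n"
          unfolding F using x c diff[OF c e] fc[OF x e] H.m_closed H.inv_closed
          by (auto simp del: hom_group_simps)
        then show ?thesis using cC by blast
      qed
      ultimately show ?thesis by blast
    qed
    fix x :: "nat \<Rightarrow> 'a \<Rightarrow> 'b" assume x: "\<And>n. x n \<in> ?F n"
    have xc: "x n \<in> carrier (hom_group A V)" for n using x F by blast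
    define pp where "pp = partial_prod (hom_group A V) x"
    have pp: "pp n \<in> carrier (hom_group A V)" for n
      unfolding pp_def using xc by (rule H.partial_prod_closed)
    \<comment> \<open>The factor \<open>x i\<close> may still change the value at
      \<open>e i\<close>, later ones do not; hence \<open>Suc i\<close>.\<close>
    have stable: "pp N (e i) = pp (Suc i) (e i)" if "Suc i \<le> N" for i N
      using that
    proof (induction N rule: dec_induct)
      case (step N)
      have "x N (e i) = \<one>\<^bsub>V\<^esub>" using x[of N] step(1) unfolding F by auto
      moreover have "pp (Suc N) (e i) = pp N (e i) \<otimes>\<^bsub>V\<^esub> x N (e i)"
        using e by (simp add: pp_def)
      ultimately show ?case using step fc[OF pp e] by simp
    qed simp
    \<comment> \<open>The enumeration may repeat an element, so the limit value must not depend on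
      the index at which it is met.\<close>
    have stable': "pp N a = pp M a" if "e i = a" "e j = a" "i < N" "j < M" for a i j N M
    proof -
      have "pp N a = pp (max N M) a"
        using stable[of i N] stable[of i "max N M"] that by (simp add: Suc_le_eq)
      also have "\<dots> = pp M a"
        using stable[of j M] stable[of j "max N M"] that by (simp add: Suc_le_eq)
      finally show ?thesis .
    qed
    obtain idx where idx: "\<And>a. a \<in> carrier A \<Longrightarrow> e (idx a) = a" using e_surj by metis
    define y where "y = (\<lambda>a\<in>carrier A. pp (Suc (idx a)) a)"
    have y: "y a = pp N a" if "a \<in> carrier A" "e i = a" "i < N" for a i N
      using stable'[of "idx a" a i "Suc (idx a)" N] idx that by (simp add: y_def)
    have yH: "y \<in> carrier (hom_group A V)"
    proof (rule hom_groupI)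
      show "y a \<in> carrier V" if "a \<in> carrier A" for a
        using fc[OF pp that] that by (simp add: y_def)
      show "y (a \<otimes>\<^bsub>A\<^esub> b) = y a \<otimes>\<^bsub>V\<^esub> y b" if ab: "a \<in> carrier A" "b \<in> carrier A" for a b
      proof -
        \<comment> \<open>One length that is late enough for \<open>a\<close>, \<open>b\<close> and
          their product.\<close>
        define N where "N = Suc (max (idx a) (max (idx b) (idx (a \<otimes>\<^bsub>A\<^esub> b))))"
        have "pp N (a \<otimes>\<^bsub>A\<^esub> b) = pp N a \<otimes>\<^bsub>V\<^esub> pp N b"
          using pp[of N] ab by (auto intro: hom_mult)
        moreover have "y a = pp N a" "y b = pp N b" "y (a \<otimes>\<^bsub>A\<^esub> b) = pp N (a \<otimes>\<^bsub>A\<^esub> b)"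
          using ab by (auto intro!: y idx simp: N_def)
        ultimately show ?thesis by simp
      qed
      show "y \<in> extensional (carrier A)" by (simp add: y_def)
    qed
    show "\<exists>y\<in>carrier (hom_group A V). \<forall>n. y \<otimes>\<^bsub>hom_group A V\<^esub> inv\<^bsub>hom_group A V\<^esub> partial_prod (hom_group A V) x n \<in> ?F n"
    proof (intro bexI[OF _ yH] allI)
      fix n
      show "y \<otimes>\<^bsub>hom_group A V\<^esub> inv\<^bsub>hom_group A V\<^esub> partial_prod (hom_group A V) x n \<in> ?F n"
        unfolding pp_def[symmetric] F
        using yH pp[of n] diff[OF pp e] fc[OF pp e] y[OF e refl, of _ n] H.m_closed H.inv_closed
        by (auto simp del: hom_group_simps)
    qed
  qed
qed

definition hom_post :: "('a, 'm) monoid_scheme \<Rightarrow> ('b \<Rightarrow> 'c) \<Rightarrow> ('a \<Rightarrow> 'b) \<Rightarrow> 'a \<Rightarrow> 'c" where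
  "hom_post A \<pi> f = (\<lambda>a\<in>carrier A. \<pi> (f a))"

lemma hom_post_hom:
  assumes "group A" "comm_group V" "comm_group W" "\<pi> \<in> hom V W"
  shows "hom_post A \<pi> \<in> hom (hom_group A V) (hom_group A W)"
proof (rule homI)
  interpret A: group A by fact
  fix f assume f: "f \<in> carrier (hom_group A V)"
  then show "hom_post A \<pi> f \<in> carrier (hom_group A W)"
    using assms(4) by (auto simp: hom_post_def hom_def Pi_iff)
  fix g assume "g \<in> carrier (hom_group A V)"
  then show "hom_post A \<pi> (f \<otimes>\<^bsub>hom_group A V\<^esub> g) = hom_post A \<pi> f \<otimes>\<^bsub>hom_group A W\<^esub> hom_post A \<pi> g"
    using f assms(4) by (auto simp: hom_post_def hom_def Pi_iff fun_eq_iff)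
qed

theorem hom_post_dichotomy:
  fixes A :: "('a, 'm) monoid_scheme" and V :: "('b, 'n) monoid_scheme" and W :: "('c, 'k) monoid_scheme"
  assumes "group A" "countable (carrier A)" "comm_group V" "countable (carrier V)"
    "comm_group W" "countable (carrier W)" "\<pi> \<in> hom V W"
  obtains (countable) C where "countable C" "C \<subseteq> carrier (hom_group A W)"
      "\<And>y. y \<in> carrier (hom_group A W) \<Longrightarrow>
         \<exists>c\<in>C. y \<otimes>\<^bsub>hom_group A W\<^esub> inv\<^bsub>hom_group A W\<^esub> c \<in> hom_post A \<pi> ` carrier (hom_group A V)"
  | (continuum) q :: "(nat \<Rightarrow> bool) \<Rightarrow> 'a \<Rightarrow> 'c" where "\<And>s. q s \<in> carrier (hom_group A W)"
      "\<And>s. countable {t. q t \<otimes>\<^bsub>hom_group A W\<^esub> inv\<^bsub>hom_group A W\<^esub> q s \<in> hom_post A \<pi> ` carrier (hom_group A V)}"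
proof -
  interpret A: group A by fact
  interpret P: filtered_group "hom_group A V" "hom_filtration A V"
    by (rule filtered_hom_group) fact+
  interpret Q: filtered_group "hom_group A W" "hom_filtration A W"
    by (rule filtered_hom_group) fact+
  have \<Phi>: "hom_post A \<pi> \<in> hom (hom_group A V) (hom_group A W)"
    by (rule hom_post_hom) fact+
  have one: "\<pi> \<one>\<^bsub>V\<^esub> = \<one>\<^bsub>W\<^esub>"
    using assms by (auto intro: hom_one comm_group.axioms(2))
  interpret filtered_hom "hom_group A V" "hom_filtration A V" "hom_group A W" "hom_filtration A W" "hom_post A \<pi>"
  proof
    show "hom_post A \<pi> x \<in> hom_filtration A W n" if "x \<in> hom_filtration A V n" for x n
      using that hom_in_carrier[OF \<Phi>, of x] one from_nat_into[of "carrier A"] A.carrier_not_empty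
      by (auto simp: hom_filtration_def hom_post_def)
  qed (rule \<Phi>)
  show ?thesis using cokernel_dichotomy countable continuum by metis
qed

section \<open>Injective resolutions\<close>

lemma divisible_epi:
  assumes "group G" "group H" "f \<in> hom G H" "f ` carrier G = carrier H" "divisible G"
  shows "divisible H"
  using divisible_hom_image[OF assms(1,2,3,5)] assms(4) by (simp add: divisible_def nat_pow_def)

lemma (in group) r_coset_eq_iff:
  assumes "subgroup K G" "a \<in> carrier G" "b \<in> carrier G"
  shows "K #> a = K #> b \<longleftrightarrow> a \<otimes> inv b \<in> K"
proof
  assume "K #> a = K #> b"
  then have "a \<in> K #> b" using rcos_self[OF assms(2,1)] by simp
  then show "a \<otimes> inv b \<in> K" using subgroup.rcos_module[OF assms(1) is_group assms(3,2)] by simp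
next
  assume "a \<otimes> inv b \<in> K"
  then have "a \<in> K #> b" using subgroup.rcos_module[OF assms(1) is_group assms(3,2)] by simp
  then show "K #> a = K #> b" using repr_independence[OF _ assms(3,1)] by simp
qed

lemma countable_FactGroup: "countable (carrier G) \<Longrightarrow> countable (carrier (G Mod K))"
  by (simp add: carrier_FactGroup)

text \<open>Writing \<open>B\<close> as \<open>\<int>\<^sup>(\<^sup>B\<^sup>) / L\<close>, the divisible group is \<open>\<rat>\<^sup>(\<^sup>B\<^sup>) / L\<close>.\<close>

lemma countable_divisible_embedding:
  fixes B :: "('b, 'n) monoid_scheme"
  assumes "comm_group B" and cB: "countable (carrier B)"
  obtains D :: "('b \<Rightarrow> rat) set monoid" and \<iota>
  where "comm_group D" "divisible D" "countable (carrier D)" "\<iota> \<in> mon B D"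
proof -
  interpret B: comm_group B by fact
  let ?H = "\<lambda>_ :: 'b. rat_group"
  define X where "X = sum_group (carrier B) ?H"
  have ratg [simp]: "group rat_group" by (rule comm_group.axioms(2)[OF comm_group_rat_group])
  interpret X: comm_group X
    unfolding X_def by (rule comm_group_sum_group) (rule comm_group_rat_group)
  define u where "u b = sum_unit (carrier B) ?H b 1" for b
  have u: "u b \<in> carrier X" if "b \<in> carrier B" for b
    using hom_in_carrier[OF sum_unit_hom[of "carrier B" ?H b], of 1] that by (simp add: u_def X_def)
  then obtain hX where hX: "hX \<in> hom (free_Abelian_group (carrier B)) X" "\<And>b. b \<in> carrier B \<Longrightarrow> hX (frag_of b) = u b"
    using X.free_Abelian_group_universal[of u "carrier B"] by blast
  interpret FG: comm_group "free_Abelian_group (carrier B)" by (rule abelian_free_Abelian_group)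
  interpret hX: group_hom "free_Abelian_group (carrier B)" X hX
    by (simp add: group_hom_def group_hom_axioms_def hX)
  interpret ev: group_hom "free_Abelian_group (carrier B)" B B.frag_eval
    by (simp add: group_hom_def group_hom_axioms_def B.frag_eval_hom)
  have coord: "hX x b = of_int (lookup x b)" if "keys x \<subseteq> carrier B" "b \<in> carrier B" for x b
  proof -
    have "(\<lambda>x. x b) \<in> hom X rat_group"
      unfolding X_def by (rule proj_hom_sum_group) (auto simp: that)
    with hX(1) have "(\<lambda>x. hX x b) \<in> hom (free_Abelian_group (carrier B)) rat_group"
      by (rule hom_comp)
    from frag_hom_single_support[OF comm_group_rat_group this that] show ?thesis
      using that by (simp add: hX(2) u_def sum_unit_def)
  qed
  \<comment> \<open>By its coordinates, \<open>hX\<close> is the inclusion of integral into rational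
    vectors.\<close>
  have inj: "x = y" if "keys x \<subseteq> carrier B" "keys y \<subseteq> carrier B" "hX x = hX y" for x y
  proof (rule poly_mapping_eqI)
    fix b
    show "lookup x b = lookup y b"
    proof (cases "b \<in> carrier B")
      case True
      then show ?thesis using coord[OF that(1) True] coord[OF that(2) True] that(3) by simp
    next
      case False
      then have "b \<notin> keys x" "b \<notin> keys y" using that by auto
      then show ?thesis by (simp add: in_keys_iff)
    qed
  qed
  define L where "L = kernel (free_Abelian_group (carrier B)) B B.frag_eval"
  define K where "K = hX ` L"
  have K: "subgroup K X"
    unfolding K_def L_def by (rule hX.subgroup_img_is_subgroup[OF ev.subgroup_kernel])
  define D where "D = X Mod K"
  interpret D: comm_group D unfolding D_def by (rule X.abelian_FactGroup[OF K])
  interpret KN: normal K X by (rule X.subgroup_imp_normal[OF K])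
  define \<iota> where "\<iota> b = K #>\<^bsub>X\<^esub> u b" for b
  have cosets: "(\<lambda>x. K #>\<^bsub>X\<^esub> x) \<in> hom X D" unfolding D_def by (rule KN.r_coset_hom_Mod)
  have onto: "(\<lambda>x. K #>\<^bsub>X\<^esub> x) ` carrier X = carrier D" by (simp add: D_def carrier_FactGroup)
  have hom: "\<iota> \<in> hom B D"
  proof (rule homI)
    show "\<iota> b \<in> carrier D" if "b \<in> carrier B" for b
      unfolding \<iota>_def using hom_in_carrier[OF cosets u[OF that]] .
    show "\<iota> (a \<otimes>\<^bsub>B\<^esub> b) = \<iota> a \<otimes>\<^bsub>D\<^esub> \<iota> b" if ab: "a \<in> carrier B" "b \<in> carrier B" for a b
    proof -
      \<comment> \<open>The relation expressing that the generator of a product is the sum of the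
        generators; evaluation kills it, so it lies in \<open>L\<close>.\<close>
      define z where "z = frag_of (a \<otimes>\<^bsub>B\<^esub> b) \<otimes>\<^bsub>free_Abelian_group (carrier B)\<^esub> inv\<^bsub>free_Abelian_group (carrier B)\<^esub>
          (frag_of a \<otimes>\<^bsub>free_Abelian_group (carrier B)\<^esub> frag_of b)"
      have c: "frag_of a \<in> carrier (free_Abelian_group (carrier B))" "frag_of b \<in> carrier (free_Abelian_group (carrier B))"
        "frag_of (a \<otimes>\<^bsub>B\<^esub> b) \<in> carrier (free_Abelian_group (carrier B))" using ab by auto
      note ev.hom_mult[simp del] hX.hom_mult[simp del]
      have "B.frag_eval z = \<one>\<^bsub>B\<^esub>"
        unfolding z_def using c ab
        by (simp only: ev.hom_mult ev.hom_inv FG.m_closed FG.inv_closed B.frag_eval_of B.m_closed B.r_inv)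
      moreover have "z \<in> carrier (free_Abelian_group (carrier B))"
        unfolding z_def using c by (simp only: FG.m_closed FG.inv_closed)
      ultimately have "z \<in> L" by (simp add: L_def kernel_def)
      then have "hX z \<in> K" by (simp add: K_def)
      also have "hX z = u (a \<otimes>\<^bsub>B\<^esub> b) \<otimes>\<^bsub>X\<^esub> inv\<^bsub>X\<^esub> (u a \<otimes>\<^bsub>X\<^esub> u b)"
        unfolding z_def using c ab
        by (simp only: hX.hom_mult hX.hom_inv FG.m_closed FG.inv_closed hX(2) B.m_closed)
      finally have "\<iota> (a \<otimes>\<^bsub>B\<^esub> b) = K #>\<^bsub>X\<^esub> (u a \<otimes>\<^bsub>X\<^esub> u b)"
        unfolding \<iota>_def using ab u X.r_coset_eq_iff[OF K] by simp
      also have "\<dots> = \<iota> a \<otimes>\<^bsub>D\<^esub> \<iota> b"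
        unfolding \<iota>_def by (rule hom_mult[OF cosets]) (use ab u in auto)
      finally show ?thesis .
    qed
  qed
  have "inj_on \<iota> (carrier B)"
  proof (rule inj_onI)
    fix a b assume ab: "a \<in> carrier B" "b \<in> carrier B" "\<iota> a = \<iota> b"
    then have "u a \<otimes>\<^bsub>X\<^esub> inv\<^bsub>X\<^esub> u b \<in> K"
      unfolding \<iota>_def using u X.r_coset_eq_iff[OF K] by blast
    then obtain x where x: "x \<in> L" "hX x = u a \<otimes>\<^bsub>X\<^esub> inv\<^bsub>X\<^esub> u b" by (auto simp: K_def)
    \<comment> \<open>By injectivity of \<open>hX\<close>, the difference of \<open>u a\<close> and
      \<open>u b\<close> comes only from the difference of the two generators, which must therefore
      be a relation in \<open>B\<close>.\<close>
    define z where "z = frag_of a \<otimes>\<^bsub>free_Abelian_group (carrier B)\<^esub> inv\<^bsub>free_Abelian_group (carrier B)\<^esub> frag_of b"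
    have c: "frag_of a \<in> carrier (free_Abelian_group (carrier B))" "frag_of b \<in> carrier (free_Abelian_group (carrier B))"
      using ab by auto
    have z: "z \<in> carrier (free_Abelian_group (carrier B))"
      unfolding z_def using c by (simp only: FG.m_closed FG.inv_closed)
    have "hX z = u a \<otimes>\<^bsub>X\<^esub> inv\<^bsub>X\<^esub> u b"
      unfolding z_def using c ab by (simp only: hX.hom_mult hX.hom_inv FG.inv_closed hX(2))
    then have "x = z" using x z by (intro inj) (auto simp: L_def kernel_def)
    then have "B.frag_eval z = \<one>\<^bsub>B\<^esub>" using x by (simp add: L_def kernel_def)
    moreover have "B.frag_eval z = a \<otimes>\<^bsub>B\<^esub> inv\<^bsub>B\<^esub> b"
      unfolding z_def using c ab by (simp only: ev.hom_mult ev.hom_inv FG.inv_closed B.frag_eval_of)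
    ultimately show "a = b" using ab by (simp add: B.inv_solve_right')
  qed
  then have "\<iota> \<in> mon B D" using hom by (simp add: mon_def)
  moreover have "divisible D"
    by (rule divisible_epi[OF X.is_group D.is_group cosets onto])
      (auto simp: X_def intro!: divisible_sum_group divisible_rat_group)
  moreover have "countable (carrier D)"
    unfolding D_def X_def by (intro countable_FactGroup countable_sum_group) (auto simp: cB)
  ultimately show ?thesis using that D.comm_group_axioms by blast
qed

text \<open>An \<open>n\<close>-th root of \<open>f\<close> has to send \<open>a [^] n\<close> to
  \<open>f a\<close>. Torsion-freeness makes this well defined on \<open>n\<close>-th powers, and
  divisibility of \<open>V\<close> extends it to all of \<open>A\<close>.\<close>

lemma divisible_hom_group:
  assumes "comm_group A" "torsion_free A" "comm_group V" "divisible V"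
  shows "divisible (hom_group A V)"
  unfolding divisible_def
proof (intro ballI allI impI)
  interpret A: comm_group A by fact
  interpret V: comm_group V by fact
  interpret AV: group "A \<times>\<times> V" by (simp add: DirProd_group)
  interpret H: comm_group "hom_group A V" by (rule comm_group_hom_group) (auto intro: assms)
  fix f and n :: nat assume f: "f \<in> carrier (hom_group A V)" and n: "n > 0"
  interpret f: group_hom A V f using f by unfold_locales auto
  define R where "R = (\<lambda>a. (a [^]\<^bsub>A\<^esub> n, f a)) ` carrier A"
  have "(\<lambda>a. (a [^]\<^bsub>A\<^esub> n, f a)) \<in> hom A (A \<times>\<times> V)"
    by (auto simp: hom_def A.nat_pow_distrib)
  then have R: "subgroup R (A \<times>\<times> V)"
    unfolding R_def by (intro group_hom.img_is_subgroup) (simp add: group_hom_def group_hom_axioms_def)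
  have "x = \<one>\<^bsub>V\<^esub>" if "(\<one>\<^bsub>A\<^esub>, x) \<in> R" for x
  proof -
    obtain a where a: "a \<in> carrier A" "\<one>\<^bsub>A\<^esub> = a [^]\<^bsub>A\<^esub> n" "x = f a" using \<open>(\<one>\<^bsub>A\<^esub>, x) \<in> R\<close> by (auto simp: R_def)
    then have "a = \<one>\<^bsub>A\<^esub>" using assms(2) n unfolding torsion_free_def by metis
    then show ?thesis using a(3) f.hom_one by (simp only:)
  qed
  then obtain h where h: "h \<in> hom A V" "\<And>a x. (a, x) \<in> R \<Longrightarrow> h a = x"
    using partial_hom_extend[OF assms(1,3,4) R] by blast
  interpret h: group_hom A V h by unfold_locales (rule h)
  define g where "g = restrict h (carrier A)"
  have g: "g \<in> carrier (hom_group A V)"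
    using h(1) by (intro hom_groupI) (auto simp: g_def)
  have "g [^]\<^bsub>hom_group A V\<^esub> n = f"
  proof (rule extensionalityI)
    have "g [^]\<^bsub>hom_group A V\<^esub> n \<in> carrier (hom_group A V)" using g by (rule H.nat_pow_closed)
    then show "g [^]\<^bsub>hom_group A V\<^esub> n \<in> extensional (carrier A)" by simp
    show "f \<in> extensional (carrier A)" using f by simp
    fix a assume a: "a \<in> carrier A"
    have "(g [^]\<^bsub>hom_group A V\<^esub> n) a = g a [^]\<^bsub>V\<^esub> n"
      by (rule hom_nat_pow[OF eval_hom_group[OF a] g H.is_group V.is_group])
    also have "\<dots> = h (a [^]\<^bsub>A\<^esub> n)" using a by (simp add: g_def h.hom_nat_pow)
    also have "\<dots> = f a" using a by (intro h(2)) (auto simp: R_def)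
    finally show "(g [^]\<^bsub>hom_group A V\<^esub> n) a = f a" .
  qed
  then show "\<exists>y\<in>carrier (hom_group A V). y [^]\<^bsub>hom_group A V\<^esub> n = f" using g by blast
qed

section \<open>Extensions and the Baer sum\<close>

lemma bij_betw_imp_ex_inverse:
  assumes "bij_betw f S T"
  obtains g where "\<And>x. x \<in> T \<Longrightarrow> g x \<in> S" "\<And>x. x \<in> T \<Longrightarrow> f (g x) = x" "\<And>x. x \<in> S \<Longrightarrow> g (f x) = x"
  using assms that[of "inv_into S f"]
  by (metis bij_betw_imp_inj_on bij_betw_inv_into_left bij_betw_inv_into_right bij_betw_imp_surj_on inv_into_into)

locale abelian_extension = A: comm_group A + B: comm_group B
  for A :: "('a, 'm) monoid_scheme" and B :: "('b, 'n) monoid_scheme" and E :: "('a, 'b, 'e) extension" +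
  assumes is_ext: "is_extension A B E"
begin

sublocale M: comm_group "middle E"
  using is_ext by (simp add: is_extension_def)

sublocale inc: group_hom B "middle E" "inc E"
  using is_ext by unfold_locales (simp add: is_extension_def mon_def)

sublocale prj: group_hom "middle E" A "prj E"
  using is_ext by unfold_locales (simp add: is_extension_def epi_def)

lemma inc_inj: "b \<in> carrier B \<Longrightarrow> c \<in> carrier B \<Longrightarrow> inc E b = inc E c \<longleftrightarrow> b = c"
  using is_ext by (auto simp: is_extension_def mon_def inj_on_eq_iff)

lemma prj_surj:
  assumes "a \<in> carrier A" obtains x where "x \<in> carrier (middle E)" "prj E x = a"
proof -
  have "a \<in> prj E ` carrier (middle E)" using is_ext assms by (simp add: is_extension_def epi_def)
  then show ?thesis using that by blast
qed

lemma prj_inc [simp]: "b \<in> carrier B \<Longrightarrow> prj E (inc E b) = \<one>\<^bsub>A\<^esub>"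
  using is_ext by (auto simp: is_extension_def kernel_def)

lemma prj_eq_oneE:
  assumes "x \<in> carrier (middle E)" "prj E x = \<one>\<^bsub>A\<^esub>"
  obtains b where "b \<in> carrier B" "x = inc E b"
proof -
  have "x \<in> inc E ` carrier B" using is_ext assms by (auto simp: is_extension_def kernel_def)
  then show ?thesis using that by blast
qed

lemma prj_eqE:
  assumes "x \<in> carrier (middle E)" "y \<in> carrier (middle E)" "prj E x = prj E y"
  obtains b where "b \<in> carrier B" "x = y \<otimes>\<^bsub>middle E\<^esub> inc E b"
proof -
  have "prj E (inv\<^bsub>middle E\<^esub> y \<otimes>\<^bsub>middle E\<^esub> x) = \<one>\<^bsub>A\<^esub>"
    using assms by simp
  then obtain b where b: "b \<in> carrier B" "inv\<^bsub>middle E\<^esub> y \<otimes>\<^bsub>middle E\<^esub> x = inc E b"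
    using assms by (metis M.inv_closed M.m_closed prj_eq_oneE)
  then have "x = y \<otimes>\<^bsub>middle E\<^esub> inc E b"
    using assms by (metis M.inv_closed M.inv_solve_left' inc.hom_closed)
  then show ?thesis using that b by blast
qed

text \<open>Every fibre of \<open>prj E\<close> is a translate of the image of \<open>B\<close>, so
  a choice of one lift per element of \<open>A\<close>, made without regard to multiplication, gives
  the bijection.\<close>

lemma ex_section_bij:
  obtains g where "bij_betw g (carrier A \<times> carrier B) (carrier (middle E))"
proof -
  define \<sigma> where "\<sigma> a = (SOME x. x \<in> carrier (middle E) \<and> prj E x = a)" for a
  have \<sigma>: "\<sigma> a \<in> carrier (middle E)" "prj E (\<sigma> a) = a" if "a \<in> carrier A" for a
    using someI_ex[of "\<lambda>x. x \<in> carrier (middle E) \<and> prj E x = a"] prj_surj[OF that] unfolding \<sigma>_def by metis+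
  have "bij_betw (\<lambda>(a, b). \<sigma> a \<otimes>\<^bsub>middle E\<^esub> inc E b) (carrier A \<times> carrier B) (carrier (middle E))"
    unfolding bij_betw_def
  proof
    show "inj_on (\<lambda>(a, b). \<sigma> a \<otimes>\<^bsub>middle E\<^esub> inc E b) (carrier A \<times> carrier B)"
    proof (rule inj_onI, clarsimp)
      fix a b c d assume *: "a \<in> carrier A" "b \<in> carrier B" "c \<in> carrier A" "d \<in> carrier B"
        "\<sigma> a \<otimes>\<^bsub>middle E\<^esub> inc E b = \<sigma> c \<otimes>\<^bsub>middle E\<^esub> inc E d"
      have "prj E (\<sigma> a \<otimes>\<^bsub>middle E\<^esub> inc E b) = prj E (\<sigma> c \<otimes>\<^bsub>middle E\<^esub> inc E d)" by (simp only: *(5))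
      then have "a = c" using *(1-4) \<sigma> by simp
      then show "a = c \<and> b = d" using * \<sigma> by (simp add: inc_inj)
    qed
    show "(\<lambda>(a, b). \<sigma> a \<otimes>\<^bsub>middle E\<^esub> inc E b) ` (carrier A \<times> carrier B) = carrier (middle E)"
    proof
      show "carrier (middle E) \<subseteq> (\<lambda>(a, b). \<sigma> a \<otimes>\<^bsub>middle E\<^esub> inc E b) ` (carrier A \<times> carrier B)"
      proof
        fix x assume x: "x \<in> carrier (middle E)"
        then obtain b where "b \<in> carrier B" "x = \<sigma> (prj E x) \<otimes>\<^bsub>middle E\<^esub> inc E b"
          using \<sigma> prj_eqE[OF x, of "\<sigma> (prj E x)"] by auto
        then show "x \<in> (\<lambda>(a, b). \<sigma> a \<otimes>\<^bsub>middle E\<^esub> inc E b) ` (carrier A \<times> carrier B)"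
          using x by force
      qed
    qed (use \<sigma> in auto)
  qed
  then show ?thesis by (rule that)
qed

text \<open>Transport of structure along \<open>ex_section_bij\<close>.\<close>

lemma ex_equiv_on_product:
  obtains F :: "('a, 'b, 'a \<times> 'b) extension" where "is_extension A B F" "ext_equiv B F E"
proof -
  obtain g where g: "bij_betw g (carrier A \<times> carrier B) (carrier (middle E))" by (rule ex_section_bij)
  obtain h where h: "\<And>x. x \<in> carrier (middle E) \<Longrightarrow> h x \<in> carrier A \<times> carrier B"
    "\<And>x. x \<in> carrier (middle E) \<Longrightarrow> g (h x) = x" "\<And>y. y \<in> carrier A \<times> carrier B \<Longrightarrow> h (g y) = y"
    using bij_betw_imp_ex_inverse[OF g] by metis
  have gc: "g y \<in> carrier (middle E)" if "y \<in> carrier A \<times> carrier B" for y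
    using bij_betwE[OF g] that by blast
  define G :: "('a \<times> 'b) monoid" where
    "G = \<lparr>carrier = carrier A \<times> carrier B, monoid.mult = (\<lambda>x y. h (g x \<otimes>\<^bsub>middle E\<^esub> g y)), one = h \<one>\<^bsub>middle E\<^esub>\<rparr>"
  have hhom: "h \<in> hom (middle E) G"
    using h gc by (auto simp: hom_def G_def Pi_iff)
  have him: "h ` carrier (middle E) = carrier G"
  proof
    show "h ` carrier (middle E) \<subseteq> carrier G" by (rule image_subsetI) (simp add: G_def h(1))
    show "carrier G \<subseteq> h ` carrier (middle E)"
    proof
      fix y assume y: "y \<in> carrier G"
      then have "y = h (g y)" "g y \<in> carrier (middle E)" using h(3) gc by (simp_all add: G_def)
      then show "y \<in> h ` carrier (middle E)" by (rule image_eqI)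
    qed
  qed
  have "comm_group (G\<lparr>carrier := h ` carrier (middle E), one := h \<one>\<^bsub>middle E\<^esub>\<rparr>)"
    by (rule M.hom_imp_img_comm_group[OF hhom])
  then have "comm_group G" unfolding him by (simp add: G_def)
  then interpret G: comm_group G .
  have ghom: "g \<in> hom G (middle E)"
    using h gc by (auto simp: hom_def G_def)
  define F where "F = \<lparr>middle = G, inc = (\<lambda>b. h (inc E b)), prj = (\<lambda>y. prj E (g y))\<rparr>"
  have "is_extension A B F"
    unfolding is_extension_def
  proof (intro conjI)
    show "comm_group (middle F)" by (simp add: F_def G.comm_group_axioms)
    have "(\<lambda>b. h (inc E b)) \<in> hom B G" by (rule hom_comp[OF inc.homh hhom])
    moreover have "inj_on (\<lambda>b. h (inc E b)) (carrier B)"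
      by (rule inj_onI) (metis h(2) inc.hom_closed inc_inj)
    ultimately show "inc F \<in> mon B (middle F)" by (simp add: F_def mon_def)
    have "(\<lambda>y. prj E (g y)) \<in> hom G A" by (rule hom_comp[OF ghom prj.homh])
    moreover have "carrier A \<subseteq> (\<lambda>y. prj E (g y)) ` carrier G"
    proof
      fix a assume "a \<in> carrier A"
      then obtain x where "x \<in> carrier (middle E)" "prj E x = a" by (rule prj_surj)
      then show "a \<in> (\<lambda>y. prj E (g y)) ` carrier G"
        using h by (intro image_eqI[of _ _ "h x"]) (auto simp: G_def)
    qed
    ultimately show "prj F \<in> epi (middle F) A" by (simp add: F_def epi_iff_subset)
    show "inc F ` carrier B = kernel (middle F) A (prj F)"
    proof
      show "inc F ` carrier B \<subseteq> kernel (middle F) A (prj F)"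
        by (rule image_subsetI) (simp add: F_def kernel_def G_def h)
      show "kernel (middle F) A (prj F) \<subseteq> inc F ` carrier B"
      proof
        fix y assume "y \<in> kernel (middle F) A (prj F)"
        then have y: "y \<in> carrier A \<times> carrier B" "prj E (g y) = \<one>\<^bsub>A\<^esub>" by (auto simp: F_def kernel_def G_def)
        then obtain b where "b \<in> carrier B" "g y = inc E b" using gc by (auto elim: prj_eq_oneE[rotated])
        then show "y \<in> inc F ` carrier B" using h(3)[OF y(1)] by (auto simp: F_def)
      qed
    qed
  qed
  moreover have "ext_equiv B F E"
    unfolding ext_equiv_def
  proof (intro bexI[of _ g] conjI ballI)
    show "g \<in> iso (middle F) (middle E)" using g ghom by (simp add: F_def iso_def G_def)
    show "g (inc F b) = inc E b" if "b \<in> carrier B" for b using h(2) that by (simp add: F_def)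
  qed (simp add: F_def)
  ultimately show ?thesis by (rule that)
qed

end

section \<open>Equivalence of extensions\<close>

lemma ext_equiv_trans: "ext_equiv B E F \<Longrightarrow> ext_equiv B F H \<Longrightarrow> ext_equiv B E H"
  unfolding ext_equiv_def
proof (elim bexE conjE)
  fix h k assume h: "h \<in> iso (middle E) (middle F)" "\<forall>b\<in>carrier B. h (inc E b) = inc F b"
    "\<forall>x\<in>carrier (middle E). prj F (h x) = prj E x"
    and k: "k \<in> iso (middle F) (middle H)" "\<forall>b\<in>carrier B. k (inc F b) = inc H b"
    "\<forall>x\<in>carrier (middle F). prj H (k x) = prj F x"
  have "h x \<in> carrier (middle F)" if "x \<in> carrier (middle E)" for x
    using h(1) that by (auto simp: iso_def hom_def)
  then show "\<exists>h\<in>iso (middle E) (middle H). (\<forall>b\<in>carrier B. h (inc E b) = inc H b) \<and>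
         (\<forall>x\<in>carrier (middle E). prj H (h x) = prj E x)"
    using h k iso_set_trans[OF h(1) k(1)] by (intro bexI[of _ "k \<circ> h"]) auto
qed

lemma ext_equiv_sym:
  assumes "group (middle E)" "inc E ` carrier B \<subseteq> carrier (middle E)" "ext_equiv B E F"
  shows "ext_equiv B F E"
proof -
  obtain h where h: "h \<in> iso (middle E) (middle F)" "\<forall>b\<in>carrier B. h (inc E b) = inc F b"
    "\<forall>x\<in>carrier (middle E). prj F (h x) = prj E x"
    using assms(3) unfolding ext_equiv_def by blast
  have bij: "inj_on h (carrier (middle E))" "h ` carrier (middle E) = carrier (middle F)"
    using h(1) by (auto simp: iso_def bij_betw_def)
  define k where "k = inv_into (carrier (middle E)) h"
  have "k \<in> iso (middle F) (middle E)"
    unfolding k_def by (rule group.iso_set_sym[OF assms(1) h(1)])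
  moreover have "k (inc F b) = inc E b" if "b \<in> carrier B" for b
    using that h(2) bij assms(2) unfolding k_def by (metis image_subset_iff inv_into_f_f)
  moreover have "prj E (k x) = prj F x" if "x \<in> carrier (middle F)" for x
    using that h(3) bij(2) unfolding k_def by (metis f_inv_into_f inv_into_into)
  ultimately show ?thesis unfolding ext_equiv_def by blast
qed

lemma ext_class_eqI:
  assumes "group (middle E)" "inc E ` carrier B \<subseteq> carrier (middle E)" "ext_equiv B E F"
  shows "ext_class A B E = ext_class A B F"
  unfolding ext_class_def
  by (auto intro: ext_equiv_trans[OF assms(3)] ext_equiv_trans[OF ext_equiv_sym[OF assms]])

text \<open>An injective resolution \<open>0 \<rightarrow> B \<rightarrow> D \<rightarrow> I \<rightarrow> 0\<close> and an argument \<open>A\<close> of \<open>Ext(A, B)\<close>.\<close>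

locale ext_resolution = A: comm_group A + B: comm_group B + D: comm_group D + I: comm_group I
  for A :: "('a, 'm) monoid_scheme" and B :: "('b, 'n) monoid_scheme"
    and D :: "('d, 'k) monoid_scheme" and I :: "('i, 'l) monoid_scheme" +
  fixes \<iota> :: "'b \<Rightarrow> 'd" and \<pi> :: "'d \<Rightarrow> 'i"
  assumes \<iota>_mon: "\<iota> \<in> mon B D" and \<pi>_epi: "\<pi> \<in> epi D I"
    and exact: "\<iota> ` carrier B = kernel D I \<pi>" and divD: "divisible D"
begin

sublocale \<iota>: group_hom B D \<iota>
  using \<iota>_mon by unfold_locales (simp add: mon_def)

sublocale \<pi>: group_hom D I \<pi>
  using \<pi>_epi by unfold_locales (simp add: epi_def)

lemma \<iota>_inj: "b \<in> carrier B \<Longrightarrow> c \<in> carrier B \<Longrightarrow> \<iota> b = \<iota> c \<longleftrightarrow> b = c"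
  using \<iota>_mon by (auto simp: mon_def inj_on_eq_iff)

lemma \<pi>_surj: "i \<in> carrier I \<Longrightarrow> \<exists>d\<in>carrier D. \<pi> d = i"
proof -
  assume "i \<in> carrier I"
  then have "i \<in> \<pi> ` carrier D" using \<pi>_epi by (simp add: epi_def)
  then show ?thesis by blast
qed

lemma \<pi>_\<iota> [simp]: "b \<in> carrier B \<Longrightarrow> \<pi> (\<iota> b) = \<one>\<^bsub>I\<^esub>"
  using exact by (auto simp: kernel_def)

lemma \<pi>_eq_oneD: "d \<in> carrier D \<Longrightarrow> \<pi> d = \<one>\<^bsub>I\<^esub> \<Longrightarrow> \<exists>b\<in>carrier B. d = \<iota> b"
  using exact by (auto simp: kernel_def)

lemma divI: "divisible I"
  by (rule divisible_epi[OF D.is_group I.is_group \<pi>.homh _ divD]) (use \<pi>_epi in \<open>simp add: epi_def\<close>)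

text \<open>The resolution pulled back along \<open>\<phi>\<close>: the fibre product of
  \<open>A\<close> and \<open>D\<close> over \<open>I\<close>. Every extension will turn out to be
  equivalent to one of these.\<close>

definition pullback :: "('a \<Rightarrow> 'i) \<Rightarrow> ('a, 'b, 'a \<times> 'd) extension" where
  "pullback \<phi> = \<lparr>middle = \<lparr>carrier = {(a, d). a \<in> carrier A \<and> d \<in> carrier D \<and> \<phi> a = \<pi> d},
      monoid.mult = (\<otimes>\<^bsub>A \<times>\<times> D\<^esub>), one = \<one>\<^bsub>A \<times>\<times> D\<^esub>\<rparr>,
     inc = (\<lambda>b. (\<one>\<^bsub>A\<^esub>, \<iota> b)), prj = fst\<rparr>"

lemma pullback_simps [simp]:
  "(a, d) \<in> carrier (middle (pullback \<phi>)) \<longleftrightarrow> a \<in> carrier A \<and> d \<in> carrier D \<and> \<phi> a = \<pi> d"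
  "(a, d) \<otimes>\<^bsub>middle (pullback \<phi>)\<^esub> (a', d') = (a \<otimes>\<^bsub>A\<^esub> a', d \<otimes>\<^bsub>D\<^esub> d')"
  "\<one>\<^bsub>middle (pullback \<phi>)\<^esub> = (\<one>\<^bsub>A\<^esub>, \<one>\<^bsub>D\<^esub>)"
  "inc (pullback \<phi>) b = (\<one>\<^bsub>A\<^esub>, \<iota> b)" "prj (pullback \<phi>) = fst"
  by (auto simp: pullback_def)

lemma is_extension_pullback:
  assumes \<phi>: "\<phi> \<in> hom A I"
  shows "is_extension A B (pullback \<phi>)"
proof -
  interpret \<phi>: group_hom A I \<phi> by unfold_locales (rule \<phi>)
  interpret P: comm_group "A \<times>\<times> D" by (rule comm_group_DirProd) (rule A.comm_group_axioms D.comm_group_axioms)+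
  define S where "S = {(a, d). a \<in> carrier A \<and> d \<in> carrier D \<and> \<phi> a = \<pi> d}"
  have "subgroup S (A \<times>\<times> D)"
    by (rule P.subgroupI) (auto simp: S_def intro!: exI[of _ "\<one>\<^bsub>A\<^esub>"] exI[of _ "\<one>\<^bsub>D\<^esub>"])
  then have "comm_group ((A \<times>\<times> D)\<lparr>carrier := S\<rparr>)" by (rule P.comm_group_subgroup)
  moreover have "(A \<times>\<times> D)\<lparr>carrier := S\<rparr> = middle (pullback \<phi>)"
    by (simp add: pullback_def S_def DirProd_def)
  ultimately have "comm_group (middle (pullback \<phi>))" by simp
  moreover have "inc (pullback \<phi>) \<in> mon B (middle (pullback \<phi>))"
    by (auto simp: mon_def hom_def inj_on_def \<iota>_inj)
  moreover have "prj (pullback \<phi>) \<in> epi (middle (pullback \<phi>)) A"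
  proof -
    have "carrier A \<subseteq> fst ` carrier (middle (pullback \<phi>))"
    proof
      fix a assume a: "a \<in> carrier A"
      then obtain d where "d \<in> carrier D" "\<pi> d = \<phi> a" using \<pi>_surj \<phi>.hom_closed by blast
      then have "(a, d) \<in> carrier (middle (pullback \<phi>))" using a by simp
      then show "a \<in> fst ` carrier (middle (pullback \<phi>))" by (intro image_eqI[of _ fst "(a, d)"]) simp_all
    qed
    then show ?thesis by (auto simp: epi_iff_subset hom_def)
  qed
  moreover have "inc (pullback \<phi>) ` carrier B = kernel (middle (pullback \<phi>)) A (prj (pullback \<phi>))"
  proof
    show "inc (pullback \<phi>) ` carrier B \<subseteq> kernel (middle (pullback \<phi>)) A (prj (pullback \<phi>))"
      by (auto simp: kernel_def)
    show "kernel (middle (pullback \<phi>)) A (prj (pullback \<phi>)) \<subseteq> inc (pullback \<phi>) ` carrier B"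
    proof (rule subrelI)
      fix a d assume "(a, d) \<in> kernel (middle (pullback \<phi>)) A (prj (pullback \<phi>))"
      then have "a = \<one>\<^bsub>A\<^esub>" "d \<in> carrier D" "\<pi> d = \<one>\<^bsub>I\<^esub>" by (auto simp: kernel_def)
      then show "(a, d) \<in> inc (pullback \<phi>) ` carrier B" using \<pi>_eq_oneD[of d] by auto
    qed
  qed
  ultimately show ?thesis by (simp add: is_extension_def)
qed

lemma abelian_extension_pullback: "\<phi> \<in> hom A I \<Longrightarrow> abelian_extension A B (pullback \<phi>)"
  by (simp add: abelian_extension_def abelian_extension_axioms_def is_extension_pullback
      A.comm_group_axioms B.comm_group_axioms)

text \<open>A morphism from \<open>E\<close> to the resolution that is the identity on
  \<open>B\<close> and \<open>\<phi>\<close> on the quotients. Carrying \<open>r\<close> along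
  identifies the class of \<open>E\<close> without an explicit equivalence.\<close>

definition realises :: "('a, 'b, 'e) extension \<Rightarrow> ('a \<Rightarrow> 'i) \<Rightarrow> ('e \<Rightarrow> 'd) \<Rightarrow> bool" where
  "realises E \<phi> r \<longleftrightarrow> r \<in> hom (middle E) D \<and> (\<forall>b\<in>carrier B. r (inc E b) = \<iota> b) \<and>
     (\<forall>x\<in>carrier (middle E). \<pi> (r x) = \<phi> (prj E x))"

text \<open>The short five lemma for \<open>x \<mapsto> (prj E x, r x)\<close>: two elements with
  equal projection differ by some \<open>inc E b\<close>, on which \<open>r\<close> is the injective
  \<open>\<iota>\<close>, and a lift of \<open>a\<close> is corrected by such an element to hit a
  prescribed \<open>d\<close>.\<close>

lemma realises_imp_equiv:
  assumes "is_extension A B E" "\<phi> \<in> hom A I" "realises E \<phi> r"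
  shows "ext_equiv B E (pullback \<phi>)"
proof -
  interpret abelian_extension A B E by unfold_locales (rule assms)
  interpret r: group_hom "middle E" D r
    using assms(3) by unfold_locales (simp add: realises_def)
  have r: "\<And>b. b \<in> carrier B \<Longrightarrow> r (inc E b) = \<iota> b" "\<And>x. x \<in> carrier (middle E) \<Longrightarrow> \<pi> (r x) = \<phi> (prj E x)"
    using assms(3) by (auto simp: realises_def)
  have "(\<lambda>x. (prj E x, r x)) \<in> iso (middle E) (middle (pullback \<phi>))"
    unfolding iso_iff
  proof (intro conjI)
    show "(\<lambda>x. (prj E x, r x)) \<in> hom (middle E) (middle (pullback \<phi>))"
      using r by (auto simp: hom_def)
    show "inj_on (\<lambda>x. (prj E x, r x)) (carrier (middle E))"
    proof (rule inj_onI)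
      fix x y assume xy: "x \<in> carrier (middle E)" "y \<in> carrier (middle E)" "(prj E x, r x) = (prj E y, r y)"
      then obtain b where b: "b \<in> carrier B" "x = y \<otimes>\<^bsub>middle E\<^esub> inc E b" by (auto elim: prj_eqE)
      then have "\<iota> b = \<iota> \<one>\<^bsub>B\<^esub>" using xy r(1) by simp
      then have "b = \<one>\<^bsub>B\<^esub>" using b(1) \<iota>_inj by blast
      then show "x = y" using b xy by simp
    qed
    show "(\<lambda>x. (prj E x, r x)) ` carrier (middle E) = carrier (middle (pullback \<phi>))"
    proof
      show "carrier (middle (pullback \<phi>)) \<subseteq> (\<lambda>x. (prj E x, r x)) ` carrier (middle E)"
      proof (rule subrelI)
        fix a d assume "(a, d) \<in> carrier (middle (pullback \<phi>))"
        then have ad: "a \<in> carrier A" "d \<in> carrier D" "\<phi> a = \<pi> d" by auto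
        obtain x where x: "x \<in> carrier (middle E)" "prj E x = a" using prj_surj[OF ad(1)] .
        then have "\<pi> (inv\<^bsub>D\<^esub> r x \<otimes>\<^bsub>D\<^esub> d) = \<one>\<^bsub>I\<^esub>" using ad r(2) by simp
        then obtain b where b: "b \<in> carrier B" "inv\<^bsub>D\<^esub> r x \<otimes>\<^bsub>D\<^esub> d = \<iota> b"
          using \<pi>_eq_oneD x ad by (metis D.inv_closed D.m_closed r.hom_closed)
        then have "d = r x \<otimes>\<^bsub>D\<^esub> \<iota> b"
          using x ad by (metis D.inv_closed D.inv_solve_left' \<iota>.hom_closed r.hom_closed)
        then show "(a, d) \<in> (\<lambda>x. (prj E x, r x)) ` carrier (middle E)"
          using x b r(1) by (intro image_eqI[of _ _ "x \<otimes>\<^bsub>middle E\<^esub> inc E b"]) auto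
      qed
    qed (use r in auto)
  qed
  then show ?thesis
    unfolding ext_equiv_def using r by (intro bexI[of _ "\<lambda>x. (prj E x, r x)"]) auto
qed

lemma equiv_imp_realises:
  assumes "is_extension A B E" "ext_equiv B E (pullback \<phi>)"
  obtains r where "realises E \<phi> r"
proof -
  obtain h where h: "h \<in> iso (middle E) (middle (pullback \<phi>))" "\<forall>b\<in>carrier B. h (inc E b) = inc (pullback \<phi>) b"
    "\<forall>x\<in>carrier (middle E). prj (pullback \<phi>) (h x) = prj E x"
    using assms(2) unfolding ext_equiv_def by blast
  have hh: "h \<in> hom (middle E) (middle (pullback \<phi>))" using h(1) by (simp add: iso_def)
  have snd: "snd \<in> hom (middle (pullback \<phi>)) D" by (auto simp: hom_def)
  have "realises E \<phi> (\<lambda>x. snd (h x))"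
    unfolding realises_def
  proof (intro conjI ballI)
    show "(\<lambda>x. snd (h x)) \<in> hom (middle E) D" by (rule hom_comp[OF hh snd])
    show "snd (h (inc E b)) = \<iota> b" if "b \<in> carrier B" for b using h(2) that by simp
    show "\<pi> (snd (h x)) = \<phi> (prj E x)" if x: "x \<in> carrier (middle E)" for x
    proof -
      obtain a d where hx: "h x = (a, d)" by (metis surj_pair)
      then have "(a, d) \<in> carrier (middle (pullback \<phi>))" using hom_in_carrier[OF hh x] by simp
      moreover have "a = prj E x" using h(3) x hx by auto
      ultimately show ?thesis by (simp add: hx)
    qed
  qed
  then show ?thesis by (rule that)
qed

text \<open>Injectivity of \<open>D\<close> extends \<open>\<iota>\<close> along
  \<open>inc E\<close> to the middle term; on the quotients the extension induces
  \<open>\<phi>\<close>.\<close>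

lemma ex_realises:
  assumes "is_extension A B E"
  obtains \<phi> r where "\<phi> \<in> carrier (hom_group A I)" "realises E \<phi> r"
proof -
  interpret abelian_extension A B E by unfold_locales (rule assms)
  define R where "R = (\<lambda>b. (inc E b, \<iota> b)) ` carrier B"
  have "(\<lambda>b. (inc E b, \<iota> b)) \<in> hom B (middle E \<times>\<times> D)"
    by (simp add: hom_paired inc.homh \<iota>.homh)
  then have R: "subgroup R (middle E \<times>\<times> D)"
    unfolding R_def by (intro group_hom.img_is_subgroup)
      (simp add: group_hom_def group_hom_axioms_def DirProd_group)
  have "x = \<one>\<^bsub>D\<^esub>" if R1: "(\<one>\<^bsub>middle E\<^esub>, x) \<in> R" for x
  proof -
    obtain b where b: "b \<in> carrier B" "inc E b = \<one>\<^bsub>middle E\<^esub>" "x = \<iota> b" using R1 by (auto simp: R_def)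
    then have "b = \<one>\<^bsub>B\<^esub>" using inc_inj[of b "\<one>\<^bsub>B\<^esub>"] by simp
    then show ?thesis using b by simp
  qed
  then obtain r where r: "r \<in> hom (middle E) D" "\<And>e d. (e, d) \<in> R \<Longrightarrow> r e = d"
    using partial_hom_extend[OF M.comm_group_axioms D.comm_group_axioms divD R] by blast
  interpret r: group_hom "middle E" D r by unfold_locales (rule r)
  have rinc: "r (inc E b) = \<iota> b" if "b \<in> carrier B" for b
    using that by (intro r(2)) (auto simp: R_def)
  \<comment> \<open>Any lift of \<open>a\<close> gives the same value: two lifts differ by some
    \<open>inc E b\<close>, and \<open>\<pi> (\<iota> b)\<close> is trivial.\<close>
  define \<phi> where "\<phi> = (\<lambda>a\<in>carrier A. \<pi> (r (SOME x. x \<in> carrier (middle E) \<and> prj E x = a)))"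
  have \<phi>: "\<pi> (r x) = \<phi> (prj E x)" if x: "x \<in> carrier (middle E)" for x
  proof -
    define y where "y = (SOME y. y \<in> carrier (middle E) \<and> prj E y = prj E x)"
    have y: "y \<in> carrier (middle E)" "prj E x = prj E y"
      using someI[of "\<lambda>y. y \<in> carrier (middle E) \<and> prj E y = prj E x" x] x unfolding y_def by auto
    obtain b where b: "b \<in> carrier B" "x = y \<otimes>\<^bsub>middle E\<^esub> inc E b" using prj_eqE[OF x y] .
    then have "\<pi> (r x) = \<pi> (r y)" using y by (simp add: rinc)
    then show ?thesis using x by (simp add: \<phi>_def y_def)
  qed
  have "\<phi> \<in> carrier (hom_group A I)"
  proof (rule hom_groupI)
    show "\<phi> a \<in> carrier I" if a: "a \<in> carrier A" for a
    proof -
      obtain x where x: "x \<in> carrier (middle E)" "prj E x = a" using prj_surj[OF a] .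
      then show ?thesis using \<phi>[OF x(1)] by (metis \<pi>.hom_closed r.hom_closed)
    qed
    show "\<phi> (a \<otimes>\<^bsub>A\<^esub> b) = \<phi> a \<otimes>\<^bsub>I\<^esub> \<phi> b" if ab: "a \<in> carrier A" "b \<in> carrier A" for a b
    proof -
      obtain x where x: "x \<in> carrier (middle E)" "prj E x = a" using prj_surj[OF ab(1)] .
      obtain y where y: "y \<in> carrier (middle E)" "prj E y = b" using prj_surj[OF ab(2)] .
      show ?thesis using \<phi>[of "x \<otimes>\<^bsub>middle E\<^esub> y"] \<phi>[OF x(1)] \<phi>[OF y(1)] x y by simp
    qed
  qed (simp add: \<phi>_def)
  moreover have "realises E \<phi> r" using r rinc \<phi> by (simp add: realises_def)
  ultimately show ?thesis by (rule that)
qed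

section \<open>The connecting map from Hom(A,I) onto Ext(A,B)\<close>

definition cls :: "('a \<Rightarrow> 'i) \<Rightarrow> ('a, 'b, 'a \<times> 'b) extension set" where
  "cls \<phi> = ext_class A B (pullback \<phi>)"

lemma ext_class_eq_cls:
  assumes "is_extension A B E" "\<phi> \<in> hom A I" "realises E \<phi> r"
  shows "ext_class A B E = cls \<phi>"
proof -
  interpret abelian_extension A B E by unfold_locales (rule assms)
  show ?thesis unfolding cls_def
    by (rule ext_class_eqI) (auto intro: realises_imp_equiv[OF assms])
qed

lemma mem_cls_iff:
  assumes "\<phi> \<in> hom A I"
  shows "F \<in> cls \<phi> \<longleftrightarrow> is_extension A B F \<and> (\<exists>r. realises F \<phi> r)"
proof
  interpret P: abelian_extension A B "pullback \<phi>" by (rule abelian_extension_pullback[OF assms])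
  assume "F \<in> cls \<phi>"
  then have F: "is_extension A B F" "ext_equiv B (pullback \<phi>) F" by (auto simp: cls_def ext_class_def)
  have "ext_equiv B F (pullback \<phi>)"
    by (rule ext_equiv_sym[OF P.M.is_group _ F(2)]) (use P.inc.hom_closed in blast)
  then show "is_extension A B F \<and> (\<exists>r. realises F \<phi> r)" using F equiv_imp_realises by blast
next
  assume F: "is_extension A B F \<and> (\<exists>r. realises F \<phi> r)"
  then interpret F: abelian_extension A B F by unfold_locales blast
  have "ext_equiv B F (pullback \<phi>)" using F realises_imp_equiv[OF _ assms] by blast
  then have "ext_equiv B (pullback \<phi>) F"
    by (intro ext_equiv_sym[OF F.M.is_group]) (use F.inc.hom_closed in auto)
  then show "F \<in> cls \<phi>" using F by (auto simp: cls_def ext_class_def)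
qed

text \<open>The pullback lives on \<open>'a \<times> 'd\<close> while members of a class live on
  \<open>'a \<times> 'b\<close>, so a representative is obtained by transport of structure.\<close>

lemma cls_nonempty:
  assumes "\<phi> \<in> hom A I"
  obtains F where "F \<in> cls \<phi>"
proof -
  interpret P: abelian_extension A B "pullback \<phi>" by (rule abelian_extension_pullback[OF assms])
  obtain F :: "('a, 'b, 'a \<times> 'b) extension" where F: "is_extension A B F" "ext_equiv B F (pullback \<phi>)"
    by (rule P.ex_equiv_on_product)
  obtain r where "realises F \<phi> r" using equiv_imp_realises[OF F] .
  then have "F \<in> cls \<phi>" using F(1) mem_cls_iff[OF assms, of F] by blast
  then show ?thesis by (rule that)
qed

lemma carrier_Ext: "carrier (Ext A B) = cls ` carrier (hom_group A I)"
proof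
  show "carrier (Ext A B) \<subseteq> cls ` carrier (hom_group A I)"
  proof
    fix X assume "X \<in> carrier (Ext A B)"
    then obtain E :: "('a, 'b, 'a \<times> 'b) extension" where E: "is_extension A B E" "X = ext_class A B E"
      by (auto simp: Ext_def)
    then obtain \<phi> r where "\<phi> \<in> carrier (hom_group A I)" "realises E \<phi> r" by (elim ex_realises)
    then show "X \<in> cls ` carrier (hom_group A I)" using E ext_class_eq_cls by (intro image_eqI[of _ _ \<phi>]) auto
  qed
  show "cls ` carrier (hom_group A I) \<subseteq> carrier (Ext A B)"
  proof
    fix X assume "X \<in> cls ` carrier (hom_group A I)"
    then obtain \<phi> where \<phi>: "\<phi> \<in> hom A I" "X = cls \<phi>" by auto
    obtain F where "F \<in> cls \<phi>" using cls_nonempty[OF \<phi>(1)] .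
    then obtain r where "is_extension A B F" "realises F \<phi> r" using mem_cls_iff[OF \<phi>(1)] by auto
    then have "is_extension A B F" "X = ext_class A B F"
      using ext_class_eq_cls[OF _ \<phi>(1), of F r] \<phi>(2) by auto
    then show "X \<in> carrier (Ext A B)" by (simp add: Ext_def)
  qed
qed

text \<open>The quotient defining the Baer sum is the one by the kernel of \<open>(x, y) \<mapsto> (prj x, r x + r' y)\<close>.\<close>

lemma baer_sum_equiv_pullback:
  fixes E :: "('a, 'b, 'e) extension" and F :: "('a, 'b, 'f) extension"
  assumes E: "is_extension A B E" "realises E \<phi> r" and F: "is_extension A B F" "realises F \<psi> r'"
    and \<phi>: "\<phi> \<in> hom A I" and \<psi>: "\<psi> \<in> hom A I"
  defines "\<chi> \<equiv> \<phi> \<otimes>\<^bsub>hom_group A I\<^esub> \<psi>"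
  shows "ext_equiv B (baer_sum B E F) (pullback \<chi>)"
    and "group (middle (baer_sum B E F))"
    and "inc (baer_sum B E F) ` carrier B \<subseteq> carrier (middle (baer_sum B E F))"
proof -
  interpret E: abelian_extension A B E by unfold_locales (rule E)
  interpret F: abelian_extension A B F by unfold_locales (rule F)
  interpret r: group_hom "middle E" D r using E(2) by unfold_locales (simp add: realises_def)
  interpret r': group_hom "middle F" D r' using F(2) by unfold_locales (simp add: realises_def)
  have rE: "\<And>b. b \<in> carrier B \<Longrightarrow> r (inc E b) = \<iota> b" "\<And>x. x \<in> carrier (middle E) \<Longrightarrow> \<pi> (r x) = \<phi> (prj E x)"
    using E(2) by (auto simp: realises_def)
  have rF: "\<And>b. b \<in> carrier B \<Longrightarrow> r' (inc F b) = \<iota> b" "\<And>x. x \<in> carrier (middle F) \<Longrightarrow> \<pi> (r' x) = \<psi> (prj F x)"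
    using F(2) by (auto simp: realises_def)
  have \<chi>: "\<chi> \<in> hom A I"
    unfolding \<chi>_def using hom_mult_pointwise[OF A.is_group I.comm_group_axioms \<phi> \<psi>] by simp
  have \<chi>a: "\<chi> a = \<phi> a \<otimes>\<^bsub>I\<^esub> \<psi> a" if "a \<in> carrier A" for a using that by (simp add: \<chi>_def)
  interpret P: abelian_extension A B "pullback \<chi>" by (rule abelian_extension_pullback[OF \<chi>])
  interpret EF: comm_group "middle E \<times>\<times> middle F"
    by (rule comm_group_DirProd[OF E.M.comm_group_axioms F.M.comm_group_axioms])
  define S where "S = {(x, y). x \<in> carrier (middle E) \<and> y \<in> carrier (middle F) \<and> prj E x = prj F y}"
  define fp where "fp = fibre_product E F"
  have fp: "fp = (middle E \<times>\<times> middle F)\<lparr>carrier := S\<rparr>" by (simp add: fp_def fibre_product_def S_def)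
  have "subgroup S (middle E \<times>\<times> middle F)"
    by (rule EF.subgroupI) (auto simp: S_def intro!: exI[of _ "\<one>\<^bsub>middle E\<^esub>"] exI[of _ "\<one>\<^bsub>middle F\<^esub>"])
  then interpret fp: comm_group fp unfolding fp by (rule EF.comm_group_subgroup)
  define k where "k z = (prj E (fst z), r (fst z) \<otimes>\<^bsub>D\<^esub> r' (snd z))" for z
  have "k \<in> hom fp (middle (pullback \<chi>))"
  proof (rule homI)
    show "k z \<in> carrier (middle (pullback \<chi>))" if "z \<in> carrier fp" for z
      using that rE rF \<chi>a by (auto simp: fp S_def k_def)
    show "k (z \<otimes>\<^bsub>fp\<^esub> w) = k z \<otimes>\<^bsub>middle (pullback \<chi>)\<^esub> k w" if "z \<in> carrier fp" "w \<in> carrier fp" for z w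
    proof -
      obtain x y x' y' where zw: "z = (x, y)" "w = (x', y')" by (metis surj_pair)
      then have "x \<in> carrier (middle E)" "y \<in> carrier (middle F)" "x' \<in> carrier (middle E)" "y' \<in> carrier (middle F)"
        using that by (simp_all add: fp S_def)
      then show ?thesis by (simp add: zw fp k_def D.m_ac)
    qed
  qed
  then interpret k: group_hom fp "middle (pullback \<chi>)" k by unfold_locales
  define K where "K = antidiagonal B E F"
  have K: "K = kernel fp (middle (pullback \<chi>)) k"
  proof
    show "K \<subseteq> kernel fp (middle (pullback \<chi>)) k"
      using rE rF by (auto simp: K_def antidiagonal_def kernel_def fp S_def k_def)
    show "kernel fp (middle (pullback \<chi>)) k \<subseteq> K"
    proof (rule subrelI)
      fix x y assume "(x, y) \<in> kernel fp (middle (pullback \<chi>)) k"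
      then have xy: "x \<in> carrier (middle E)" "y \<in> carrier (middle F)" "prj E x = prj F y" "prj E x = \<one>\<^bsub>A\<^esub>"
        "r x \<otimes>\<^bsub>D\<^esub> r' y = \<one>\<^bsub>D\<^esub>" by (auto simp: kernel_def fp S_def k_def)
      obtain b where b: "b \<in> carrier B" "x = inc E b" using E.prj_eq_oneE xy by metis
      obtain c where c: "c \<in> carrier B" "y = inc F c" using F.prj_eq_oneE xy by metis
      have "\<iota> (b \<otimes>\<^bsub>B\<^esub> c) = \<iota> \<one>\<^bsub>B\<^esub>" using xy(5) b c rE rF by simp
      then have "b \<otimes>\<^bsub>B\<^esub> c = \<one>\<^bsub>B\<^esub>" using b c \<iota>_inj by blast
      then have "c = inv\<^bsub>B\<^esub> b" using b c by (metis B.inv_equality B.m_comm)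
      then show "(x, y) \<in> K" using b c by (auto simp: K_def antidiagonal_def)
    qed
  qed
  have onto: "k ` carrier fp = carrier (middle (pullback \<chi>))"
  proof
    show "k ` carrier fp \<subseteq> carrier (middle (pullback \<chi>))" using k.hom_closed by blast
    show "carrier (middle (pullback \<chi>)) \<subseteq> k ` carrier fp"
    proof (rule subrelI)
      fix a d assume "(a, d) \<in> carrier (middle (pullback \<chi>))"
      then have ad: "a \<in> carrier A" "d \<in> carrier D" "\<phi> a \<otimes>\<^bsub>I\<^esub> \<psi> a = \<pi> d" using \<chi>a by auto
      obtain x where x: "x \<in> carrier (middle E)" "prj E x = a" using E.prj_surj[OF ad(1)] .
      obtain y where y: "y \<in> carrier (middle F)" "prj F y = a" using F.prj_surj[OF ad(1)] .
      \<comment> \<open>\<open>c\<close> and \<open>d\<close> have the same image in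
        \<open>I\<close>; their discrepancy is some \<open>\<iota> b\<close>, which is absorbed by
        moving \<open>x\<close> along \<open>inc E b\<close>.\<close>
      define c where "c = r x \<otimes>\<^bsub>D\<^esub> r' y"
      have cD: "c \<in> carrier D" using x y by (simp add: c_def)
      have "\<pi> c = \<pi> d" using x y ad rE rF by (simp add: c_def)
      then have "\<pi> (inv\<^bsub>D\<^esub> c \<otimes>\<^bsub>D\<^esub> d) = \<one>\<^bsub>I\<^esub>" using cD ad by simp
      then obtain b where b: "b \<in> carrier B" "inv\<^bsub>D\<^esub> c \<otimes>\<^bsub>D\<^esub> d = \<iota> b"
        using \<pi>_eq_oneD cD ad by (metis D.inv_closed D.m_closed)
      then have "d = c \<otimes>\<^bsub>D\<^esub> \<iota> b"
        using cD ad by (metis D.inv_closed D.inv_solve_left' \<iota>.hom_closed)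
      then have "(a, d) = k (x \<otimes>\<^bsub>middle E\<^esub> inc E b, y)"
        using x y b rE ad(1) by (simp add: k_def c_def D.m_ac)
      moreover have "(x \<otimes>\<^bsub>middle E\<^esub> inc E b, y) \<in> carrier fp" using x y b ad(1) by (simp add: fp S_def)
      ultimately show "(a, d) \<in> k ` carrier fp" by blast
    qed
  qed
  define h where "h X = the_elem (k ` X)" for X
  have iso: "h \<in> iso (fp Mod K) (middle (pullback \<chi>))"
    unfolding h_def K by (rule k.FactGroup_iso_set[OF onto])
  \<comment> \<open>\<open>k\<close> is constant on cosets of its kernel, so \<open>the_elem\<close>
    in \<open>h\<close> and the choice in \<open>prj\<close> of the Baer sum may be evaluated at any
    representative.\<close>
  have kX: "k w = k z" if z: "z \<in> carrier fp" "w \<in> K #>\<^bsub>fp\<^esub> z" for z w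
  proof -
    have "\<exists>u\<in>K. w = u \<otimes>\<^bsub>fp\<^esub> z" using z(2) unfolding r_coset_def by blast
    then obtain u where "u \<in> K" "w = u \<otimes>\<^bsub>fp\<^esub> z" by blast
    moreover from \<open>u \<in> K\<close> have "u \<in> carrier fp" "k u = \<one>\<^bsub>middle (pullback \<chi>)\<^esub>"
      unfolding K kernel_def by blast+
    ultimately show ?thesis
      using z(1) by (simp only: k.hom_mult k.hom_closed P.M.l_one)
  qed
  have z_in: "z \<in> K #>\<^bsub>fp\<^esub> z" if "z \<in> carrier fp" for z
    by (rule fp.rcos_self[OF that]) (simp add: K k.subgroup_kernel)
  have h_coset: "h (K #>\<^bsub>fp\<^esub> z) = k z" if "z \<in> carrier fp" for z
  proof -
    have "k ` (K #>\<^bsub>fp\<^esub> z) = {k z}" using kX[OF that] z_in[OF that] by blast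
    then show ?thesis by (simp add: h_def)
  qed
  have baer: "baer_sum B E F = \<lparr>middle = fp Mod K, inc = (\<lambda>b. K #>\<^bsub>fp\<^esub> (inc E b, \<one>\<^bsub>middle F\<^esub>)),
      prj = (\<lambda>X. prj E (fst (SOME z. z \<in> X)))\<rparr>"
    by (simp add: baer_sum_def fp_def K_def)
  have inc_fp: "(inc E b, \<one>\<^bsub>middle F\<^esub>) \<in> carrier fp" if "b \<in> carrier B" for b
    using that by (simp add: fp S_def)
  show "ext_equiv B (baer_sum B E F) (pullback \<chi>)"
    unfolding ext_equiv_def
  proof (intro bexI[of _ h] conjI ballI)
    show "h \<in> iso (middle (baer_sum B E F)) (middle (pullback \<chi>))" using iso by (simp add: baer)
    show "h (inc (baer_sum B E F) b) = inc (pullback \<chi>) b" if "b \<in> carrier B" for b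
      using that inc_fp rE h_coset by (simp add: baer k_def)
    show "prj (pullback \<chi>) (h X) = prj (baer_sum B E F) X" if X: "X \<in> carrier (middle (baer_sum B E F))" for X
    proof -
      obtain z where z: "z \<in> carrier fp" "X = K #>\<^bsub>fp\<^esub> z" using X by (auto simp: baer carrier_FactGroup)
      have "(SOME z. z \<in> X) \<in> X" using z_in[OF z(1)] z(2) by (metis someI)
      then have "k (SOME z. z \<in> X) = k z" using kX z by blast
      then show ?thesis using h_coset[OF z(1)] z(2) by (simp add: baer k_def)
    qed
  qed
  have "comm_group (fp Mod K)"
    by (rule fp.abelian_FactGroup) (simp add: K k.subgroup_kernel)
  then show "group (middle (baer_sum B E F))" by (simp add: baer comm_group.axioms(2))
  show "inc (baer_sum B E F) ` carrier B \<subseteq> carrier (middle (baer_sum B E F))"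
    using inc_fp by (auto simp: baer carrier_FactGroup)
qed

text \<open>All pairs of representatives yield the same class, and both classes are inhabited, so
  the union in the definition of \<open>Ext\<close> collapses to that class.\<close>

lemma cls_mult:
  assumes \<phi>: "\<phi> \<in> hom A I" and \<psi>: "\<psi> \<in> hom A I"
  shows "cls \<phi> \<otimes>\<^bsub>Ext A B\<^esub> cls \<psi> = cls (\<phi> \<otimes>\<^bsub>hom_group A I\<^esub> \<psi>)"
proof -
  have "ext_class A B (baer_sum B E F) = cls (\<phi> \<otimes>\<^bsub>hom_group A I\<^esub> \<psi>)" if EF: "E \<in> cls \<phi>" "F \<in> cls \<psi>" for E F
  proof -
    obtain r r' where *: "is_extension A B E" "realises E \<phi> r" "is_extension A B F" "realises F \<psi> r'"
      using EF mem_cls_iff \<phi> \<psi> by blast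
    show ?thesis unfolding cls_def
      by (rule ext_class_eqI) (rule baer_sum_equiv_pullback[OF * \<phi> \<psi>])+
  qed
  moreover obtain E F where "E \<in> cls \<phi>" "F \<in> cls \<psi>" using cls_nonempty \<phi> \<psi> by metis
  ultimately have "(\<Union>E\<in>cls \<phi>. \<Union>F\<in>cls \<psi>. ext_class A B (baer_sum B E F)) = cls (\<phi> \<otimes>\<^bsub>hom_group A I\<^esub> \<psi>)"
    by auto
  then show ?thesis by (simp add: Ext_def)
qed

lemma is_extension_split: "is_extension A B (split_extension A B)"
  unfolding is_extension_def split_extension_def
  using comm_group_DirProd[OF A.comm_group_axioms B.comm_group_axioms]
  by (auto simp: mon_def epi_def hom_def inj_on_def kernel_def intro!: image_eqI[of _ fst "(a, \<one>\<^bsub>B\<^esub>)" for a])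

text \<open>Exactness at Hom(A,I). A lift \<open>\<chi>\<close> extends by \<open>\<iota>\<close> to
  a map on the direct product that realises \<open>\<phi>\<close>; conversely, a splitting followed
  by a realising map is a lift.\<close>

lemma cls_eq_one_iff:
  assumes \<phi>: "\<phi> \<in> hom A I"
  shows "cls \<phi> = \<one>\<^bsub>Ext A B\<^esub> \<longleftrightarrow> (\<exists>\<chi>\<in>hom A D. \<forall>a\<in>carrier A. \<phi> a = \<pi> (\<chi> a))"
proof
  interpret S: abelian_extension A B "split_extension A B" by unfold_locales (rule is_extension_split)
  have one: "\<one>\<^bsub>Ext A B\<^esub> = ext_class A B (split_extension A B)" by (simp add: Ext_def)
  show "cls \<phi> = \<one>\<^bsub>Ext A B\<^esub>" if lift: "\<exists>\<chi>\<in>hom A D. \<forall>a\<in>carrier A. \<phi> a = \<pi> (\<chi> a)"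
  proof -
    obtain \<chi> where \<chi>: "\<chi> \<in> hom A D" "\<And>a. a \<in> carrier A \<Longrightarrow> \<phi> a = \<pi> (\<chi> a)" using lift by blast
    interpret \<chi>: group_hom A D \<chi> by unfold_locales (rule \<chi>)
    have "realises (split_extension A B) \<phi> (\<lambda>(a, b). \<chi> a \<otimes>\<^bsub>D\<^esub> \<iota> b)"
      using \<chi> by (auto simp: realises_def split_extension_def hom_def D.m_ac)
    then show ?thesis unfolding one using ext_class_eq_cls[OF is_extension_split \<phi>] by simp
  qed
  assume eq: "cls \<phi> = \<one>\<^bsub>Ext A B\<^esub>"
  obtain F where F: "F \<in> cls \<phi>" using cls_nonempty[OF \<phi>] .
  then have "ext_equiv B (split_extension A B) F" unfolding eq one by (simp add: ext_class_def)
  then obtain h where h: "h \<in> hom (A \<times>\<times> B) (middle F)" "\<And>x. x \<in> carrier A \<times> carrier B \<Longrightarrow> prj F (h x) = fst x"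
    by (auto simp: ext_equiv_def split_extension_def iso_def)
  obtain r where r: "realises F \<phi> r" using F mem_cls_iff[OF \<phi>] by blast
  have rh: "r \<in> hom (middle F) D" using r by (simp add: realises_def)
  have "(\<lambda>a. r (h (a, \<one>\<^bsub>B\<^esub>))) \<in> hom A D"
    by (rule hom_comp[OF hom_comp[OF hom_DirProd_left h(1)] rh]) auto
  moreover have "\<phi> a = \<pi> (r (h (a, \<one>\<^bsub>B\<^esub>)))" if a: "a \<in> carrier A" for a
  proof -
    have "h (a, \<one>\<^bsub>B\<^esub>) \<in> carrier (middle F)" using hom_in_carrier[OF h(1)] a by simp
    then show ?thesis using r h(2)[of "(a, \<one>\<^bsub>B\<^esub>)"] a by (simp add: realises_def)
  qed
  ultimately show "\<exists>\<chi>\<in>hom A D. \<forall>a\<in>carrier A. \<phi> a = \<pi> (\<chi> a)"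
    by (intro bexI[of _ "\<lambda>a. r (h (a, \<one>\<^bsub>B\<^esub>))"] ballI)
qed

lemma cls_hom: "cls \<in> hom (hom_group A I) (Ext A B)"
  using cls_mult carrier_Ext by (auto simp: hom_def simp del: hom_group_simps(2))

lemma cls_one: "cls \<one>\<^bsub>hom_group A I\<^esub> = \<one>\<^bsub>Ext A B\<^esub>"
proof -
  interpret H: comm_group "hom_group A I" by (rule comm_group_hom_group) (auto intro: I.comm_group_axioms)
  have "(\<lambda>_. \<one>\<^bsub>D\<^esub>) \<in> hom A D" by (auto simp: hom_def)
  then have "\<exists>\<chi>\<in>hom A D. \<forall>a\<in>carrier A. \<one>\<^bsub>hom_group A I\<^esub> a = \<pi> (\<chi> a)"
    by (intro bexI[of _ "\<lambda>_. \<one>\<^bsub>D\<^esub>"]) auto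
  moreover have "\<one>\<^bsub>hom_group A I\<^esub> \<in> hom A I" using H.one_closed by (simp del: hom_group_simps(3))
  ultimately show ?thesis using cls_eq_one_iff by blast
qed

text \<open>\<open>Ext A B\<close> is the image of the commutative group of homomorphisms from
  \<open>A\<close> to \<open>I\<close> under the multiplicative map \<open>cls\<close>, and this
  transfers all the group laws to the Baer sum.\<close>

lemma comm_group_Ext: "comm_group (Ext A B)"
proof -
  interpret H: comm_group "hom_group A I" by (rule comm_group_hom_group) (auto intro: I.comm_group_axioms)
  have "comm_group (Ext A B\<lparr>carrier := cls ` carrier (hom_group A I), one := cls \<one>\<^bsub>hom_group A I\<^esub>\<rparr>)"
    by (rule H.hom_imp_img_comm_group[OF cls_hom])
  then show ?thesis unfolding cls_one carrier_Ext[symmetric] by simp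
qed

end

section \<open>The torsion of \<open>Ext\<close>\<close>

lemma (in comm_group) subgroup_torsion_part: "subgroup (torsion_part p G) G"
  by (rule subgroupI)
    (auto simp: torsion_part_def nat_pow_distrib nat_pow_inv intro!: exI[of _ \<one>])

section \<open>Cardinal estimates\<close>

lemma card_of_nat_bool: "|UNIV :: (nat \<Rightarrow> bool) set| =o ctwo ^c natLeq"
proof -
  have "Func (UNIV :: nat set) (UNIV :: bool set) = UNIV" by (auto simp: Func_def)
  then have "ctwo ^c natLeq = |UNIV :: (nat \<Rightarrow> bool) set|"
    by (simp add: cexp_def ctwo_def Field_natLeq)
  then show ?thesis by (simp add: card_of_refl)
qed

text \<open>\<open>X\<close> is the union of its fibres. The image is infinite, since otherwise
  \<open>X\<close> would be countable, and an infinite cardinal absorbs countable factors.\<close>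

lemma card_of_ordLeq_image_countable_fibres:
  assumes "uncountable X" and fib: "\<And>x. x \<in> X \<Longrightarrow> countable {y \<in> X. f y = f x}"
  shows "|X| \<le>o |f ` X|"
proof -
  have X: "X = (\<Union>z\<in>f ` X. {y \<in> X. f y = z})" by auto
  have fib': "countable {y \<in> X. f y = z}" if "z \<in> f ` X" for z using that fib by auto
  have inf: "infinite (f ` X)"
  proof
    assume "finite (f ` X)"
    then have "countable (\<Union>z\<in>f ` X. {y \<in> X. f y = z})" using fib' by (intro countable_UN) (auto simp: countable_finite)
    then show False using X assms(1) by simp
  qed
  have "|\<Union>z\<in>f ` X. {y \<in> X. f y = z}| \<le>o |f ` X|"
  proof (rule card_of_UNION_ordLeq_infinite[OF inf])
    show "\<forall>z\<in>f ` X. |{y \<in> X. f y = z}| \<le>o |f ` X|"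
    proof
      fix z assume "z \<in> f ` X"
      then have "|{y \<in> X. f y = z}| \<le>o natLeq" using fib' countable_card_le_natLeq by blast
      moreover have "natLeq \<le>o |f ` X|" using inf infinite_iff_natLeq_ordLeq by blast
      ultimately show "|{y \<in> X. f y = z}| \<le>o |f ` X|" by (rule ordLeq_transitive)
    qed
  qed (rule card_of_mono1, simp)
  then show ?thesis using X by simp
qed

text \<open>A homomorphism is determined by its graph, a subset of a countable set.\<close>

lemma card_of_hom_group_ordLeq:
  assumes "countable (carrier A)" "countable (carrier W)"
  shows "|carrier (hom_group A W)| \<le>o ctwo ^c natLeq"
proof -
  let ?S = "carrier A \<times> carrier W"
  have "|carrier (hom_group A W)| \<le>o |Pow ?S|"
  proof (rule card_of_ordLeqI)
    let ?g = "\<lambda>f. (\<lambda>a. (a, f a)) ` carrier A"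
    show "inj_on ?g (carrier (hom_group A W))"
    proof (rule inj_onI)
      fix f h assume fh: "f \<in> carrier (hom_group A W)" "h \<in> carrier (hom_group A W)" "?g f = ?g h"
      show "f = h"
      proof (rule extensionalityI)
        fix a assume "a \<in> carrier A"
        then have "(a, f a) \<in> ?g h" unfolding fh(3)[symmetric] by blast
        then show "f a = h a" by auto
      qed (use fh in auto)
    qed
    show "?g f \<in> Pow ?S" if "f \<in> carrier (hom_group A W)" for f
      using that hom_in_carrier by fastforce
  qed
  also have "|Pow ?S| \<le>o |Pow (UNIV :: nat set)|"
  proof (rule card_of_Pow_mono)
    have "countable ?S" using assms by blast
    then have "|?S| \<le>o natLeq" by (simp flip: countable_card_le_natLeq)
    then show "|?S| \<le>o |UNIV :: nat set|"
      using card_of_nat ordIso_symmetric ordLeq_ordIso_trans by blast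
  qed
  also have "|Pow (UNIV :: nat set)| =o |Func (UNIV :: nat set) (UNIV :: bool set)|"
    by (rule card_of_Pow_Func)
  also have "|Func (UNIV :: nat set) (UNIV :: bool set)| = ctwo ^c natLeq"
    by (simp add: cexp_def ctwo_def Field_natLeq)
  finally show ?thesis .
qed

section \<open>The p-torsion of Ext as a cokernel\<close>

context ext_resolution
begin

lemma divisible_Ext:
  assumes "torsion_free A"
  shows "divisible (Ext A B)"
proof (rule divisible_epi[OF _ _ cls_hom carrier_Ext[symmetric]])
  show "group (hom_group A I)"
    by (rule comm_group.axioms(2)[OF comm_group_hom_group]) (auto intro: I.comm_group_axioms)
  show "group (Ext A B)" by (rule comm_group.axioms(2)[OF comm_group_Ext])
  show "divisible (hom_group A I)"
    by (rule divisible_hom_group[OF A.comm_group_axioms assms I.comm_group_axioms divI])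
qed

definition torsion_I :: "nat \<Rightarrow> ('i, 'l) monoid_scheme" where
  "torsion_I p = I\<lparr>carrier := torsion_part p I\<rparr>"

text \<open>The largest subgroup of \<open>D\<close> that \<open>\<pi>\<close> maps into the
  torsion: every lift to \<open>D\<close> of a map into \<open>torsion_I p\<close> takes its values
  here.\<close>

definition torsion_D :: "nat \<Rightarrow> ('d, 'k) monoid_scheme" where
  "torsion_D p = D\<lparr>carrier := {d \<in> carrier D. \<pi> d \<in> torsion_part p I}\<rparr>"

lemma comm_group_torsion_I: "comm_group (torsion_I p)"
  unfolding torsion_I_def by (rule I.comm_group_subgroup[OF I.subgroup_torsion_part])

lemma comm_group_torsion_D: "comm_group (torsion_D p)"
  unfolding torsion_D_def
  by (rule D.comm_group_subgroup[OF hom_vimage_subgroup[OF D.is_group I.is_group \<pi>.homh I.subgroup_torsion_part]])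

lemma hom_torsion_I: "f \<in> hom A (torsion_I p) \<longleftrightarrow> f \<in> hom A I \<and> (\<forall>a\<in>carrier A. f a [^]\<^bsub>I\<^esub> p = \<one>\<^bsub>I\<^esub>)"
  by (auto simp: torsion_I_def torsion_part_def hom_def Pi_iff)

lemma hom_group_torsion_I: "hom_group A (torsion_I p) = (hom_group A I)\<lparr>carrier := carrier (hom_group A (torsion_I p))\<rparr>"
  by (simp add: hom_group_def torsion_I_def)

text \<open>Equality of classes means that the quotient of the two maps lifts to \<open>D\<close>.
  That quotient has \<open>p\<close>-torsion values, so the lift lands in \<open>torsion_D p\<close>
  by itself.\<close>

lemma cls_eq_iff:
  assumes "\<phi> \<in> carrier (hom_group A (torsion_I p))" "\<psi> \<in> carrier (hom_group A (torsion_I p))"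
  shows "cls \<phi> = cls \<psi> \<longleftrightarrow> \<phi> \<otimes>\<^bsub>hom_group A (torsion_I p)\<^esub> inv\<^bsub>hom_group A (torsion_I p)\<^esub> \<psi>
     \<in> hom_post A \<pi> ` carrier (hom_group A (torsion_D p))"
proof -
  interpret H: comm_group "hom_group A I" by (rule comm_group_hom_group) (auto intro: I.comm_group_axioms)
  interpret X: comm_group "Ext A B" by (rule comm_group_Ext)
  interpret cls: group_hom "hom_group A I" "Ext A B" cls by unfold_locales (rule cls_hom)
  interpret HT: comm_group "hom_group A (torsion_I p)"
    by (rule comm_group_hom_group) (auto intro: comm_group_torsion_I)
  have sub: "subgroup (carrier (hom_group A (torsion_I p))) (hom_group A I)"
  proof (rule H.group_incl_imp_subgroup)
    show "carrier (hom_group A (torsion_I p)) \<subseteq> carrier (hom_group A I)" by (auto simp: hom_torsion_I)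
    show "group (hom_group A I\<lparr>carrier := carrier (hom_group A (torsion_I p))\<rparr>)"
      unfolding hom_group_torsion_I[symmetric] by (rule HT.is_group)
  qed
  have c: "\<phi> \<in> carrier (hom_group A I)" "\<psi> \<in> carrier (hom_group A I)"
    using assms subgroup.subset[OF sub] by auto
  define \<xi> where "\<xi> = \<phi> \<otimes>\<^bsub>hom_group A I\<^esub> inv\<^bsub>hom_group A I\<^esub> \<psi>"
  have "inv\<^bsub>hom_group A (torsion_I p)\<^esub> \<psi> = inv\<^bsub>hom_group A I\<^esub> \<psi>"
    using H.m_inv_consistent[OF sub assms(2)] unfolding hom_group_torsion_I[symmetric] .
  then have \<xi>: "\<phi> \<otimes>\<^bsub>hom_group A (torsion_I p)\<^esub> inv\<^bsub>hom_group A (torsion_I p)\<^esub> \<psi> = \<xi>"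
    by (simp add: \<xi>_def torsion_I_def)
  have \<xi>T: "\<xi> \<in> carrier (hom_group A (torsion_I p))"
    unfolding \<xi>[symmetric] using assms HT.m_closed HT.inv_closed by blast
  have "cls \<xi> = cls \<phi> \<otimes>\<^bsub>Ext A B\<^esub> inv\<^bsub>Ext A B\<^esub> cls \<psi>"
    unfolding \<xi>_def using c by (simp only: cls.hom_mult cls.hom_inv H.inv_closed)
  moreover have "cls \<phi> \<in> carrier (Ext A B)" "cls \<psi> \<in> carrier (Ext A B)"
    using c cls.hom_closed by blast+
  ultimately have "cls \<phi> = cls \<psi> \<longleftrightarrow> cls \<xi> = \<one>\<^bsub>Ext A B\<^esub>"
    by (simp add: X.inv_solve_right')
  also have "\<dots> \<longleftrightarrow> (\<exists>\<chi>\<in>hom A D. \<forall>a\<in>carrier A. \<xi> a = \<pi> (\<chi> a))"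
    using \<xi>T by (intro cls_eq_one_iff) (simp add: hom_torsion_I)
  also have "\<dots> \<longleftrightarrow> \<xi> \<in> hom_post A \<pi> ` carrier (hom_group A (torsion_D p))"
  proof
    assume "\<exists>\<chi>\<in>hom A D. \<forall>a\<in>carrier A. \<xi> a = \<pi> (\<chi> a)"
    then obtain \<chi> where \<chi>: "\<chi> \<in> hom A D" "\<And>a. a \<in> carrier A \<Longrightarrow> \<xi> a = \<pi> (\<chi> a)" by blast
    define \<chi>' where "\<chi>' = restrict \<chi> (carrier A)"
    have "\<xi> = hom_post A \<pi> \<chi>'"
      using \<xi>T \<chi>(2) by (intro extensionalityI[of _ "carrier A"]) (auto simp: hom_post_def \<chi>'_def)
    moreover have "\<chi>' \<in> carrier (hom_group A (torsion_D p))"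
    proof (rule hom_groupI)
      show "\<chi>' a \<in> carrier (torsion_D p)" if a: "a \<in> carrier A" for a
        using a hom_in_carrier[OF \<chi>(1) a] \<chi>(2)[OF a] \<xi>T
        by (auto simp: \<chi>'_def torsion_D_def hom_torsion_I torsion_part_def)
    qed (use \<chi>(1) in \<open>auto simp: \<chi>'_def torsion_D_def hom_mult\<close>)
    ultimately show "\<xi> \<in> hom_post A \<pi> ` carrier (hom_group A (torsion_D p))" by blast
  next
    assume "\<xi> \<in> hom_post A \<pi> ` carrier (hom_group A (torsion_D p))"
    then obtain \<chi> where \<chi>: "\<chi> \<in> hom A (torsion_D p)" "\<xi> = hom_post A \<pi> \<chi>" by auto
    then have "\<chi> \<in> hom A D" by (auto simp: torsion_D_def hom_def)
    then show "\<exists>\<chi>\<in>hom A D. \<forall>a\<in>carrier A. \<xi> a = \<pi> (\<chi> a)"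
      using \<chi>(2) by (intro bexI[of _ \<chi>]) (auto simp: hom_post_def)
  qed
  finally show ?thesis unfolding \<xi> .
qed

text \<open>If the class of \<open>\<phi>\<close> is killed by \<open>p\<close>, then the
  \<open>p\<close>-th power of \<open>\<phi>\<close> lifts to some \<open>\<chi>\<close> into
  \<open>D\<close>. Divisibility of the group of homomorphisms from \<open>A\<close> to
  \<open>D\<close> gives a \<open>p\<close>-th root \<open>\<omega>\<close> of
  \<open>\<chi>\<close>; dividing \<open>\<phi>\<close> by \<open>\<pi> \<circ> \<omega>\<close>
  preserves the class and leaves a map with \<open>p\<close>-torsion values.\<close>

lemma torsion_part_Ext:
  assumes "torsion_free A" "p > 0"
  shows "torsion_part p (Ext A B) = cls ` carrier (hom_group A (torsion_I p))"
proof
  interpret H: comm_group "hom_group A I" by (rule comm_group_hom_group) (auto intro: I.comm_group_axioms)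
  interpret HD: comm_group "hom_group A D" by (rule comm_group_hom_group) (auto intro: D.comm_group_axioms)
  interpret X: comm_group "Ext A B" by (rule comm_group_Ext)
  interpret cls: group_hom "hom_group A I" "Ext A B" cls by unfold_locales (rule cls_hom)
  interpret post: group_hom "hom_group A D" "hom_group A I" "hom_post A \<pi>"
    by unfold_locales (rule hom_post_hom[OF A.is_group D.comm_group_axioms I.comm_group_axioms \<pi>.homh])
  have pow: "(f [^]\<^bsub>hom_group A I\<^esub> p) a = f a [^]\<^bsub>I\<^esub> p" if "f \<in> carrier (hom_group A I)" "a \<in> carrier A" for f a
    by (rule hom_nat_pow[OF eval_hom_group[OF that(2)] that(1) H.is_group I.is_group])
  have post_one: "cls (hom_post A \<pi> \<chi>) = \<one>\<^bsub>Ext A B\<^esub>" if "\<chi> \<in> carrier (hom_group A D)" for \<chi>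
    using that post.hom_closed[OF that] by (subst cls_eq_one_iff) (auto simp: hom_post_def)
  show "cls ` carrier (hom_group A (torsion_I p)) \<subseteq> torsion_part p (Ext A B)"
  proof (rule image_subsetI)
    fix \<phi> assume \<phi>: "\<phi> \<in> carrier (hom_group A (torsion_I p))"
    then have c: "\<phi> \<in> carrier (hom_group A I)" by (simp add: hom_torsion_I)
    have "\<phi> [^]\<^bsub>hom_group A I\<^esub> p = \<one>\<^bsub>hom_group A I\<^esub>"
    proof (rule extensionalityI[of _ "carrier A"])
      show "\<phi> [^]\<^bsub>hom_group A I\<^esub> p \<in> extensional (carrier A)" using H.nat_pow_closed[OF c, of p] by simp
      show "(\<phi> [^]\<^bsub>hom_group A I\<^esub> p) a = \<one>\<^bsub>hom_group A I\<^esub> a" if "a \<in> carrier A" for a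
        using pow[OF c that] \<phi> that by (simp add: hom_torsion_I)
    qed simp
    then have "cls \<phi> [^]\<^bsub>Ext A B\<^esub> p = \<one>\<^bsub>Ext A B\<^esub>"
      using cls.hom_nat_pow[OF c, of p] cls.hom_one by (simp del: hom_group_simps)
    then show "cls \<phi> \<in> torsion_part p (Ext A B)"
      using cls.hom_closed[OF c] by (simp add: torsion_part_def)
  qed
  show "torsion_part p (Ext A B) \<subseteq> cls ` carrier (hom_group A (torsion_I p))"
  proof
    fix X assume X: "X \<in> torsion_part p (Ext A B)"
    then obtain \<phi> where \<phi>: "\<phi> \<in> carrier (hom_group A I)" "X = cls \<phi>"
      unfolding torsion_part_def carrier_Ext by blast
    have "cls (\<phi> [^]\<^bsub>hom_group A I\<^esub> p) = \<one>\<^bsub>Ext A B\<^esub>"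
      using X cls.hom_nat_pow[OF \<phi>(1), of p] by (simp add: \<phi>(2) torsion_part_def)
    moreover have "\<phi> [^]\<^bsub>hom_group A I\<^esub> p \<in> hom A I" using H.nat_pow_closed[OF \<phi>(1), of p] by simp
    ultimately obtain \<chi> where \<chi>: "\<chi> \<in> hom A D" "\<And>a. a \<in> carrier A \<Longrightarrow> (\<phi> [^]\<^bsub>hom_group A I\<^esub> p) a = \<pi> (\<chi> a)"
      using cls_eq_one_iff by blast
    have "restrict \<chi> (carrier A) \<in> carrier (hom_group A D)"
      using \<chi>(1) by (auto simp: hom_def)
    then obtain \<omega> where \<omega>: "\<omega> \<in> carrier (hom_group A D)" "\<omega> [^]\<^bsub>hom_group A D\<^esub> p = restrict \<chi> (carrier A)"
      using divisibleD[OF divisible_hom_group[OF A.comm_group_axioms assms(1) D.comm_group_axioms divD]] assms(2)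
      by metis
    have \<omega>a: "\<omega> a [^]\<^bsub>D\<^esub> p = \<chi> a" "\<omega> a \<in> carrier D" if "a \<in> carrier A" for a
      using hom_nat_pow[OF eval_hom_group[OF that] \<omega>(1) HD.is_group D.is_group, of p] \<omega> that hom_in_carrier
      by fastforce+
    define \<psi> where "\<psi> = \<phi> \<otimes>\<^bsub>hom_group A I\<^esub> inv\<^bsub>hom_group A I\<^esub> hom_post A \<pi> \<omega>"
    have post: "hom_post A \<pi> \<omega> \<in> carrier (hom_group A I)" by (rule post.hom_closed[OF \<omega>(1)])
    have \<psi>: "\<psi> \<in> carrier (hom_group A I)"
      unfolding \<psi>_def by (rule H.m_closed[OF \<phi>(1) H.inv_closed[OF post]])
    have "\<psi> a [^]\<^bsub>I\<^esub> p = \<one>\<^bsub>I\<^esub>" if a: "a \<in> carrier A" for a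
    proof -
      have \<phi>a: "\<phi> a \<in> carrier I" using \<phi>(1) a hom_in_carrier by fastforce
      have "\<psi> a = \<phi> a \<otimes>\<^bsub>I\<^esub> inv\<^bsub>I\<^esub> \<pi> (\<omega> a)"
        using a inv_hom_group[OF A.is_group I.comm_group_axioms post a] by (simp add: \<psi>_def hom_post_def)
      moreover have "\<phi> a [^]\<^bsub>I\<^esub> p = \<pi> (\<omega> a) [^]\<^bsub>I\<^esub> p"
        using pow[OF \<phi>(1) a] \<chi>(2)[OF a] \<pi>.hom_nat_pow[OF \<omega>a(2)[OF a], of p] \<omega>a(1)[OF a] by simp
      ultimately show ?thesis
        using \<phi>a \<omega>a(2)[OF a] by (simp add: I.nat_pow_distrib I.nat_pow_inv)
    qed
    then have "\<psi> \<in> carrier (hom_group A (torsion_I p))" using \<psi> by (simp add: hom_torsion_I)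
    moreover have "cls \<psi> = cls \<phi> \<otimes>\<^bsub>Ext A B\<^esub> inv\<^bsub>Ext A B\<^esub> cls (hom_post A \<pi> \<omega>)"
      unfolding \<psi>_def using \<phi>(1) post by (simp only: cls.hom_mult cls.hom_inv H.inv_closed)
    then have "X = cls \<psi>"
      using post_one[OF \<omega>(1)] cls.hom_closed[OF \<phi>(1)] \<phi>(2) by simp
    ultimately show "X \<in> cls ` carrier (hom_group A (torsion_I p))" by blast
  qed
qed

text \<open>In the continuum case the lower bound comes from \<open>cls \<circ> q\<close>, whose
  fibres are countable, and the upper bound from the number of homomorphisms between countable
  groups.\<close>

theorem torsion_part_Ext_dichotomy:
  assumes "torsion_free A" "countable (carrier A)" "countable (carrier D)" "p > 0"
  shows "countable (torsion_part p (Ext A B)) \<or> |torsion_part p (Ext A B)| =o ctwo ^c natLeq"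
proof -
  have cI: "countable (carrier I)"
    using \<pi>_epi assms(3) by (metis (mono_tags, lifting) countable_image epi_def mem_Collect_eq)
  have cW: "countable (carrier (torsion_I p))"
    by (rule countable_subset[OF _ cI]) (auto simp: torsion_I_def torsion_part_def)
  have cV: "countable (carrier (torsion_D p))"
    by (rule countable_subset[OF _ assms(3)]) (auto simp: torsion_D_def)
  have \<pi>: "\<pi> \<in> hom (torsion_D p) (torsion_I p)"
    by (auto simp: torsion_D_def torsion_I_def hom_def)
  note T = torsion_part_Ext[OF assms(1,4)]
  show ?thesis
  proof (rule hom_post_dichotomy[OF A.is_group assms(2) comm_group_torsion_D cV comm_group_torsion_I cW \<pi>])
    fix C assume C: "countable C" "C \<subseteq> carrier (hom_group A (torsion_I p))"
      "\<And>y. y \<in> carrier (hom_group A (torsion_I p)) \<Longrightarrow> \<exists>c\<in>C. y \<otimes>\<^bsub>hom_group A (torsion_I p)\<^esub>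
         inv\<^bsub>hom_group A (torsion_I p)\<^esub> c \<in> hom_post A \<pi> ` carrier (hom_group A (torsion_D p))"
    have "torsion_part p (Ext A B) \<subseteq> cls ` C"
      unfolding T
    proof (rule image_subsetI)
      fix y assume y: "y \<in> carrier (hom_group A (torsion_I p))"
      then obtain c where "c \<in> C" "y \<otimes>\<^bsub>hom_group A (torsion_I p)\<^esub>
         inv\<^bsub>hom_group A (torsion_I p)\<^esub> c \<in> hom_post A \<pi> ` carrier (hom_group A (torsion_D p))" using C(3) by blast
      then have "cls y = cls c" using cls_eq_iff[OF y, of c] C(2) by blast
      then show "cls y \<in> cls ` C" using \<open>c \<in> C\<close> by blast
    qed
    then show ?thesis using C(1) countable_image countable_subset by blast
  next
    fix q :: "(nat \<Rightarrow> bool) \<Rightarrow> 'a \<Rightarrow> 'i"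
    assume q: "\<And>s. q s \<in> carrier (hom_group A (torsion_I p))"
      "\<And>s. countable {t. q t \<otimes>\<^bsub>hom_group A (torsion_I p)\<^esub> inv\<^bsub>hom_group A (torsion_I p)\<^esub> q s
         \<in> hom_post A \<pi> ` carrier (hom_group A (torsion_D p))}"
    let ?f = "\<lambda>s. cls (q s)"
    have unc: "uncountable (UNIV :: (nat \<Rightarrow> bool) set)"
    proof
      assume "countable (UNIV :: (nat \<Rightarrow> bool) set)"
      then have "|UNIV :: (nat \<Rightarrow> bool) set| \<le>o natLeq" by (simp flip: countable_card_le_natLeq)
      then have "ctwo ^c natLeq \<le>o natLeq"
        using card_of_nat_bool ordIso_symmetric ordIso_ordLeq_trans by blast
      then show False
        using ordLess_ctwo_cexp[OF natLeq_Card_order] not_ordLess_ordLeq by blast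
    qed
    have "|UNIV :: (nat \<Rightarrow> bool) set| \<le>o |range ?f|"
    proof (rule card_of_ordLeq_image_countable_fibres[OF unc])
      fix s
      have "{t \<in> UNIV. ?f t = ?f s} = {t. q t \<otimes>\<^bsub>hom_group A (torsion_I p)\<^esub> inv\<^bsub>hom_group A (torsion_I p)\<^esub> q s
         \<in> hom_post A \<pi> ` carrier (hom_group A (torsion_D p))}"
        using cls_eq_iff[OF q(1) q(1)] by auto
      then show "countable {t \<in> UNIV. ?f t = ?f s}" using q(2) by simp
    qed
    moreover have "|range ?f| \<le>o |torsion_part p (Ext A B)|"
      unfolding T using q(1) by (intro card_of_mono1) blast
    ultimately have ge: "ctwo ^c natLeq \<le>o |torsion_part p (Ext A B)|"
      using card_of_nat_bool ordIso_symmetric ordIso_ordLeq_trans ordLeq_transitive by blast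
    have "|torsion_part p (Ext A B)| \<le>o |carrier (hom_group A (torsion_I p))|"
      unfolding T by (rule card_of_image)
    then have "|torsion_part p (Ext A B)| \<le>o ctwo ^c natLeq"
      using card_of_hom_group_ordLeq[OF assms(2) cW] ordLeq_transitive by blast
    then show ?thesis using ge by (simp add: ordIso_iff_ordLeq)
  qed
qed

end

theorem theorem2p5:
  fixes p :: nat
    and A :: "('a, 'm) monoid_scheme"
    and B :: "('b, 'n) monoid_scheme"
  assumes "prime p"
    and "comm_group A" and "countable (carrier A)" and "torsion_free A"
    and "comm_group B" and "countable (carrier B)"
  shows "p_rank p (Ext A B) \<le>o natLeq \<or> p_rank p (Ext A B) =o ctwo ^c natLeq"
proof -
  interpret A: comm_group A by fact
  interpret B: comm_group B by fact
  obtain D :: "('b \<Rightarrow> rat) set monoid" and \<iota>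
    where D: "comm_group D" "divisible D" "countable (carrier D)" "\<iota> \<in> mon B D"
    using countable_divisible_embedding[OF assms(5,6)] .
  interpret D: comm_group D by fact
  interpret \<iota>: group_hom B D \<iota> using D(4) by unfold_locales (simp add: mon_def)
  define L where "L = \<iota> ` carrier B"
  have L: "subgroup L D" unfolding L_def by (rule \<iota>.img_is_subgroup)
  interpret L: normal L D by (rule D.subgroup_imp_normal[OF L])
  interpret I: comm_group "D Mod L" by (rule D.abelian_FactGroup[OF L])
  define \<pi> where "\<pi> d = L #>\<^bsub>D\<^esub> d" for d
  interpret ext_resolution A B D "D Mod L" \<iota> \<pi>
  proof
    show "\<iota> \<in> mon B D" by (rule D(4))
    show "\<pi> \<in> epi D (D Mod L)"
      using L.r_coset_hom_Mod unfolding \<pi>_def epi_def carrier_FactGroup by blast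
    show "\<iota> ` carrier B = kernel D (D Mod L) \<pi>"
    proof -
      have "\<pi> d = \<one>\<^bsub>D Mod L\<^esub> \<longleftrightarrow> d \<in> L" if "d \<in> carrier D" for d
        using that D.coset_join1[OF _ that L] D.coset_join2[OF that L] L.subset
        by (auto simp: \<pi>_def)
      then show ?thesis using L.subset unfolding kernel_def L_def[symmetric] by blast
    qed
    show "divisible D" by (rule D(2))
  qed
  have p: "p > 0" using assms(1) by (rule prime_gt_0_nat)
  note Ext = comm_group_Ext divisible_Ext[OF assms(4)] assms(1)
  show ?thesis
  \<comment> \<open>The distinction is made on the torsion and not on the rank: uncountable torsion
    has the cardinality of the rank, and by the dichotomy this is the continuum.\<close>
  proof (cases "countable (torsion_part p (Ext A B))")
    case True
    then show ?thesis using p_rank_countable[OF Ext] by blast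
  next
    case False
    then have "p_rank p (Ext A B) =o ctwo ^c natLeq"
      using p_rank_uncountable[OF Ext] torsion_part_Ext_dichotomy[OF assms(4,3) D(3) p] ordIso_transitive by blast
    then show ?thesis ..
  qed
qed

end
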